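(* Let $\mathcal K$ be a simplicial complex on $[m]=\{1,\dots,m\}$, $m\ge1$, and let $\Delta^{m-1}$ denote the full simplex on $[m]$. (a) For any $\mathcal K$, the $d'$-cohomology of $\Lambda[u_1,\dots,u_m]\otimes\mathbb Z[\mathcal K]$ is zero: $H\bigl(\Lambda[u_1,\dots,u_m]\otimes\mathbb Z[\mathcal K],d'\bigr)=0$. (b) If $\mathcal K\ne\Delta^{m-1}$, then the $d'$-cohomology of the bicomplexes $\bigoplus_{I\subset[m]}C^*(\mathcal K_I)$ and $R^*(\mathcal K)$ is zero: $$H\Bigl(\bigoplus_{I\subset[m]}C^*(\mathcal K_I),d'\Bigr)=H\bigl(R^*(\mathcal K),d'\bigr)=0.$$ Therefore, the second double cohomology and the total cohomology of the bicomplexes $\bigl(\bigoplus_{I\subset[m]}C^*(\mathcal K_I),d,d'\bigr)$ and $\bigl(R^*(\mathcal K),d,d'\bigr)$ are zero unless $\mathcal K=\Delta^{m-1}$. (c) If $\mathcal K=\Delta^{m-1}$, then the only nonzero $d'$-cohomology group of $\bigoplus_{I\subset[m]}C^*(\mathcal K_I)$ and $R^*(\mathcal K)$ is $H^{2m}\cong\mathbb Z$ (total degree $2m$), represented by $\alpha_{[m],[m]}$ and $v_1\cdots v_m$, respectively.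
   Context: $\mathcal K$ contains $\varnothing$ and all singletons; $\mathcal K_I=\{J\in\mathcal K:J\subset I\}$ is the full subcomplex on $I\subset[m]$; $\varepsilon(j,I)=(-1)^{\#\{r\in I: r<j\}}$. (1) $C^*(\mathcal K_I)$ is the augmented simplicial cochain complex over $\mathbb Z$: $C^{q-1}(\mathcal K_I)$ is free on $\alpha_{L,I}$, $L\in\mathcal K_I$, $|L|=q\ge0$, placed in bidegree $(q-|I|,2|I|)$, with $d\alpha_{L,I}=\sum_{j\in I\setminus L,\,L\cup\{j\}\in\mathcal K}\varepsilon(j,L)\alpha_{L\cup\{j\},I}$ and second differential $d'\alpha_{L,I}=(-1)^{|L|}\sum_{i\in I\setminus L}\varepsilon(i,I)\alpha_{L,I\setminus\{i\}}$. (2) $\mathbb Z[\mathcal K]=\mathbb Z[v_1,\dots,v_m]/(\prod_{i\in I}v_i: I\notin\mathcal K)$. The Koszul algebra $\Lambda[u_1,\dots,u_m]\otimes\mathbb Z[\mathcal K]$ has $\mathrm{bideg}\,u_i=(-1,2)$, $\mathrm{bideg}\,v_i=(0,2)$, and two differentials that are derivations (graded Leibniz rule): $du_i=v_i$, $dv_i=0$ and $d'u_i=1$, $d'v_i=0$. (3) $R^*(\mathcal K)\subset\Lambda[u_1,\dots,u_m]\otimes\mathbb Z[\mathcal K]$ is the subgroup with basis the monomials $u_Jv_I$ ($J\subset[m]$, $I\in\mathcal K$, $J\cap I=\varnothing$); it is preserved by $d$ and $d'$: $d(u_Jv_I)=\sum_{k\in J}\varepsilon(k,J)u_{J\setminus\{k\}}v_{I\cup\{k\}}$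 (with $v_{I\cup\{k\}}=0$ if $I\cup\{k\}\notin\mathcal K$), $d'(u_Jv_I)=\sum_{j\in J}\varepsilon(j,J)u_{J\setminus\{j\}}v_I$. The total degree of bidegree $(-k,2\ell)$ is $-k+2\ell$. In each case $dd'=-d'd$. For a bicomplex $(A,d,d')$, the second double cohomology is $H(H(A,d'),d)$ and the total cohomology is $H(A,d+d')$. *)

theory Defs
  imports "HOL-Algebra.QuotRing" "HOL-Algebra.Free_Abelian_Groups" "HOL-Algebra.Elementary_Groups"
begin

section \<open>Simplicial complexes\<close>

definition simplicial_complex_on :: "nat \<Rightarrow> nat set set \<Rightarrow> bool"
  where "simplicial_complex_on m K \<longleftrightarrow>
    K \<subseteq> Pow {1..m} \<and> {} \<in> K \<and> (\<forall>i\<in>{1..m}. {i} \<in> K) \<and> (\<forall>I\<in>K. \<forall>J. J \<subseteq> I \<longrightarrow> J \<in> K)"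

definition full_simplex :: "nat \<Rightarrow> nat set set"
  where "full_simplex m = Pow {1..m}"

definition eps :: "nat \<Rightarrow> nat set \<Rightarrow> int"
  where "eps j I = (- 1) ^ card {r \<in> I. r < j}"


section \<open>Cohomology of differentials and bicomplexes\<close>

text \<open>Abelian groups are group records; they need not be written additively.
  \<open>cohomology_at A B C f\<close> is the cohomology at \<open>B\<close> of \<open>A \<rightarrow> B \<rightarrow> C\<close>, where both maps
  are given by \<open>f\<close>.\<close>

definition cohomology_at ::
    "('a, 'm) monoid_scheme \<Rightarrow> ('a, 'm) monoid_scheme \<Rightarrow> ('a, 'm) monoid_scheme \<Rightarrow> ('a \<Rightarrow> 'a) \<Rightarrow> 'a set monoid"
  where "cohomology_at A B C f = (B\<lparr>carrier := kernel B C f\<rparr>) Mod (f ` carrier A)"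

definition cohomology :: "('a, 'm) monoid_scheme \<Rightarrow> ('a \<Rightarrow> 'a) \<Rightarrow> 'a set monoid"
  where "cohomology A f = cohomology_at A A A f"

text \<open>The map induced on \<open>cohomology A f\<close> by a map \<open>g\<close> anticommuting with \<open>f\<close>: it sends the coset \<open>c\<close>
  of \<open>x\<close> modulo the image \<open>B\<close> of \<open>f\<close> to the coset of \<open>g x\<close>.  The set product \<open>B \<cdot> g(c)\<close> is that
  coset, because \<open>g\<close> maps \<open>B\<close> into itself.\<close>

definition induced_map :: "('a, 'm) monoid_scheme \<Rightarrow> ('a \<Rightarrow> 'a) \<Rightarrow> ('a \<Rightarrow> 'a) \<Rightarrow> 'a set \<Rightarrow> 'a set"
  where "induced_map A f g c = (f ` carrier A) <#>\<^bsub>A\<^esub> (g ` c)"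

definition second_double_cohomology ::
    "('a, 'm) monoid_scheme \<Rightarrow> ('a \<Rightarrow> 'a) \<Rightarrow> ('a \<Rightarrow> 'a) \<Rightarrow> 'a set set monoid"
  where "second_double_cohomology A d d' = cohomology (cohomology A d') (induced_map A d' d)"

definition total_cohomology ::
    "('a, 'm) monoid_scheme \<Rightarrow> ('a \<Rightarrow> 'a) \<Rightarrow> ('a \<Rightarrow> 'a) \<Rightarrow> 'a set monoid"
  where "total_cohomology A d d' = cohomology A (\<lambda>x. d x \<otimes>\<^bsub>A\<^esub> d' x)"

definition total_degree :: "int \<times> int \<Rightarrow> int"
  where "total_degree b = fst b + snd b"


section \<open>The bicomplex of cochains of full subcomplexes\<close>

text \<open>The direct sum over all \<open>I \<subseteq> [m]\<close> of the augmented cochain groups of \<open>K\<^sub>I\<close> is the free abelian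
  group on the pairs \<open>(L, I)\<close> with \<open>L \<in> K\<close>, \<open>L \<subseteq> I\<close>; the pair \<open>(L, I)\<close> stands for
  \<open>\<alpha>\<^sub>L\<^sub>,\<^sub>I\<close>.\<close>

definition full_subcomplex :: "nat set set \<Rightarrow> nat set \<Rightarrow> nat set set"
  where "full_subcomplex K I = {J \<in> K. J \<subseteq> I}"

definition cochain_basis :: "nat \<Rightarrow> nat set set \<Rightarrow> (nat set \<times> nat set) set"
  where "cochain_basis m K = {(L, I). I \<subseteq> {1..m} \<and> L \<in> full_subcomplex K I}"

definition cochain_bidegree :: "nat set \<times> nat set \<Rightarrow> int \<times> int"
  where "cochain_bidegree = (\<lambda>(L, I). (int (card L) - int (card I), 2 * int (card I)))"

definition cochains :: "nat \<Rightarrow> nat set set \<Rightarrow> (nat set \<times> nat set \<Rightarrow>\<^sub>0 int) monoid"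
  where "cochains m K = free_Abelian_group (cochain_basis m K)"

definition cochains_deg :: "nat \<Rightarrow> nat set set \<Rightarrow> int \<Rightarrow> (nat set \<times> nat set \<Rightarrow>\<^sub>0 int) monoid"
  where "cochains_deg m K n =
    free_Abelian_group {b \<in> cochain_basis m K. total_degree (cochain_bidegree b) = n}"

definition cochain_\<alpha> :: "nat set \<Rightarrow> nat set \<Rightarrow> (nat set \<times> nat set \<Rightarrow>\<^sub>0 int)"
  where "cochain_\<alpha> L I = frag_of (L, I)"

definition cochain_d ::
    "nat set set \<Rightarrow> (nat set \<times> nat set \<Rightarrow>\<^sub>0 int) \<Rightarrow> (nat set \<times> nat set \<Rightarrow>\<^sub>0 int)"
  where "cochain_d K = frag_extend (\<lambda>(L, I).
    \<Sum>j\<in>{j \<in> I - L. L \<union> {j} \<in> K}. frag_cmul (eps j L) (cochain_\<alpha> (L \<union> {j}) I))"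

definition cochain_d' :: "(nat set \<times> nat set \<Rightarrow>\<^sub>0 int) \<Rightarrow> (nat set \<times> nat set \<Rightarrow>\<^sub>0 int)"
  where "cochain_d' = frag_extend (\<lambda>(L, I).
    frag_cmul ((- 1) ^ card L) (\<Sum>i\<in>I - L. frag_cmul (eps i I) (cochain_\<alpha> L (I - {i}))))"

text \<open>The differential \<open>d'\<close> has bidegree \<open>(1,-2)\<close>, hence lowers the total degree by one.\<close>

definition cochains_cohomology_deg :: "nat \<Rightarrow> nat set set \<Rightarrow> int \<Rightarrow> (nat set \<times> nat set \<Rightarrow>\<^sub>0 int) set monoid"
  where "cochains_cohomology_deg m K n = cohomology_at
    (cochains_deg m K (n + 1)) (cochains_deg m K n) (cochains_deg m K (n - 1)) cochain_d'"


section \<open>Stanley--Reisner rings\<close>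

text \<open>A polynomial is a finitely supported map from exponent vectors to integers.\<close>

type_synonym poly_int = "(nat \<Rightarrow>\<^sub>0 nat) \<Rightarrow>\<^sub>0 int"

definition poly_ring :: "nat \<Rightarrow> poly_int ring"
  where "poly_ring m = \<lparr>carrier = {p. \<forall>t\<in>Poly_Mapping.keys p. Poly_Mapping.keys t \<subseteq> {1..m}},
    monoid.mult = (*), one = 1, ring.zero = 0, add = (+)\<rparr>"

definition poly_var :: "nat \<Rightarrow> poly_int"
  where "poly_var i = Poly_Mapping.single (Poly_Mapping.single i 1) 1"

definition SR_ideal :: "nat \<Rightarrow> nat set set \<Rightarrow> poly_int set"
  where "SR_ideal m K = Idl\<^bsub>poly_ring m\<^esub> {\<Prod>i\<in>I. poly_var i | I. I \<subseteq> {1..m} \<and> I \<notin> K}"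

definition SR_ring :: "nat \<Rightarrow> nat set set \<Rightarrow> poly_int set ring"
  where "SR_ring m K = poly_ring m Quot SR_ideal m K"

definition SR_monomial :: "nat \<Rightarrow> nat set set \<Rightarrow> nat set \<Rightarrow> poly_int set"
  where "SR_monomial m K I = SR_ideal m K +>\<^bsub>poly_ring m\<^esub> (\<Prod>i\<in>I. poly_var i)"


section \<open>Exterior algebras over a commutative ring\<close>

text \<open>The exterior algebra \<open>\<Lambda>[u\<^sub>1,\<dots>,u\<^sub>m]\<close> is free with basis the \<open>u\<^sub>J\<close> (factors in increasing
  order), so \<open>\<Lambda>[u\<^sub>1,\<dots>,u\<^sub>m] \<otimes> S\<close> is the direct sum of the groups \<open>u\<^sub>J \<otimes> S\<close>: the function \<open>x\<close>
  stands for the sum of the \<open>u\<^sub>J \<otimes> x(J)\<close>.  As elements of \<open>S\<close> have even degree, the product is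
  \<open>(u\<^sub>A \<otimes> s)(u\<^sub>B \<otimes> t) = u\<^sub>A u\<^sub>B \<otimes> s t\<close>, where \<open>u\<^sub>A u\<^sub>B\<close> is zero unless \<open>A \<inter> B = {}\<close>, and otherwise is
  \<open>u\<close> at \<open>A \<union> B\<close> times the sign of the shuffle.\<close>

definition shuffle_sign :: "nat set \<Rightarrow> nat set \<Rightarrow> int"
  where "shuffle_sign A B = (- 1) ^ card {(a, b). a \<in> A \<and> b \<in> B \<and> b < a}"

definition exterior_algebra :: "nat \<Rightarrow> ('a, 'b) ring_scheme \<Rightarrow> (nat set \<Rightarrow> 'a) ring"
  where "exterior_algebra m S =
    \<lparr>carrier = Pow {1..m} \<rightarrow>\<^sub>E carrier S,
     monoid.mult = (\<lambda>x y. \<lambda>J\<in>Pow {1..m}.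
       \<Oplus>\<^bsub>S\<^esub>A\<in>Pow J. [shuffle_sign A (J - A)] \<cdot>\<^bsub>S\<^esub> (x A \<otimes>\<^bsub>S\<^esub> y (J - A))),
     one = (\<lambda>J\<in>Pow {1..m}. if J = {} then \<one>\<^bsub>S\<^esub> else \<zero>\<^bsub>S\<^esub>),
     ring.zero = (\<lambda>J\<in>Pow {1..m}. \<zero>\<^bsub>S\<^esub>),
     add = (\<lambda>x y. \<lambda>J\<in>Pow {1..m}. x J \<oplus>\<^bsub>S\<^esub> y J)\<rparr>"

definition ext_tensor :: "nat \<Rightarrow> ('a, 'b) ring_scheme \<Rightarrow> nat set \<Rightarrow> 'a \<Rightarrow> nat set \<Rightarrow> 'a"
  where "ext_tensor m S J s = (\<lambda>A\<in>Pow {1..m}. if A = J then s else \<zero>\<^bsub>S\<^esub>)"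

definition ext_homogeneous :: "nat \<Rightarrow> ('a, 'b) ring_scheme \<Rightarrow> nat \<Rightarrow> (nat set \<Rightarrow> 'a) set"
  where "ext_homogeneous m S k =
    {x \<in> carrier (exterior_algebra m S). \<forall>J\<in>Pow {1..m}. card J \<noteq> k \<longrightarrow> x J = \<zero>\<^bsub>S\<^esub>}"

text \<open>The graded Leibniz rule carries the sign \<open>(-1)\<close> to the total degree of \<open>x\<close>; with
  \<open>bideg u\<^sub>i = (-1,2)\<close> and \<open>bideg v\<^sub>i = (0,2)\<close> this degree has the parity of the exterior degree.\<close>

definition graded_derivation ::
    "nat \<Rightarrow> ('a, 'b) ring_scheme \<Rightarrow> ((nat set \<Rightarrow> 'a) \<Rightarrow> (nat set \<Rightarrow> 'a)) \<Rightarrow> bool"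
  where "graded_derivation m S D \<longleftrightarrow>
    D \<in> hom (add_monoid (exterior_algebra m S)) (add_monoid (exterior_algebra m S)) \<and>
    (\<forall>k. \<forall>x\<in>ext_homogeneous m S k. \<forall>y\<in>carrier (exterior_algebra m S).
      D (x \<otimes>\<^bsub>exterior_algebra m S\<^esub> y) =
        D x \<otimes>\<^bsub>exterior_algebra m S\<^esub> y \<oplus>\<^bsub>exterior_algebra m S\<^esub>
        [((- 1) ^ k :: int)] \<cdot>\<^bsub>exterior_algebra m S\<^esub> (x \<otimes>\<^bsub>exterior_algebra m S\<^esub> D y))"


section \<open>The Koszul algebra\<close>

type_synonym koszul = "nat set \<Rightarrow> poly_int set"

definition koszul_algebra :: "nat \<Rightarrow> nat set set \<Rightarrow> koszul ring"
  where "koszul_algebra m K = exterior_algebra m (SR_ring m K)"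

definition koszul_monomial :: "nat \<Rightarrow> nat set set \<Rightarrow> nat set \<Rightarrow> nat set \<Rightarrow> koszul"
  where "koszul_monomial m K J I = ext_tensor m (SR_ring m K) J (SR_monomial m K I)"

definition koszul_u :: "nat \<Rightarrow> nat set set \<Rightarrow> nat \<Rightarrow> koszul"
  where "koszul_u m K i = koszul_monomial m K {i} {}"

definition koszul_v :: "nat \<Rightarrow> nat set set \<Rightarrow> nat \<Rightarrow> koszul"
  where "koszul_v m K i = koszul_monomial m K {} {i}"

definition is_koszul_d :: "nat \<Rightarrow> nat set set \<Rightarrow> (koszul \<Rightarrow> koszul) \<Rightarrow> bool"
  where "is_koszul_d m K d \<longleftrightarrow> graded_derivation m (SR_ring m K) d \<and>
    (\<forall>i\<in>{1..m}. d (koszul_u m K i) = koszul_v m K i \<and> d (koszul_v m K i) = \<zero>\<^bsub>koszul_algebra m K\<^esub>)"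

definition is_koszul_d' :: "nat \<Rightarrow> nat set set \<Rightarrow> (koszul \<Rightarrow> koszul) \<Rightarrow> bool"
  where "is_koszul_d' m K d' \<longleftrightarrow> graded_derivation m (SR_ring m K) d' \<and>
    (\<forall>i\<in>{1..m}. d' (koszul_u m K i) = \<one>\<^bsub>koszul_algebra m K\<^esub> \<and>
      d' (koszul_v m K i) = \<zero>\<^bsub>koszul_algebra m K\<^esub>)"

text \<open>The subgroup \<open>R\<^sup>*(K)\<close> and its homogeneous parts, with \<open>u\<^sub>J v\<^sub>I\<close> encoded by \<open>(J, I)\<close>.\<close>

definition R_basis :: "nat \<Rightarrow> nat set set \<Rightarrow> (nat set \<times> nat set) set"
  where "R_basis m K = {(J, I). J \<subseteq> {1..m} \<and> I \<in> K \<and> J \<inter> I = {}}"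

definition R_bidegree :: "nat set \<times> nat set \<Rightarrow> int \<times> int"
  where "R_bidegree = (\<lambda>(J, I). (- int (card J), 2 * int (card J) + 2 * int (card I)))"

definition R_group :: "nat \<Rightarrow> nat set set \<Rightarrow> koszul monoid"
  where "R_group m K = subgroup_generated (add_monoid (koszul_algebra m K))
    {koszul_monomial m K J I | J I. (J, I) \<in> R_basis m K}"

definition R_group_deg :: "nat \<Rightarrow> nat set set \<Rightarrow> int \<Rightarrow> koszul monoid"
  where "R_group_deg m K n = subgroup_generated (add_monoid (koszul_algebra m K))
    {koszul_monomial m K J I | J I. (J, I) \<in> R_basis m K \<and> total_degree (R_bidegree (J, I)) = n}"

definition R_cohomology_deg :: "nat \<Rightarrow> nat set set \<Rightarrow> (koszul \<Rightarrow> koszul) \<Rightarrow> int \<Rightarrow> koszul set monoid"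
  where "R_cohomology_deg m K d' n = cohomology_at
    (R_group_deg m K (n + 1)) (R_group_deg m K n) (R_group_deg m K (n - 1)) d'"


section \<open>Existence of the Koszul differentials\<close>

text \<open>The two predicates \<^const>\<open>is_koszul_d\<close> and \<^const>\<open>is_koszul_d'\<close> are satisfiable.  Each
  determines its differential on the carrier, since the \<open>u\<^sub>i\<close> and \<open>v\<^sub>i\<close> generate the algebra.\<close>

lemma eps_Un: "finite A \<Longrightarrow> finite B \<Longrightarrow> A \<inter> B = {} \<Longrightarrow> eps k (A \<union> B) = eps k A * eps k B"
proof -
  assume a: "finite A" "finite B" "A \<inter> B = {}"
  have "{r \<in> A \<union> B. r < k} = {r \<in> A. r < k} \<union> {r \<in> B. r < k}" by auto
  moreover have "card ({r \<in> A. r < k} \<union> {r \<in> B. r < k}) = card {r \<in> A. r < k} + card {r \<in> B. r < k}"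
    using a by (intro card_Un_disjoint) auto
  ultimately show ?thesis by (simp add: eps_def power_add)
qed

lemma eps_sq [simp]: "eps k A * eps k A = 1"
  by (simp add: eps_def flip: power_mult_distrib)

lemma shuffle_sign_insert_left:
  assumes "finite A" "finite B" "k \<notin> A"
  shows "shuffle_sign (insert k A) B = shuffle_sign A B * eps k B"
proof -
  have "{(a, b). a \<in> insert k A \<and> b \<in> B \<and> b < a} =
      {(a, b). a \<in> A \<and> b \<in> B \<and> b < a} \<union> Pair k ` {b \<in> B. b < k}" by auto
  moreover have "finite {(a, b). a \<in> A \<and> b \<in> B \<and> b < a}"
    by (rule finite_subset[of _ "A \<times> B"]) (use assms in auto)
  then have "card ({(a, b). a \<in> A \<and> b \<in> B \<and> b < a} \<union> Pair k ` {b \<in> B. b < k})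
     = card {(a, b). a \<in> A \<and> b \<in> B \<and> b < a} + card (Pair k ` {b \<in> B. b < k})"
    using assms by (intro card_Un_disjoint) auto
  moreover have "card (Pair k ` {b \<in> B. b < k}) = card {b \<in> B. b < k}"
    by (rule card_image) (auto simp: inj_on_def)
  ultimately show ?thesis by (simp add: shuffle_sign_def eps_def power_add)
qed

lemma shuffle_sign_insert_right:
  assumes "finite A" "finite B" "k \<notin> A" "k \<notin> B"
  shows "shuffle_sign A (insert k B) = shuffle_sign A B * (- 1) ^ card A * eps k A"
proof -
  have "{(a, b). a \<in> A \<and> b \<in> insert k B \<and> b < a} =
      {(a, b). a \<in> A \<and> b \<in> B \<and> b < a} \<union> (\<lambda>a. (a, k)) ` {a \<in> A. k < a}" by auto
  moreover have "finite {(a, b). a \<in> A \<and> b \<in> B \<and> b < a}"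
    by (rule finite_subset[of _ "A \<times> B"]) (use assms in auto)
  then have "card ({(a, b). a \<in> A \<and> b \<in> B \<and> b < a} \<union> (\<lambda>a. (a, k)) ` {a \<in> A. k < a})
     = card {(a, b). a \<in> A \<and> b \<in> B \<and> b < a} + card ((\<lambda>a. (a, k)) ` {a \<in> A. k < a})"
    using assms by (intro card_Un_disjoint) auto
  moreover have "card ((\<lambda>a. (a, k)) ` {a \<in> A. k < a}) = card {a \<in> A. k < a}"
    by (rule card_image) (auto simp: inj_on_def)
  ultimately have 1: "shuffle_sign A (insert k B) = shuffle_sign A B * (- 1) ^ card {a \<in> A. k < a}"
    by (simp add: shuffle_sign_def power_add)
  have "A = {a \<in> A. k < a} \<union> {a \<in> A. a < k}" 
  proof (rule Set.set_eqI)
    fix r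
    show "r \<in> A \<longleftrightarrow> r \<in> {a \<in> A. k < a} \<union> {a \<in> A. a < k}"
    proof (cases "r = k")
      case True
      then show ?thesis using assms(3) by simp
    next
      case False
      then have "k < r \<or> r < k" by linarith
      then show ?thesis by blast
    qed
  qed
  then have "card A = card ({a \<in> A. k < a} \<union> {a \<in> A. a < k})" by (rule arg_cong)
  also have "\<dots> = card {a \<in> A. k < a} + card {a \<in> A. a < k}"
  proof (rule card_Un_disjoint)
    show "finite {a \<in> A. k < a}" "finite {a \<in> A. a < k}" using assms(1) by simp_all
    show "{a \<in> A. k < a} \<inter> {a \<in> A. a < k} = {}" by (simp add: disjoint_iff not_less_iff_gr_or_eq)
  qed
  finally have "card A = card {a \<in> A. k < a} + card {a \<in> A. a < k}" .
  then have "(- 1) ^ card A * eps k A = (- 1) ^ card {a \<in> A. k < a} * (eps k A * eps k A)"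
    by (simp only: power_add eps_def mult.assoc)
  then have "shuffle_sign A B * ((- 1) ^ card A * eps k A) = shuffle_sign A B * (- 1) ^ card {a \<in> A. k < a}"
    by (simp only: eps_sq mult_1_right)
  then show ?thesis unfolding 1 by (simp only: mult.assoc)
qed

lemma sgn_aux1:
  assumes "e * e = 1" shows "e * f * (s * c * e) = s * c * (f :: int)"
proof -
  have "e * f * (s * c * e) = s * c * f * (e * e)" by (simp only: ac_simps)
  then show ?thesis using assms by simp
qed

lemma sgn_aux2:
  assumes "f * f = 1" shows "e * f * (s * f) = s * (e :: int)"
proof -
  have "e * f * (s * f) = s * e * (f * f)" by (simp only: ac_simps)
  then show ?thesis using assms by simp
qed

lemma sgn_aux3:
  assumes "e * e = 1" "f * f = 1" shows "s * f * (- 1 * c) * f = - (s * c * e * (e :: int))"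
proof -
  have "s * f * (- 1 * c) * f = - (s * c) * (f * f)" by (simp add: ac_simps)
  moreover have "s * c * e * e = s * c * (e * e)" by (simp only: ac_simps)
  ultimately show ?thesis using assms by simp
qed

lemma (in comm_monoid) finprod_swap:
  assumes "finite A" "finite B" "\<And>a b. a \<in> A \<Longrightarrow> b \<in> B \<Longrightarrow> f a b \<in> carrier G"
  shows "finprod G (\<lambda>a. finprod G (\<lambda>b. f a b) B) A = finprod G (\<lambda>b. finprod G (\<lambda>a. f a b) A) B"
  using assms(1,3)
proof (induction rule: finite_induct)
  case (insert a A)
  have "finprod G (\<lambda>b. finprod G (\<lambda>a. f a b) (insert a A)) B
      = finprod G (\<lambda>b. f a b \<otimes> finprod G (\<lambda>a. f a b) A) B"
    using insert by (intro finprod_cong') (auto simp: Pi_iff)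
  also have "\<dots> = finprod G (\<lambda>b. f a b) B \<otimes> finprod G (\<lambda>b. finprod G (\<lambda>a. f a b) A) B"
    using insert.prems by (intro finprod_multf) (auto simp: Pi_iff)
  finally show ?case using insert by (simp add: Pi_iff)
qed simp

lemmas (in abelian_monoid) finsum_swap = add.finprod_swap

text \<open>\<open>contraction S k\<close> is the \<open>S\<close>-linear derivation that maps \<open>u\<^sub>k\<close> to one and the other
  generators to zero; \<open>ext_prod\<close> is the exterior product without the restriction to subsets of \<open>[m]\<close>.\<close>

definition contraction :: "('a, 'b) ring_scheme \<Rightarrow> nat \<Rightarrow> (nat set \<Rightarrow> 'a) \<Rightarrow> nat set \<Rightarrow> 'a"
  where "contraction S k x A = (if k \<in> A then \<zero>\<^bsub>S\<^esub> else [eps k A] \<cdot>\<^bsub>S\<^esub> x (insert k A))"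

definition ext_prod :: "('a, 'b) ring_scheme \<Rightarrow> (nat set \<Rightarrow> 'a) \<Rightarrow> (nat set \<Rightarrow> 'a) \<Rightarrow> nat set \<Rightarrow> 'a"
  where "ext_prod S x y J =
    (\<Oplus>\<^bsub>S\<^esub>A\<in>Pow J. [shuffle_sign A (J - A)] \<cdot>\<^bsub>S\<^esub> (x A \<otimes>\<^bsub>S\<^esub> y (J - A)))"

context ring
begin

lemma smul_closed [simp]: "a \<in> carrier R \<Longrightarrow> [(s::int)] \<cdot> a \<in> carrier R"
  by (rule add.int_pow_closed)

lemma smul_smul: "a \<in> carrier R \<Longrightarrow> [(s::int)] \<cdot> ([(t::int)] \<cdot> a) = [(s * t)] \<cdot> a"
  using add.int_pow_pow[of a s t] by (simp add: mult.commute)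

lemma smul_zero [simp]: "[(s::int)] \<cdot> \<zero> = \<zero>"
  by (rule add.int_pow_one)

lemma smul_one [simp]: "a \<in> carrier R \<Longrightarrow> [(1::int)] \<cdot> a = a"
  by (simp add: add.int_pow_1)

lemma smul_add: "a \<in> carrier R \<Longrightarrow> b \<in> carrier R \<Longrightarrow> [(s::int)] \<cdot> (a \<oplus> b) = [s] \<cdot> a \<oplus> [s] \<cdot> b"
  by (rule add.int_pow_distrib)

lemma smul_cancel: "a \<in> carrier R \<Longrightarrow> t = - s \<Longrightarrow> [(s::int)] \<cdot> a \<oplus> [(t::int)] \<cdot> a = \<zero>"
  using add.int_pow_mult[of a s t] by (simp add: add_pow_int_ge)

lemma smul_finsum:
  assumes "finite A" "\<And>a. a \<in> A \<Longrightarrow> f a \<in> carrier R"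
  shows "[(s::int)] \<cdot> (\<Oplus>a\<in>A. f a) = (\<Oplus>a\<in>A. [s] \<cdot> f a)"
  using assms by (induction rule: finite_induct) (simp_all add: smul_add Pi_iff)

lemma smul_finsum2:
  assumes "finite A" "\<And>a. a \<in> A \<Longrightarrow> f a \<in> carrier R" "\<And>a. a \<in> A \<Longrightarrow> g a \<in> carrier R"
  shows "[(s::int)] \<cdot> ((\<Oplus>a\<in>A. f a) \<oplus> (\<Oplus>a\<in>A. g a)) = (\<Oplus>a\<in>A. [s] \<cdot> f a) \<oplus> (\<Oplus>a\<in>A. [s] \<cdot> g a)"
  using assms by (subst smul_add) (simp_all add: smul_finsum Pi_iff)

lemma contraction_closed:
  assumes "\<And>A. A \<subseteq> {1..m} \<Longrightarrow> x A \<in> carrier R" "k \<in> {1..m}" "A \<subseteq> {1..m}"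
  shows "contraction R k x A \<in> carrier R"
  using assms by (simp add: contraction_def)

lemma finsum_Pow_insert:
  assumes "finite J" "k \<notin> J" "\<And>A. A \<subseteq> insert k J \<Longrightarrow> f A \<in> carrier R"
  shows "(\<Oplus>A\<in>Pow (insert k J). f A) = (\<Oplus>A\<in>Pow J. f A) \<oplus> (\<Oplus>A\<in>Pow J. f (insert k A))"
proof -
  have inj: "inj_on (insert k) (Pow J)"
    using assms(2) by (intro inj_onI) (metis PowD insert_ident subsetD)
  have "(\<Oplus>A\<in>Pow (insert k J). f A) = (\<Oplus>A\<in>Pow J. f A) \<oplus> (\<Oplus>A\<in>insert k ` Pow J. f A)"
    unfolding Pow_insert
  proof (rule finsum_Un_disjoint)
    show "Pow J \<inter> insert k ` Pow J = {}" using assms(2) by blast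
    show "f \<in> Pow J \<rightarrow> carrier R" "f \<in> insert k ` Pow J \<rightarrow> carrier R"
      by (intro Pi_I assms(3), blast)+
  qed (use assms(1) in simp_all)
  also have "(\<Oplus>A\<in>insert k ` Pow J. f A) = (\<Oplus>A\<in>Pow J. f (insert k A))"
  proof (rule finsum_reindex)
    show "f \<in> insert k ` Pow J \<rightarrow> carrier R"
      by (intro Pi_I assms(3), blast)
  qed (rule inj)
  finally show ?thesis .
qed

lemma contraction_leibniz:
  assumes x: "\<And>A. A \<subseteq> {1..m} \<Longrightarrow> x A \<in> carrier R" and y: "\<And>A. A \<subseteq> {1..m} \<Longrightarrow> y A \<in> carrier R"
    and k: "k \<in> {1..m}" and J: "J \<subseteq> {1..m}"
    and hom: "\<And>A. A \<subseteq> {1..m} \<Longrightarrow> card A \<noteq> p \<Longrightarrow> x A = \<zero>"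
  shows "contraction R k (ext_prod R x y) J =
    ext_prod R (contraction R k x) y J \<oplus> [((- 1) ^ p :: int)] \<cdot> ext_prod R x (contraction R k y) J"
proof -
  have sub: "A \<subseteq> {1..m}" "insert k A \<subseteq> {1..m}" "finite A" "J - A \<subseteq> {1..m}" "finite (J - A)"
     "insert k (J - A) \<subseteq> {1..m}" if "A \<subseteq> J" for A
    using that J k finite_subset[of _ "{1..m}"] by auto
  have fJ: "finite J" using J finite_subset by blast
  note cx = contraction_closed[of m x k, OF x k] and cy = contraction_closed[of m y k, OF y k]
  have R2: "[((- 1) ^ p :: int)] \<cdot> ext_prod R x (contraction R k y) J =
    (\<Oplus>A\<in>Pow J. [(shuffle_sign A (J - A) * (- 1) ^ card A)] \<cdot> (x A \<otimes> contraction R k y (J - A)))"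
  proof -
    have cl: "[shuffle_sign A (J - A)] \<cdot> (x A \<otimes> contraction R k y (J - A)) \<in> carrier R" if "A \<subseteq> J" for A
      using sub[OF that] x cy by simp
    have "[((- 1) ^ p :: int)] \<cdot> ext_prod R x (contraction R k y) J =
      (\<Oplus>A\<in>Pow J. [((- 1) ^ p :: int)] \<cdot> ([shuffle_sign A (J - A)] \<cdot> (x A \<otimes> contraction R k y (J - A))))"
      unfolding ext_prod_def using fJ cl by (subst smul_finsum) auto
    also have "\<dots> = (\<Oplus>A\<in>Pow J. [(shuffle_sign A (J - A) * (- 1) ^ card A)] \<cdot> (x A \<otimes> contraction R k y (J - A)))"
    proof (intro finsum_cong')
      fix A assume "A \<in> Pow J" hence A: "A \<subseteq> J" by simp
      show "[((- 1) ^ p :: int)] \<cdot> ([shuffle_sign A (J - A)] \<cdot> (x A \<otimes> contraction R k y (J - A))) =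
         [(shuffle_sign A (J - A) * (- 1) ^ card A)] \<cdot> (x A \<otimes> contraction R k y (J - A))"
      proof (cases "card A = p")
        case True
        then show ?thesis using sub[OF A] x cy by (simp add: smul_smul mult.commute)
      next
        case False
        then show ?thesis using sub[OF A] hom[of A] cy by simp
      qed
    qed (use sub x cy in \<open>auto simp: Pi_iff\<close>)
    finally show ?thesis .
  qed
  show ?thesis
  proof (cases "k \<in> J")
    case False
    have e: "insert k J - A = insert k (J - A)" "insert k J - insert k A = J - A" "k \<notin> A"
      if "A \<subseteq> J" for A using that False by auto
    have sgn1: "eps k J * shuffle_sign A (insert k (J - A)) = shuffle_sign A (J - A) * (- 1) ^ card A * eps k (J - A)"
      and sgn2: "eps k J * shuffle_sign (insert k A) (J - A) = shuffle_sign A (J - A) * eps k A"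
      if A: "A \<subseteq> J" for A
    proof -
      have E: "eps k J = eps k A * eps k (J - A)"
        using eps_Un[of A "J - A" k] sub[OF A] A by (simp add: Un_absorb1)
      show "eps k J * shuffle_sign A (insert k (J - A)) = shuffle_sign A (J - A) * (- 1) ^ card A * eps k (J - A)"
        using sub[OF A] e[OF A] False
        by (simp only: shuffle_sign_insert_right E sgn_aux1 eps_sq Diff_iff simp_thms)
      show "eps k J * shuffle_sign (insert k A) (J - A) = shuffle_sign A (J - A) * eps k A"
        using sub[OF A] e[OF A] False
        by (simp only: shuffle_sign_insert_left E sgn_aux2 eps_sq simp_thms)
    qed
    have cl: "[shuffle_sign A (insert k J - A)] \<cdot> (x A \<otimes> y (insert k J - A)) \<in> carrier R"
      if "A \<subseteq> insert k J" for A
    proof -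
      have "A \<subseteq> {1..m}" "insert k J - A \<subseteq> {1..m}" using that J k by auto
      then show ?thesis using x y by (intro smul_closed m_closed)
    qed
    have "contraction R k (ext_prod R x y) J = [eps k J] \<cdot> ext_prod R x y (insert k J)"
      using False by (simp add: contraction_def)
    also have "ext_prod R x y (insert k J) =
       (\<Oplus>A\<in>Pow J. [shuffle_sign A (insert k J - A)] \<cdot> (x A \<otimes> y (insert k J - A))) \<oplus>
       (\<Oplus>A\<in>Pow J. [shuffle_sign (insert k A) (insert k J - insert k A)] \<cdot> (x (insert k A) \<otimes> y (insert k J - insert k A)))"
      unfolding ext_prod_def by (rule finsum_Pow_insert) (use fJ False cl in auto)
    also have "[eps k J] \<cdot> \<dots> =
       (\<Oplus>A\<in>Pow J. [eps k J] \<cdot> ([shuffle_sign A (insert k J - A)] \<cdot> (x A \<otimes> y (insert k J - A)))) \<oplus>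
       (\<Oplus>A\<in>Pow J. [eps k J] \<cdot> ([shuffle_sign (insert k A) (insert k J - insert k A)] \<cdot> (x (insert k A) \<otimes> y (insert k J - insert k A))))"
      by (rule smul_finsum2) (use fJ in simp, (rule cl; blast)+)
    also have "(\<Oplus>A\<in>Pow J. [eps k J] \<cdot> ([shuffle_sign A (insert k J - A)] \<cdot> (x A \<otimes> y (insert k J - A)))) =
       (\<Oplus>A\<in>Pow J. [(shuffle_sign A (J - A) * (- 1) ^ card A)] \<cdot> (x A \<otimes> contraction R k y (J - A)))"
      (is "?P1 = ?Q1")
    proof (intro finsum_cong')
      fix A assume "A \<in> Pow J" hence A: "A \<subseteq> J" by simp
      have "k \<notin> J - A" using False by auto
      then show "[eps k J] \<cdot> ([shuffle_sign A (insert k J - A)] \<cdot> (x A \<otimes> y (insert k J - A))) =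
          [(shuffle_sign A (J - A) * (- 1) ^ card A)] \<cdot> (x A \<otimes> contraction R k y (J - A))"
        using sub[OF A] x y sgn1[OF A] e[OF A]
        by (simp add: contraction_def smul_smul flip: add_pow_rdistr_int)
    qed (use sub x cy in \<open>auto simp: Pi_iff\<close>)
    also have "(\<Oplus>A\<in>Pow J. [eps k J] \<cdot> ([shuffle_sign (insert k A) (insert k J - insert k A)] \<cdot> (x (insert k A) \<otimes> y (insert k J - insert k A))))
      = ext_prod R (contraction R k x) y J"
      unfolding ext_prod_def
    proof (intro finsum_cong')
      fix A assume "A \<in> Pow J" hence A: "A \<subseteq> J" by simp
      show "[eps k J] \<cdot> ([shuffle_sign (insert k A) (insert k J - insert k A)] \<cdot> (x (insert k A) \<otimes> y (insert k J - insert k A))) =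
          [shuffle_sign A (J - A)] \<cdot> (contraction R k x A \<otimes> y (J - A))"
        using sub[OF A] x y sgn2[OF A] e[OF A]
        by (simp add: contraction_def smul_smul flip: add_pow_ldistr_int)
    qed (use sub y cx in \<open>auto simp: Pi_iff\<close>)
    also have "?Q1 \<oplus> ext_prod R (contraction R k x) y J = ext_prod R (contraction R k x) y J \<oplus> ?Q1"
      using sub x y cx cy by (intro a_comm) (auto simp: ext_prod_def Pi_iff intro!: finsum_closed)
    finally show ?thesis unfolding R2 .
  next
    case True
    define L where "L = J - {k}"
    have L: "J = insert k L" "k \<notin> L" "finite L" using True fJ by (auto simp: L_def)
    have e: "J - A = insert k (L - A)" "J - insert k A = L - A" "k \<notin> A" "k \<notin> L - A" "A \<subseteq> J"
      "finite (L - A)" "finite A" "L - A \<subseteq> {1..m}" "insert k (L - A) \<subseteq> {1..m}" if "A \<subseteq> L" for A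
      using that L J finite_subset[of _ L] by auto
    have cc1: "[shuffle_sign A (J - A)] \<cdot> (contraction R k x A \<otimes> y (J - A)) \<in> carrier R"
      and cc2: "[(shuffle_sign A (J - A) * (- 1) ^ card A)] \<cdot> (x A \<otimes> contraction R k y (J - A)) \<in> carrier R"
      if "A \<subseteq> J" for A
      using sub(1,4)[OF that] x y cx cy by (simp_all only: smul_closed m_closed)
    have p1: "ext_prod R (contraction R k x) y J =
       (\<Oplus>A\<in>Pow L. [shuffle_sign A (J - A)] \<cdot> (contraction R k x A \<otimes> y (J - A))) \<oplus>
       (\<Oplus>A\<in>Pow L. [shuffle_sign (insert k A) (J - insert k A)] \<cdot> (contraction R k x (insert k A) \<otimes> y (J - insert k A)))"
      unfolding ext_prod_def L(1) by (rule finsum_Pow_insert) (use L(2,3) cc1 in \<open>auto simp flip: L(1)\<close>)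
    have z1: "(\<Oplus>A\<in>Pow L. [shuffle_sign (insert k A) (J - insert k A)] \<cdot> (contraction R k x (insert k A) \<otimes> y (J - insert k A))) = \<zero>"
      by (rule add.finprod_one_eqI) (use e y in \<open>auto simp: contraction_def\<close>)
    have p2: "(\<Oplus>A\<in>Pow J. [(shuffle_sign A (J - A) * (- 1) ^ card A)] \<cdot> (x A \<otimes> contraction R k y (J - A))) =
       (\<Oplus>A\<in>Pow L. [(shuffle_sign A (J - A) * (- 1) ^ card A)] \<cdot> (x A \<otimes> contraction R k y (J - A))) \<oplus>
       (\<Oplus>A\<in>Pow L. [(shuffle_sign (insert k A) (J - insert k A) * (- 1) ^ card (insert k A))] \<cdot> (x (insert k A) \<otimes> contraction R k y (J - insert k A)))"
      unfolding L(1) by (rule finsum_Pow_insert) (use L(2,3) cc2 in \<open>auto simp flip: L(1)\<close>)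
    have z2: "(\<Oplus>A\<in>Pow L. [(shuffle_sign A (J - A) * (- 1) ^ card A)] \<cdot> (x A \<otimes> contraction R k y (J - A))) = \<zero>"
      by (rule add.finprod_one_eqI) (use e sub x in \<open>auto simp: contraction_def\<close>)
    have c1: "[shuffle_sign A (J - A)] \<cdot> (contraction R k x A \<otimes> y (J - A)) \<in> carrier R"
      and c2: "[(shuffle_sign (insert k A) (J - insert k A) * (- 1) ^ card (insert k A))] \<cdot>
          (x (insert k A) \<otimes> contraction R k y (J - insert k A)) \<in> carrier R" if "A \<subseteq> L" for A
      using e(1,2,8,9)[OF that] sub(1,2)[OF e(5)[OF that]] x y cx cy by (simp_all only: smul_closed m_closed)
    have "ext_prod R (contraction R k x) y J \<oplus> [((- 1) ^ p :: int)] \<cdot> ext_prod R x (contraction R k y) J =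
      (\<Oplus>A\<in>Pow L. [shuffle_sign A (J - A)] \<cdot> (contraction R k x A \<otimes> y (J - A))) \<oplus>
      (\<Oplus>A\<in>Pow L. [(shuffle_sign (insert k A) (J - insert k A) * (- 1) ^ card (insert k A))] \<cdot> (x (insert k A) \<otimes> contraction R k y (J - insert k A)))"
      unfolding R2 p1 p2 z1 z2 using c1 c2 by (simp add: Pi_iff)
    also have "\<dots> = (\<Oplus>A\<in>Pow L. [shuffle_sign A (J - A)] \<cdot> (contraction R k x A \<otimes> y (J - A)) \<oplus>
       [(shuffle_sign (insert k A) (J - insert k A) * (- 1) ^ card (insert k A))] \<cdot> (x (insert k A) \<otimes> contraction R k y (J - insert k A)))"
      using c1 c2 by (subst finsum_addf) (auto simp: Pi_iff)
    also have "\<dots> = \<zero>"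
    proof (rule add.finprod_one_eqI)
      fix A assume "A \<in> Pow L" hence A: "A \<subseteq> L" by simp
      note eA = e[OF A] and s = sub[OF e(5)[OF A]]
      have sg: "shuffle_sign (insert k A) (L - A) * (- 1) ^ card (insert k A) * eps k (L - A) =
         - (shuffle_sign A (insert k (L - A)) * eps k A)"
        using eA by (simp only: shuffle_sign_insert_left shuffle_sign_insert_right card_insert_disjoint
          power_Suc sgn_aux3 eps_sq simp_thms)
      show "[shuffle_sign A (J - A)] \<cdot> (contraction R k x A \<otimes> y (J - A)) \<oplus>
       [(shuffle_sign (insert k A) (J - insert k A) * (- 1) ^ card (insert k A))] \<cdot> (x (insert k A) \<otimes> contraction R k y (J - insert k A)) = \<zero>"
        unfolding eA(1,2) using eA(3,4) s eA x y sg
        by (simp add: contraction_def add_pow_rdistr_int add_pow_ldistr_int smul_smul)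
           (intro smul_cancel; simp)
    qed
    finally show ?thesis using True by (simp add: contraction_def)
  qed
qed

end

text \<open>The derivation that maps \<open>u\<^sub>k\<close> to \<open>g k\<close> and vanishes on \<open>S\<close>.\<close>

definition ext_diff :: "nat \<Rightarrow> ('a, 'b) ring_scheme \<Rightarrow> (nat \<Rightarrow> 'a) \<Rightarrow> (nat set \<Rightarrow> 'a) \<Rightarrow> nat set \<Rightarrow> 'a"
  where "ext_diff m S g x = (\<lambda>J\<in>Pow {1..m}. \<Oplus>\<^bsub>S\<^esub>k\<in>{1..m}. g k \<otimes>\<^bsub>S\<^esub> contraction S k x J)"

lemma exterior_algebra_simps:
  "carrier (exterior_algebra m S) = Pow {1..m} \<rightarrow>\<^sub>E carrier S"
  "x \<otimes>\<^bsub>exterior_algebra m S\<^esub> y = restrict (ext_prod S x y) (Pow {1..m})"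
  "\<one>\<^bsub>exterior_algebra m S\<^esub> = ext_tensor m S {} \<one>\<^bsub>S\<^esub>"
  "\<zero>\<^bsub>exterior_algebra m S\<^esub> = (\<lambda>J\<in>Pow {1..m}. \<zero>\<^bsub>S\<^esub>)"
  "x \<oplus>\<^bsub>exterior_algebra m S\<^esub> y = (\<lambda>J\<in>Pow {1..m}. x J \<oplus>\<^bsub>S\<^esub> y J)"
  by (simp_all add: exterior_algebra_def ext_prod_def ext_tensor_def restrict_def fun_eq_iff)

context ring
begin

lemma exterior_algebra_abelian_group: "abelian_group (exterior_algebra m R)"
proof (rule abelian_groupI)
  fix x assume x: "x \<in> carrier (exterior_algebra m R)"
  show "\<exists>y\<in>carrier (exterior_algebra m R). y \<oplus>\<^bsub>exterior_algebra m R\<^esub> x = \<zero>\<^bsub>exterior_algebra m R\<^esub>"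
    using x by (intro bexI[of _ "\<lambda>J\<in>Pow {1..m}. \<ominus> x J"])
       (auto simp: exterior_algebra_simps PiE_iff l_neg restrict_def fun_eq_iff extensional_def)
  show "\<zero>\<^bsub>exterior_algebra m R\<^esub> \<oplus>\<^bsub>exterior_algebra m R\<^esub> x = x"
    using x by (auto simp: exterior_algebra_simps PiE_iff restrict_def fun_eq_iff extensional_def)
qed (auto simp: exterior_algebra_simps PiE_iff restrict_def fun_eq_iff extensional_def a_ac)

lemma exterior_algebra_smul:
  assumes x: "x \<in> carrier (exterior_algebra m R)" and J: "J \<subseteq> {1..m}"
  shows "([((- 1) ^ p :: int)] \<cdot>\<^bsub>exterior_algebra m R\<^esub> x) J = [((- 1) ^ p :: int)] \<cdot> x J"
proof -
  interpret E: abelian_group "exterior_algebra m R" by (rule exterior_algebra_abelian_group)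
  have cJ: "y J \<in> carrier R" if "y \<in> carrier (exterior_algebra m R)" for y
    using that J by (auto simp: exterior_algebra_simps)
  have one: "[(1::int)] \<cdot>\<^bsub>exterior_algebra m R\<^esub> y = y" if "y \<in> carrier (exterior_algebra m R)" for y
    using E.add.int_pow_1[OF that] .
  have minus: "([(- 1::int)] \<cdot>\<^bsub>exterior_algebra m R\<^esub> x) J = [(- 1::int)] \<cdot> x J"
  proof -
    have 1: "[(- 1::int)] \<cdot>\<^bsub>exterior_algebra m R\<^esub> x = \<ominus>\<^bsub>exterior_algebra m R\<^esub> x"
      using E.add.int_pow_neg[OF x, of 1] one[OF x] by (simp add: a_inv_def)
    have 2: "[(- 1::int)] \<cdot> x J = \<ominus> x J"
      using add.int_pow_neg[OF cJ[OF x], of 1] cJ[OF x] by (simp add: a_inv_def)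
    have "(x \<oplus>\<^bsub>exterior_algebra m R\<^esub> \<ominus>\<^bsub>exterior_algebra m R\<^esub> x) J = \<zero>\<^bsub>exterior_algebra m R\<^esub> J"
      using E.r_neg[OF x] by simp
    then have "x J \<oplus> (\<ominus>\<^bsub>exterior_algebra m R\<^esub> x) J = \<zero>"
      using J by (simp add: exterior_algebra_simps)
    then have "(\<ominus>\<^bsub>exterior_algebra m R\<^esub> x) J = \<ominus> x J"
      using cJ[OF x] cJ[OF E.a_inv_closed[OF x]] by (metis minus_equality a_comm)
    with 1 2 show ?thesis by simp
  qed
  show ?thesis
    using one[OF x] minus cJ[OF x] by (cases "even p") simp_all
qed

lemma contraction_cong:
  assumes "\<And>A. A \<subseteq> {1..m} \<Longrightarrow> x A = y A" "k \<in> {1..m}" "J \<subseteq> {1..m}"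
  shows "contraction R k x J = contraction R k y J"
  using assms by (simp add: contraction_def)

lemma ext_prod_cong:
  assumes "\<And>A. A \<subseteq> {1..m} \<Longrightarrow> x A = x' A" "\<And>A. A \<subseteq> {1..m} \<Longrightarrow> y A = y' A"
    "\<And>A. A \<subseteq> {1..m} \<Longrightarrow> x A \<in> carrier R" "\<And>A. A \<subseteq> {1..m} \<Longrightarrow> y A \<in> carrier R" "J \<subseteq> {1..m}"
  shows "ext_prod R x y J = ext_prod R x' y' J"
  unfolding ext_prod_def
proof (rule finsum_cong')
  fix A assume "A \<in> Pow J"
  then have "A \<subseteq> {1..m}" "J - A \<subseteq> {1..m}" using assms(5) by auto
  then show "[shuffle_sign A (J - A)] \<cdot> (x A \<otimes> y (J - A)) = [shuffle_sign A (J - A)] \<cdot> (x' A \<otimes> y' (J - A))"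
    using assms(1,2) by simp
next
  have "A \<subseteq> {1..m}" "J - A \<subseteq> {1..m}" if "A \<subseteq> J" for A using that assms(5) by auto
  then show "(\<lambda>A. [shuffle_sign A (J - A)] \<cdot> (x' A \<otimes> y' (J - A))) \<in> Pow J \<rightarrow> carrier R"
    using assms(3,4) by (simp add: Pi_iff flip: assms(1,2))
qed simp

lemma ext_prod_closed:
  assumes "\<And>A. A \<subseteq> {1..m} \<Longrightarrow> x A \<in> carrier R" "\<And>A. A \<subseteq> {1..m} \<Longrightarrow> y A \<in> carrier R" "J \<subseteq> {1..m}"
  shows "ext_prod R x y J \<in> carrier R"
proof -
  have "A \<subseteq> {1..m}" "J - A \<subseteq> {1..m}" if "A \<subseteq> J" for A using that assms(3) by auto
  then show ?thesis using assms(1,2) by (simp add: ext_prod_def Pi_iff)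
qed

end

context cring
begin

lemma ext_diff_closed:
  assumes "\<And>k. k \<in> {1..m} \<Longrightarrow> g k \<in> carrier R" "x \<in> carrier (exterior_algebra m R)"
  shows "ext_diff m R g x \<in> carrier (exterior_algebra m R)"
proof -
  have "x A \<in> carrier R" if "A \<subseteq> {1..m}" for A using assms(2) that by (auto simp: exterior_algebra_simps)
  from contraction_closed[OF this] assms(1) show ?thesis
    unfolding exterior_algebra_simps ext_diff_def by (intro PiE_I) (auto intro!: finsum_closed simp del: atLeastAtMost_iff One_nat_def)
qed

lemma ext_prod_diff:
  assumes g: "\<And>k. k \<in> {1..m} \<Longrightarrow> g k \<in> carrier R"
    and x: "\<And>A. A \<subseteq> {1..m} \<Longrightarrow> x A \<in> carrier R" and y: "\<And>A. A \<subseteq> {1..m} \<Longrightarrow> y A \<in> carrier R"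
    and J: "J \<subseteq> {1..m}"
  shows "ext_prod R (ext_diff m R g x) y J = (\<Oplus>k\<in>{1..m}. g k \<otimes> ext_prod R (contraction R k x) y J)"
    and "ext_prod R y (ext_diff m R g x) J = (\<Oplus>k\<in>{1..m}. g k \<otimes> ext_prod R y (contraction R k x) J)"
proof -
  note c = contraction_closed[of m x, OF x]
  have sub: "A \<subseteq> {1..m}" "J - A \<subseteq> {1..m}" if "A \<subseteq> J" for A using that J by auto
  have fJ: "finite J" using J finite_subset by blast
  have cl: "A \<subseteq> J \<Longrightarrow> k \<in> {1..m} \<Longrightarrow> [shuffle_sign A (J - A)] \<cdot> (contraction R k x A \<otimes> y (J - A)) \<in> carrier R"
     "A \<subseteq> J \<Longrightarrow> k \<in> {1..m} \<Longrightarrow> [shuffle_sign A (J - A)] \<cdot> (y A \<otimes> contraction R k x (J - A)) \<in> carrier R" for A k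
    using sub[of A] c[of k A] c[of k "J - A"] y by simp_all
  have e1: "[shuffle_sign A (J - A)] \<cdot> (ext_diff m R g x A \<otimes> y (J - A)) =
      (\<Oplus>k\<in>{1..m}. g k \<otimes> ([shuffle_sign A (J - A)] \<cdot> (contraction R k x A \<otimes> y (J - A))))" if A: "A \<subseteq> J" for A
  proof -
    have "ext_diff m R g x A \<otimes> y (J - A) = (\<Oplus>k\<in>{1..m}. (g k \<otimes> contraction R k x A) \<otimes> y (J - A))"
      unfolding ext_diff_def using sub[OF A] y
      by (simp del: atLeastAtMost_iff One_nat_def) (intro finsum_ldistr; simp add: g c Pi_iff del: atLeastAtMost_iff One_nat_def)
    also have "[shuffle_sign A (J - A)] \<cdot> \<dots> =
      (\<Oplus>k\<in>{1..m}. [shuffle_sign A (J - A)] \<cdot> ((g k \<otimes> contraction R k x A) \<otimes> y (J - A)))"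
      using sub[OF A] y by (intro smul_finsum) (simp_all add: g c del: atLeastAtMost_iff One_nat_def)
    also have "\<dots> = (\<Oplus>k\<in>{1..m}. g k \<otimes> ([shuffle_sign A (J - A)] \<cdot> (contraction R k x A \<otimes> y (J - A))))"
      using sub[OF A] y
      by (intro finsum_cong') (simp_all add: g c Pi_iff m_assoc add_pow_rdistr_int del: atLeastAtMost_iff One_nat_def)
    finally show ?thesis .
  qed
  have e2: "[shuffle_sign A (J - A)] \<cdot> (y A \<otimes> ext_diff m R g x (J - A)) =
      (\<Oplus>k\<in>{1..m}. g k \<otimes> ([shuffle_sign A (J - A)] \<cdot> (y A \<otimes> contraction R k x (J - A))))" if A: "A \<subseteq> J" for A
  proof -
    have "y A \<otimes> ext_diff m R g x (J - A) = (\<Oplus>k\<in>{1..m}. y A \<otimes> (g k \<otimes> contraction R k x (J - A)))"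
      unfolding ext_diff_def using sub[OF A] y
      by (simp del: atLeastAtMost_iff One_nat_def) (intro finsum_rdistr; simp add: g c Pi_iff del: atLeastAtMost_iff One_nat_def)
    also have "[shuffle_sign A (J - A)] \<cdot> \<dots> =
      (\<Oplus>k\<in>{1..m}. [shuffle_sign A (J - A)] \<cdot> (y A \<otimes> (g k \<otimes> contraction R k x (J - A))))"
      using sub[OF A] y by (intro smul_finsum) (simp_all add: g c del: atLeastAtMost_iff One_nat_def)
    also have "\<dots> = (\<Oplus>k\<in>{1..m}. g k \<otimes> ([shuffle_sign A (J - A)] \<cdot> (y A \<otimes> contraction R k x (J - A))))"
      using sub[OF A] y
      by (intro finsum_cong') (simp_all add: g c Pi_iff m_lcomm add_pow_rdistr_int del: atLeastAtMost_iff One_nat_def)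
    finally show ?thesis .
  qed
  have "ext_prod R (ext_diff m R g x) y J =
      (\<Oplus>A\<in>Pow J. \<Oplus>k\<in>{1..m}. g k \<otimes> ([shuffle_sign A (J - A)] \<cdot> (contraction R k x A \<otimes> y (J - A))))"
    unfolding ext_prod_def
    by (intro finsum_cong') (simp_all add: e1 g cl Pi_iff del: atLeastAtMost_iff One_nat_def)
  also have "\<dots> = (\<Oplus>k\<in>{1..m}. \<Oplus>A\<in>Pow J. g k \<otimes> ([shuffle_sign A (J - A)] \<cdot> (contraction R k x A \<otimes> y (J - A))))"
    by (intro finsum_swap) (simp_all add: fJ g cl del: atLeastAtMost_iff One_nat_def)
  also have "\<dots> = (\<Oplus>k\<in>{1..m}. g k \<otimes> ext_prod R (contraction R k x) y J)"
    unfolding ext_prod_def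
    by (intro finsum_cong') (simp_all add: finsum_rdistr fJ g cl Pi_iff del: atLeastAtMost_iff One_nat_def)
  finally show "ext_prod R (ext_diff m R g x) y J = (\<Oplus>k\<in>{1..m}. g k \<otimes> ext_prod R (contraction R k x) y J)" .
  have "ext_prod R y (ext_diff m R g x) J =
      (\<Oplus>A\<in>Pow J. \<Oplus>k\<in>{1..m}. g k \<otimes> ([shuffle_sign A (J - A)] \<cdot> (y A \<otimes> contraction R k x (J - A))))"
    unfolding ext_prod_def
    by (intro finsum_cong') (simp_all add: e2 g cl Pi_iff del: atLeastAtMost_iff One_nat_def)
  also have "\<dots> = (\<Oplus>k\<in>{1..m}. \<Oplus>A\<in>Pow J. g k \<otimes> ([shuffle_sign A (J - A)] \<cdot> (y A \<otimes> contraction R k x (J - A))))"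
    by (intro finsum_swap) (simp_all add: fJ g cl del: atLeastAtMost_iff One_nat_def)
  also have "\<dots> = (\<Oplus>k\<in>{1..m}. g k \<otimes> ext_prod R y (contraction R k x) J)"
    unfolding ext_prod_def
    by (intro finsum_cong') (simp_all add: finsum_rdistr fJ g cl Pi_iff del: atLeastAtMost_iff One_nat_def)
  finally show "ext_prod R y (ext_diff m R g x) J = (\<Oplus>k\<in>{1..m}. g k \<otimes> ext_prod R y (contraction R k x) J)" .
qed

lemma ext_diff_graded_derivation:
  assumes g: "\<And>k. k \<in> {1..m} \<Longrightarrow> g k \<in> carrier R"
  shows "graded_derivation m R (ext_diff m R g)"
proof -
  have val: "x A \<in> carrier R" if "x \<in> carrier (exterior_algebra m R)" "A \<subseteq> {1..m}" for x A
    using that by (auto simp: exterior_algebra_simps)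
  have add: "ext_diff m R g (x \<oplus>\<^bsub>exterior_algebra m R\<^esub> y) =
      ext_diff m R g x \<oplus>\<^bsub>exterior_algebra m R\<^esub> ext_diff m R g y"
    if x: "x \<in> carrier (exterior_algebra m R)" and y: "y \<in> carrier (exterior_algebra m R)" for x y
  proof
    fix J
    show "ext_diff m R g (x \<oplus>\<^bsub>exterior_algebra m R\<^esub> y) J =
      (ext_diff m R g x \<oplus>\<^bsub>exterior_algebra m R\<^esub> ext_diff m R g y) J"
    proof (cases "J \<subseteq> {1..m}")
      case True
      note c = contraction_closed[of m x, OF val[OF x] _ True] contraction_closed[of m y, OF val[OF y] _ True]
      have "contraction R k (x \<oplus>\<^bsub>exterior_algebra m R\<^esub> y) J = contraction R k x J \<oplus> contraction R k y J"
        if "k \<in> {1..m}" for k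
        using True that val[OF x, of "insert k J"] val[OF y, of "insert k J"]
        by (simp add: contraction_def exterior_algebra_simps smul_add)
      then have "ext_diff m R g (x \<oplus>\<^bsub>exterior_algebra m R\<^esub> y) J =
         (\<Oplus>k\<in>{1..m}. g k \<otimes> contraction R k x J \<oplus> g k \<otimes> contraction R k y J)"
        using True unfolding ext_diff_def
        by (simp del: atLeastAtMost_iff One_nat_def) (intro finsum_cong'; simp add: c g r_distr Pi_iff del: atLeastAtMost_iff One_nat_def)
      also have "\<dots> = ext_diff m R g x J \<oplus> ext_diff m R g y J"
        using True unfolding ext_diff_def
        by (simp del: atLeastAtMost_iff One_nat_def) (intro finsum_addf; simp add: c g Pi_iff del: atLeastAtMost_iff One_nat_def)
      finally show ?thesis using True by (simp add: exterior_algebra_simps)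
    qed (simp add: ext_diff_def exterior_algebra_simps)
  qed
  have leib: "ext_diff m R g (x \<otimes>\<^bsub>exterior_algebra m R\<^esub> y) =
        ext_diff m R g x \<otimes>\<^bsub>exterior_algebra m R\<^esub> y \<oplus>\<^bsub>exterior_algebra m R\<^esub>
        [((- 1) ^ p :: int)] \<cdot>\<^bsub>exterior_algebra m R\<^esub> (x \<otimes>\<^bsub>exterior_algebra m R\<^esub> ext_diff m R g y)"
    if xh: "x \<in> ext_homogeneous m R p" and y: "y \<in> carrier (exterior_algebra m R)" for x y p
  proof
    fix J
    have x: "x \<in> carrier (exterior_algebra m R)" using xh by (simp add: ext_homogeneous_def)
    have hom: "x A = \<zero>" if "A \<subseteq> {1..m}" "card A \<noteq> p" for A
      using xh that by (auto simp: ext_homogeneous_def)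
    show "ext_diff m R g (x \<otimes>\<^bsub>exterior_algebra m R\<^esub> y) J =
        (ext_diff m R g x \<otimes>\<^bsub>exterior_algebra m R\<^esub> y \<oplus>\<^bsub>exterior_algebra m R\<^esub>
        [((- 1) ^ p :: int)] \<cdot>\<^bsub>exterior_algebra m R\<^esub> (x \<otimes>\<^bsub>exterior_algebra m R\<^esub> ext_diff m R g y)) J"
    proof (cases "J \<subseteq> {1..m}")
      case True
      let ?P = "\<lambda>k. ext_prod R (contraction R k x) y J" and ?Q = "\<lambda>k. ext_prod R x (contraction R k y) J"
      have cP: "?P k \<in> carrier R" and cQ: "?Q k \<in> carrier R" if "k \<in> {1..m}" for k
        using True that val[OF x] val[OF y] by (auto intro!: ext_prod_closed contraction_closed simp del: atLeastAtMost_iff One_nat_def)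
      have eq: "contraction R k (restrict (ext_prod R x y) (Pow {1..m})) J = ?P k \<oplus> [((- 1) ^ p :: int)] \<cdot> ?Q k"
        if "k \<in> {1..m}" for k
        using contraction_leibniz[OF val[OF x] val[OF y] that True hom]
          contraction_cong[of m "restrict (ext_prod R x y) (Pow {1..m})" "ext_prod R x y" k J] True that by simp
      have mem: "x \<otimes>\<^bsub>exterior_algebra m R\<^esub> ext_diff m R g y \<in> carrier (exterior_algebra m R)"
        unfolding exterior_algebra_simps
        using val[OF x] val[OF ext_diff_closed[OF g y]] by (auto intro!: ext_prod_closed simp del: atLeastAtMost_iff One_nat_def)
      have "ext_diff m R g (x \<otimes>\<^bsub>exterior_algebra m R\<^esub> y) J =
          (\<Oplus>k\<in>{1..m}. g k \<otimes> ?P k \<oplus> [((- 1) ^ p :: int)] \<cdot> (g k \<otimes> ?Q k))"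
        using True unfolding ext_diff_def exterior_algebra_simps
        by (simp del: atLeastAtMost_iff One_nat_def)
          (intro finsum_cong'; simp add: eq cP cQ g r_distr add_pow_rdistr_int Pi_iff del: atLeastAtMost_iff One_nat_def)
      also have "\<dots> = (\<Oplus>k\<in>{1..m}. g k \<otimes> ?P k) \<oplus> (\<Oplus>k\<in>{1..m}. [((- 1) ^ p :: int)] \<cdot> (g k \<otimes> ?Q k))"
        by (intro finsum_addf; simp add: cP cQ g Pi_iff del: atLeastAtMost_iff One_nat_def)
      also have "(\<Oplus>k\<in>{1..m}. [((- 1) ^ p :: int)] \<cdot> (g k \<otimes> ?Q k)) = [((- 1) ^ p :: int)] \<cdot> (\<Oplus>k\<in>{1..m}. g k \<otimes> ?Q k)"
        by (intro smul_finsum[symmetric]; simp add: cQ g del: atLeastAtMost_iff One_nat_def)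
      finally have *: "ext_diff m R g (x \<otimes>\<^bsub>exterior_algebra m R\<^esub> y) J =
         ext_prod R (ext_diff m R g x) y J \<oplus> [((- 1) ^ p :: int)] \<cdot> ext_prod R x (ext_diff m R g y) J"
        using ext_prod_diff(1)[OF g val[OF x] val[OF y] True]
          ext_prod_diff(2)[OF g val[OF y] val[OF x] True] by simp
      show ?thesis
        unfolding * using True exterior_algebra_smul[OF mem True, of p]
        by (simp add: exterior_algebra_simps)
    qed (simp add: ext_diff_def exterior_algebra_simps)
  qed
  show ?thesis
    unfolding graded_derivation_def using leib add ext_diff_closed[OF g] by (auto simp: hom_def)
qed

lemma ext_diff_generator:
  assumes g: "\<And>k. k \<in> {1..m} \<Longrightarrow> g k \<in> carrier R" and i: "i \<in> {1..m}"
  shows "ext_diff m R g (ext_tensor m R {i} \<one>) = ext_tensor m R {} (g i)"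
proof
  fix J
  show "ext_diff m R g (ext_tensor m R {i} \<one>) J = ext_tensor m R {} (g i) J"
  proof (cases "J \<subseteq> {1..m}")
    case True
    have c: "contraction R k (ext_tensor m R {i} \<one>) J = (if J = {} \<and> k = i then \<one> else \<zero>)" if "k \<in> {1..m}" for k
      using True that by (auto simp: contraction_def ext_tensor_def eps_def)
    show ?thesis
    proof (cases "J = {}")
      case J: True
      have "ext_diff m R g (ext_tensor m R {i} \<one>) J = (\<Oplus>k\<in>{1..m}. if i = k then g k else \<zero>)"
        unfolding ext_diff_def using True
        by (simp del: atLeastAtMost_iff One_nat_def) (intro finsum_cong'; auto simp: J c[unfolded J] g simp del: atLeastAtMost_iff One_nat_def)
      also have "\<dots> = g i"
        using i g by (intro finsum_singleton) auto
      finally show ?thesis using J by (simp add: ext_tensor_def)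
    next
      case J: False
      have "ext_diff m R g (ext_tensor m R {i} \<one>) J = \<zero>"
        unfolding ext_diff_def using True
        by (simp del: atLeastAtMost_iff One_nat_def) (intro add.finprod_one_eqI; simp add: J c g del: atLeastAtMost_iff One_nat_def)
      then show ?thesis using J True by (simp add: ext_tensor_def)
    qed
  qed (simp add: ext_diff_def ext_tensor_def)
qed

lemma ext_diff_scalar:
  assumes g: "\<And>k. k \<in> {1..m} \<Longrightarrow> g k \<in> carrier R"
  shows "ext_diff m R g (ext_tensor m R {} s) = \<zero>\<^bsub>exterior_algebra m R\<^esub>"
proof
  fix J
  show "ext_diff m R g (ext_tensor m R {} s) J = \<zero>\<^bsub>exterior_algebra m R\<^esub> J"
  proof (cases "J \<subseteq> {1..m}")
    case True
    have "contraction R k (ext_tensor m R {} s) J = \<zero>" if "k \<in> {1..m}" for k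
      using True that by (auto simp: contraction_def ext_tensor_def)
    then have "ext_diff m R g (ext_tensor m R {} s) J = \<zero>"
      unfolding ext_diff_def using True
      by (simp del: atLeastAtMost_iff One_nat_def) (intro add.finprod_one_eqI; simp add: g del: atLeastAtMost_iff One_nat_def)
    then show ?thesis using True by (simp add: exterior_algebra_simps)
  qed (simp add: ext_diff_def exterior_algebra_simps)
qed

end

lemma poly_ring_cring: "cring (poly_ring m)"
proof (rule cringI)
  show "abelian_group (poly_ring m)"
  proof (rule abelian_groupI)
    fix p assume p: "p \<in> carrier (poly_ring m)"
    then show "\<exists>q\<in>carrier (poly_ring m). q \<oplus>\<^bsub>poly_ring m\<^esub> p = \<zero>\<^bsub>poly_ring m\<^esub>"
      by (intro bexI[of _ "- p"]) (auto simp: poly_ring_def)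
  qed (use Poly_Mapping.keys_add in \<open>fastforce simp: poly_ring_def\<close>)+
  show "Group.comm_monoid (poly_ring m)"
  proof (rule comm_monoidI)
    fix p q assume p: "p \<in> carrier (poly_ring m)" and q: "q \<in> carrier (poly_ring m)"
    show "p \<otimes>\<^bsub>poly_ring m\<^esub> q \<in> carrier (poly_ring m)"
      unfolding poly_ring_def
    proof (clarsimp simp del: atLeastAtMost_iff One_nat_def)
      fix t i assume "t \<in> Poly_Mapping.keys (p * q)" and i: "i \<in> Poly_Mapping.keys t"
      then obtain a b where ab: "t = a + b" "a \<in> Poly_Mapping.keys p" "b \<in> Poly_Mapping.keys q"
        using keys_mult[of p q] by blast
      then have "i \<in> Poly_Mapping.keys a \<union> Poly_Mapping.keys b"
        using i Poly_Mapping.keys_add[of a b] by blast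
      then show "i \<in> {1..m}" using ab(2,3) p q unfolding poly_ring_def by fastforce
    qed
  qed (auto simp: poly_ring_def mult_ac)
qed (auto simp: poly_ring_def algebra_simps)

lemma poly_monomial_closed: "I \<subseteq> {1..m} \<Longrightarrow> (\<Prod>i\<in>I. poly_var i) \<in> carrier (poly_ring m)"
proof (induction I rule: infinite_finite_induct)
  case (insert i I)
  interpret P: cring "poly_ring m" by (rule poly_ring_cring)
  have "poly_var i \<in> carrier (poly_ring m)" using insert.prems by (auto simp: poly_ring_def poly_var_def)
  then have "poly_var i \<otimes>\<^bsub>poly_ring m\<^esub> (\<Prod>i\<in>I. poly_var i) \<in> carrier (poly_ring m)"
    using insert by (intro P.m_closed) auto
  then show ?case using insert by (simp add: poly_ring_def)
qed (auto simp: poly_ring_def)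

lemma SR_ideal_ideal: "ideal (SR_ideal m K) (poly_ring m)"
proof -
  interpret P: cring "poly_ring m" by (rule poly_ring_cring)
  show ?thesis unfolding SR_ideal_def using poly_monomial_closed by (intro P.genideal_ideal) auto
qed

lemma SR_ring_cring: "cring (SR_ring m K)"
  unfolding SR_ring_def by (rule ideal.quotient_is_cring[OF SR_ideal_ideal poly_ring_cring])

lemma SR_monomial_closed: "I \<subseteq> {1..m} \<Longrightarrow> SR_monomial m K I \<in> carrier (SR_ring m K)"
  using poly_monomial_closed by (auto simp: SR_monomial_def SR_ring_def FactRing_def A_RCOSETS_def' a_r_coset_def')

lemma SR_monomial_empty: "SR_monomial m K {} = \<one>\<^bsub>SR_ring m K\<^esub>"
  by (simp add: SR_monomial_def SR_ring_def FactRing_def poly_ring_def)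

theorem koszul_d_exists: "\<exists>d. is_koszul_d m K d"
proof -
  interpret S: cring "SR_ring m K" by (rule SR_ring_cring)
  have g: "SR_monomial m K {k} \<in> carrier (SR_ring m K)" if "k \<in> {1..m}" for k
    using that by (intro SR_monomial_closed) auto
  show ?thesis
    using S.ext_diff_graded_derivation[of m "\<lambda>k. SR_monomial m K {k}", OF g]
      S.ext_diff_generator[of m "\<lambda>k. SR_monomial m K {k}", OF g]
      S.ext_diff_scalar[of m "\<lambda>k. SR_monomial m K {k}", OF g]
    unfolding is_koszul_d_def koszul_u_def koszul_v_def koszul_monomial_def koszul_algebra_def SR_monomial_empty
    by blast
qed

theorem koszul_d'_exists: "\<exists>d'. is_koszul_d' m K d'"
proof -
  interpret S: cring "SR_ring m K" by (rule SR_ring_cring)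
  have g: "\<one>\<^bsub>SR_ring m K\<^esub> \<in> carrier (SR_ring m K)" by simp
  show ?thesis
    using S.ext_diff_graded_derivation[of m "\<lambda>k. \<one>\<^bsub>SR_ring m K\<^esub>", OF g]
      S.ext_diff_generator[of m "\<lambda>k. \<one>\<^bsub>SR_ring m K\<^esub>", OF g]
      S.ext_diff_scalar[of m "\<lambda>k. \<one>\<^bsub>SR_ring m K\<^esub>", OF g]
    unfolding is_koszul_d'_def koszul_u_def koszul_v_def koszul_monomial_def koszul_algebra_def SR_monomial_empty
      exterior_algebra_simps(3)
    by blast
qed

end

theory Submission
  imports Defs
begin

text \<open>
  In all three complexes the differential \<open>d'\<close> is a Koszul differential over the integers in which
  every generator goes to a unit, so that multiplication by a generator is a contracting homotopy.

  In the full Koszul algebra the Leibniz rule gives \<open>d'(u\<^sub>1 x) = x - u\<^sub>1 d' x\<close>; a cocycle \<open>x\<close> is thus the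
  coboundary of \<open>u\<^sub>1 x\<close>.  That conversely \<open>d'd' = 0\<close> is not part of the characterisation of \<open>d'\<close> by its
  values on the generators.  It follows because the algebra is generated by the \<open>u\<^sub>k\<close> and the scalars
  (lemma \<open>exterior_algebra_induct\<close>), because \<open>d'd'\<close> commutes with multiplication by \<open>u\<^sub>k\<close>, and because
  \<open>d'\<close> kills all scalars, the \<open>v\<^sub>i\<close> being generators of the Stanley--Reisner ring.

  On the cochains, \<open>d'\<close> removes from \<open>I\<close> an element outside \<open>L\<close> and leaves \<open>L\<close> alone.  For each \<open>L \<noteq> [m]\<close>
  putting back the least vertex outside \<open>L\<close> contracts the part spanned by the \<open>\<alpha>\<^sub>L\<^sub>,\<^sub>I\<close>
  (lemma \<open>cochain_homotopy\<close>).  Unless \<open>K\<close> is the full simplex every face \<open>L\<close> is of this kind and \<open>d'\<close> is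
  exact.  For the full simplex only \<open>\<alpha>\<close> with \<open>L = I = [m]\<close> remains, which is the generator in degree \<open>2m\<close>.

  Exactness of \<open>d'\<close> makes the second double cohomology the cohomology of a trivial group.  The total
  cohomology vanishes because \<open>d\<close> raises the cardinality of \<open>L\<close>, which is bounded: subtracting the total
  coboundary of \<open>h x\<close>, with \<open>h\<close> the homotopy for \<open>d'\<close>, moves a total cocycle \<open>x\<close> one step up this finite
  filtration.  Both arguments are carried out in the locale \<open>contractible_bicomplex\<close>.

  The results for \<open>R\<^sup>*(K)\<close> are transported along the bicomplex isomorphism sending \<open>\<alpha>\<^sub>L\<^sub>,\<^sub>I\<close> to \<open>u\<^sub>J v\<^sub>L\<close>,
  \<open>J = I - L\<close>, up to the sign that is the product of the \<open>\<epsilon>(l, I)\<close> over \<open>l \<in> L\<close>.  For this \<open>d\<close> and \<open>d'\<close> have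
  to be known on the monomials: they are determined by their values on generators, hence agree with the
  explicit derivations \<open>ext_diff\<close>.  Injectivity amounts to the linear independence of the square-free
  monomials \<open>v\<^sub>L\<close>, \<open>L \<in> K\<close>, which holds because every monomial occurring in the Stanley--Reisner ideal has a
  non-face as its support.
\<close>

section \<open>Cohomology groups and contractible bicomplexes\<close>

lemma trivial_cohomology_at:
  assumes "group B" "group C" "f \<in> hom B C" "f ` carrier A = kernel B C f"
  shows "trivial_group (cohomology_at A B C f)"
proof -
  interpret group_hom B C f
    using assms by (simp add: group_hom_def group_hom_axioms_def)
  let ?Z = "B\<lparr>carrier := kernel B C f\<rparr>"
  interpret Z: group ?Z by (rule subgroup.subgroup_is_group[OF subgroup_kernel assms(1)])
  interpret Q: normal "carrier ?Z" ?Z by (rule Z.normal_self)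
  interpret M: group "?Z Mod carrier ?Z" by (rule Q.factorgroup_is_group)
  have "carrier ?Z #>\<^bsub>?Z\<^esub> x = carrier ?Z" if "x \<in> carrier ?Z" for x
    using Z.coset_join2[OF that Z.subgroup_self that] .
  then have "carrier (?Z Mod carrier ?Z) \<subseteq> {carrier ?Z}"
    by (auto simp: carrier_FactGroup)
  then have "trivial_group (?Z Mod carrier ?Z)"
    using M.trivial_group_alt by blast
  then show ?thesis by (simp add: cohomology_at_def assms(4))
qed

text \<open>Modulo the trivial subgroup all cosets are singletons, so the cohomology is a copy of the infinite
  cyclic group \<open>B\<close>.\<close>

lemma cohomology_at_infinite_cyclic:
  assumes "group B" "group C" "f \<in> hom B C"
    and im: "f ` carrier A = {\<one>\<^bsub>B\<^esub>}" and ker: "kernel B C f = carrier B"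
    and a: "a \<in> carrier B" and car: "carrier B = generate B {a}"
    and inj: "\<And>n::int. a [^]\<^bsub>B\<^esub> n = \<one>\<^bsub>B\<^esub> \<Longrightarrow> n = 0"
  defines "H \<equiv> cohomology_at A B C f" and "c \<equiv> f ` carrier A #>\<^bsub>B\<^esub> a"
  shows "H \<cong> integer_group \<and> c \<in> carrier H \<and> carrier H = generate H {c}"
proof -
  interpret B: group B by fact
  have H: "H = B Mod {\<one>\<^bsub>B\<^esub>}" by (simp add: H_def cohomology_at_def im ker)
  interpret T: normal "{\<one>\<^bsub>B\<^esub>}" B by (rule B.one_is_normal)
  interpret M: group H unfolding H by (rule T.factorgroup_is_group)
  have c: "c = {\<one>\<^bsub>B\<^esub>} #>\<^bsub>B\<^esub> a" by (simp add: c_def im)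
  have hom: "(\<lambda>x. {\<one>\<^bsub>B\<^esub>} #>\<^bsub>B\<^esub> x) \<in> hom B H" unfolding H by (rule T.r_coset_hom_Mod)
  have coset: "{\<one>\<^bsub>B\<^esub>} #>\<^bsub>B\<^esub> x = {x}" if "x \<in> carrier B" for x
    using that by (auto simp: r_coset_def)
  have carH: "carrier H = (\<lambda>x. {\<one>\<^bsub>B\<^esub>} #>\<^bsub>B\<^esub> x) ` carrier B" by (simp add: H carrier_FactGroup)
  interpret q: group_hom B H "\<lambda>x. {\<one>\<^bsub>B\<^esub>} #>\<^bsub>B\<^esub> x"
    by unfold_locales (rule hom)
  have gen: "carrier H = generate H {c}"
    using q.generate_img[of "{a}"] a by (simp add: carH car c)
  have inj': "inj (pow B a :: int \<Rightarrow> _)"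
  proof (rule injI)
    fix i j :: int assume "a [^]\<^bsub>B\<^esub> i = a [^]\<^bsub>B\<^esub> j"
    then have "a [^]\<^bsub>B\<^esub> (i - j) = \<one>\<^bsub>B\<^esub>" using a by (simp add: B.int_pow_diff)
    then show "i = j" using inj by fastforce
  qed
  have pw: "generate B {a} = range (pow B a :: int \<Rightarrow> _)"
    using B.generate_pow[OF a] by auto
  have "pow B a \<in> iso integer_group B"
    using B.hom_integer_group_pow[OF a] inj' pw car by (auto simp: iso_def bij_betw_def)
  moreover have "(\<lambda>x. {\<one>\<^bsub>B\<^esub>} #>\<^bsub>B\<^esub> x) \<in> iso B H"
    using hom carH coset by (auto simp: iso_def bij_betw_def inj_on_def)
  ultimately have "integer_group \<cong> H" by (meson is_isoI iso_trans)
  then have "H \<cong> integer_group" by (simp add: group.iso_sym)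
  moreover have "c \<in> carrier H" using a by (auto simp: c carH)
  ultimately show ?thesis using gen by blast
qed

text \<open>A bicomplex with a homotopy \<open>h\<close> contracting \<open>d'\<close> and a finite decreasing filtration that \<open>d\<close>
  shifts and \<open>h\<close> preserves.  The groups are written multiplicatively.\<close>

locale contractible_bicomplex = comm_group A for A (structure) +
  fixes d d' h :: "'a \<Rightarrow> 'a" and F :: "nat \<Rightarrow> 'a set" and N :: nat
  assumes d_hom: "d \<in> hom A A" and d'_hom: "d' \<in> hom A A"
    and dd: "x \<in> carrier A \<Longrightarrow> d (d x) = \<one>"
    and d'd': "x \<in> carrier A \<Longrightarrow> d' (d' x) = \<one>"
    and anticommute: "x \<in> carrier A \<Longrightarrow> d (d' x) \<otimes> d' (d x) = \<one>"
    and homotopy: "x \<in> carrier A \<Longrightarrow> d' (h x) \<otimes> h (d' x) = x"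
    and F_0: "F 0 = carrier A" and F_N: "F N = {\<one>}"
    and F_subgroup: "subgroup (F p) A"
    and h_F: "x \<in> F p \<Longrightarrow> h x \<in> F p"
    and d_F: "x \<in> F p \<Longrightarrow> d x \<in> F (Suc p)"
begin

lemma h_closed: "x \<in> carrier A \<Longrightarrow> h x \<in> carrier A"
  using h_F[of x 0] by (simp add: F_0)

lemma closed [simp]: "x \<in> carrier A \<Longrightarrow> d x \<in> carrier A" "x \<in> carrier A \<Longrightarrow> d' x \<in> carrier A"
  using d_hom d'_hom by (auto simp: hom_def)

sublocale d: group_hom A A d by unfold_locales (rule d_hom)
sublocale d': group_hom A A d' by unfold_locales (rule d'_hom)

lemma h_one: "h \<one> = \<one>"
proof -
  have "h \<one> \<in> F N" using h_F[of \<one> N] by (simp add: F_N)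
  then show ?thesis by (simp add: F_N)
qed

lemma d'_image: "d' ` carrier A = kernel A A d'"
proof
  show "kernel A A d' \<subseteq> d' ` carrier A"
  proof
    fix x assume "x \<in> kernel A A d'"
    then have x: "x \<in> carrier A" "d' x = \<one>" by (auto simp: kernel_def)
    then have "d' (h x) = x" using homotopy[OF x(1)] h_one h_closed[OF x(1)] by simp
    then show "x \<in> d' ` carrier A" using h_closed[OF x(1)] by force
  qed
qed (auto simp: kernel_def d'd')

lemma trivial_cohomology: "trivial_group (cohomology A d')"
  unfolding cohomology_def by (rule trivial_cohomology_at) (use d'_image d'_hom in auto)

text \<open>The group \<open>H(A, d')\<close> consists of the single coset \<open>B = d' A\<close>.  What has to be seen is that the
  induced map sends \<open>B\<close> to itself, which holds since \<open>d\<close> preserves cocycles of \<open>d'\<close> by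
  anticommutativity.\<close>

lemma trivial_second_double_cohomology: "trivial_group (second_double_cohomology A d d')"
proof -
  let ?B = "d' ` carrier A"
  let ?H = "cohomology A d'"
  have t: "carrier ?H = {\<one>\<^bsub>?H\<^esub>}" "group ?H" using trivial_cohomology by (auto simp: trivial_group_def)
  have one: "\<one>\<^bsub>?H\<^esub> = ?B" by (simp add: cohomology_def cohomology_at_def)
  have sub: "subgroup ?B A" unfolding d'_image by (rule d'.subgroup_kernel)
  have dB: "d x \<in> ?B" if "x \<in> ?B" for x
  proof -
    have x: "x \<in> carrier A" "d' x = \<one>" using that by (auto simp: d'd')
    then have "d' (d x) = \<one>" using anticommute[OF x(1)] by simp
    then show ?thesis using x by (simp add: d'_image kernel_def)
  qed
  have ind: "induced_map A d' d ?B = ?B"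
  proof
    show "?B \<subseteq> induced_map A d' d ?B"
    proof
      fix y assume y: "y \<in> ?B"
      have "y = y \<otimes> d \<one>" using subgroup.mem_carrier[OF sub y] by simp
      then show "y \<in> induced_map A d' d ?B"
        using y subgroup.one_closed[OF sub] unfolding induced_map_def set_mult_def by blast
    qed
    show "induced_map A d' d ?B \<subseteq> ?B"
    proof
      fix y assume "y \<in> induced_map A d' d ?B"
      then obtain u v where "u \<in> ?B" "v \<in> ?B" "y = u \<otimes> d v"
        unfolding induced_map_def set_mult_def by blast
      then show "y \<in> ?B" using subgroup.m_closed[OF sub] dB by metis
    qed
  qed
  have "trivial_group (cohomology_at ?H ?H ?H (induced_map A d' d))"
  proof (rule trivial_cohomology_at)
    show "induced_map A d' d \<in> hom ?H ?H"
    proof -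
      have "?B \<otimes>\<^bsub>?H\<^esub> ?B = ?B"
        using monoid.l_one[OF group.is_monoid[OF t(2)], of ?B] t(1) by (simp add: one)
      then show ?thesis using t(1) ind by (simp add: hom_def one)
    qed
    show "induced_map A d' d ` carrier ?H = kernel ?H ?H (induced_map A d' d)"
      unfolding kernel_def t(1) one using ind by auto
  qed (use t in auto)
  then show ?thesis by (simp add: second_double_cohomology_def cohomology_def[of ?H])
qed

abbreviation "D x \<equiv> d x \<otimes> d' x"

lemma D_hom: "D \<in> hom A A"
  by (rule homI) (simp_all add: m_ac)

lemma D_D: "x \<in> carrier A \<Longrightarrow> D (D x) = \<one>"
proof -
  assume x: "x \<in> carrier A"
  have "D (D x) = (d (d x) \<otimes> d' (d' x)) \<otimes> (d (d' x) \<otimes> d' (d x))"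
    using x by (simp add: m_ac)
  then show ?thesis using x by (simp add: dd d'd' anticommute)
qed

lemma D_regroup:
  assumes "a \<in> carrier A" "b \<in> carrier A" "c \<in> carrier A"
  shows "(a \<otimes> inv b) \<otimes> (b \<otimes> c) = (c \<otimes> a) \<otimes> (inv b \<otimes> b)"
proof -
  have "inv b \<otimes> (b \<otimes> c) = c" using assms by (simp flip: m_assoc)
  then have "(a \<otimes> inv b) \<otimes> (b \<otimes> c) = a \<otimes> c" using assms by (simp add: m_assoc)
  then show ?thesis using assms by (simp add: m_comm[of c a])
qed

text \<open>Induction from the top of the filtration downwards: a total cocycle in \<open>F p\<close> is cohomologous to one
  in \<open>F (Suc p)\<close>.\<close>

lemma D_cycle_is_boundary:
  assumes "x \<in> F p" "p \<le> N" "D x = \<one>"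
  shows "x \<in> D ` carrier A"
  using assms(2,1,3)
proof (induction p arbitrary: x rule: inc_induct)
  case base
  have "D \<one> = \<one>" by simp
  then show ?case using base by (force simp: F_N)
next
  case (step p)
  interpret F: subgroup "F p" A by (rule F_subgroup)
  interpret F': subgroup "F (Suc p)" A by (rule F_subgroup)
  have x: "x \<in> carrier A" and hx: "h x \<in> carrier A" using step.prems F.mem_carrier h_closed by auto
  have "d' x = inv (d x)" using step.prems(2) x
    by (metis closed inv_equality m_comm)
  then have d'x: "d' x \<in> F (Suc p)" using d_F[OF step.prems(1)] by simp
  have hd: "h (d' x) \<in> F (Suc p)" "d (h x) \<in> F (Suc p)"
    using h_F[OF d'x] d_F[OF h_F[OF step.prems(1)]] by auto
  \<comment> \<open>The difference of \<open>x\<close> and the total coboundary of \<open>h x\<close>, rewritten by means of the homotopy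
    identity; as \<open>d' x\<close> is the inverse of \<open>d x\<close>, both factors lie one step deeper.\<close>
  define y where "y = h (d' x) \<otimes> inv (d (h x))"
  have yF: "y \<in> F (Suc p)" using hd by (simp add: y_def)
  have xy: "x = y \<otimes> D (h x)"
  proof -
    have "y \<otimes> D (h x) = (d' (h x) \<otimes> h (d' x)) \<otimes> (inv (d (h x)) \<otimes> d (h x))"
      unfolding y_def using hd hx F'.mem_carrier by (intro D_regroup) auto
    then show ?thesis using homotopy[OF x] hx x by simp
  qed
  interpret D: group_hom A A D by unfold_locales (rule D_hom)
  have y: "y \<in> carrier A" using yF by auto
  have "D x = D y \<otimes> D (D (h x))" using xy D.hom_mult[of y "D (h x)"] y hx
    by (metis closed m_closed)
  then have "D y = \<one>" using D_D[OF hx] step.prems(2) y by simp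
  then obtain z where z: "z \<in> carrier A" "y = D z" using step.IH[OF yF] by auto
  have "x = D (z \<otimes> h x)" using xy z hx D.hom_mult[of z "h x"] by simp
  then show ?case using z hx by blast
qed

lemma trivial_total_cohomology: "trivial_group (total_cohomology A d d')"
  unfolding total_cohomology_def cohomology_def
proof (rule trivial_cohomology_at)
  show "D ` carrier A = kernel A A D"
  proof
    show "kernel A A D \<subseteq> D ` carrier A"
      using D_cycle_is_boundary[of _ 0] by (auto simp: kernel_def F_0)
  qed (use D_D in \<open>auto simp: kernel_def\<close>)
qed (use D_hom in auto)

text \<open>The structure can be moved along an isomorphism that intertwines the differentials, by conjugating
  the homotopy; in this way the cochains take care of \<open>R\<^sup>*(K)\<close> as well.\<close>

lemma transport:
  assumes "comm_group B" and \<phi>: "\<phi> \<in> iso A B"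
    and e: "\<And>x. x \<in> carrier A \<Longrightarrow> e (\<phi> x) = \<phi> (d x)"
    and e': "\<And>x. x \<in> carrier A \<Longrightarrow> e' (\<phi> x) = \<phi> (d' x)"
  shows "contractible_bicomplex B e e' (\<phi> \<circ> h \<circ> inv_into (carrier A) \<phi>) (\<lambda>p. \<phi> ` F p) N"
proof -
  interpret B: comm_group B by fact
  have hom: "\<phi> \<in> hom A B" and bij: "bij_betw \<phi> (carrier A) (carrier B)" using \<phi> by (auto simp: iso_def)
  interpret \<phi>: group_hom A B \<phi> by unfold_locales (rule hom)
  let ?g = "inv_into (carrier A) \<phi>"
  have g: "?g (\<phi> x) = x" if "x \<in> carrier A" for x
    using that bij by (simp add: bij_betw_def)
  have carB: "carrier B = \<phi> ` carrier A" using bij by (simp add: bij_betw_def)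
  have FA: "x \<in> carrier A" if "x \<in> F p" for x p using that F_subgroup subgroup.mem_carrier by fast
  show ?thesis
  proof (intro contractible_bicomplex.intro contractible_bicomplex_axioms.intro B.comm_group_axioms)
    show "e \<in> hom B B" by (rule homI) (auto simp: carB e simp flip: \<phi>.hom_mult)
    show "e' \<in> hom B B" by (rule homI) (auto simp: carB e' simp flip: \<phi>.hom_mult)
    show "subgroup (\<phi> ` F p) B" for p by (rule \<phi>.subgroup_img_is_subgroup[OF F_subgroup])
  next
    fix y assume "y \<in> carrier B"
    then obtain x where x: "x \<in> carrier A" "y = \<phi> x" by (auto simp: carB)
    show "e (e y) = \<one>\<^bsub>B\<^esub>" "e' (e' y) = \<one>\<^bsub>B\<^esub>" using x by (simp_all add: e e' dd d'd')
    show "e (e' y) \<otimes>\<^bsub>B\<^esub> e' (e y) = \<one>\<^bsub>B\<^esub>"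
      using x by (simp add: e e' anticommute flip: \<phi>.hom_mult)
    show "e' ((\<phi> \<circ> h \<circ> ?g) y) \<otimes>\<^bsub>B\<^esub> (\<phi> \<circ> h \<circ> ?g) (e' y) = y"
      using x by (simp add: e' g h_closed homotopy flip: \<phi>.hom_mult)
  next
    fix p y assume "y \<in> \<phi> ` F p"
    then obtain x where x: "x \<in> F p" "y = \<phi> x" by auto
    show "(\<phi> \<circ> h \<circ> ?g) y \<in> \<phi> ` F p" using x by (simp add: g FA h_F)
    show "e y \<in> \<phi> ` F (Suc p)" using x by (simp add: e FA d_F)
  qed (simp_all add: carB F_0 F_N)
qed

end

section \<open>The cochain bicomplex and its contraction\<close>

lemma eps_insert:
  assumes "finite I" "i \<notin> I"
  shows "eps k (insert i I) = (if i < k then - eps k I else eps k I)"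
proof -
  have "{r \<in> insert i I. r < k} = (if i < k then insert i {r \<in> I. r < k} else {r \<in> I. r < k})" by auto
  then show ?thesis using assms by (simp add: eps_def)
qed

lemma eps_remove:
  assumes "finite I" "i \<in> I"
  shows "eps k (I - {i}) = (if i < k then - eps k I else eps k I)"
  using eps_insert[of "I - {i}" i k] assms by (simp add: insert_absorb split: if_splits)

lemma eps_sq_left [simp]: "eps k A * (eps k A * n) = n"
  by (simp flip: mult.assoc)

lemma minus_one_power_sq: "(- 1) ^ n * ((- 1) ^ n * x) = (x :: int)"
  by (cases "even n") simp_all

lemmas free_Abelian_induct = free_Abelian_group_induct[consumes 1, case_names zero diff gen]

lemma cochain_basisD:
  assumes "(L, I) \<in> cochain_basis m K"
  shows "L \<subseteq> I" "I \<subseteq> {1..m}" "L \<in> K" "finite I" "finite L" "L \<subseteq> {1..m}" "I - L \<subseteq> {1..m}"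
proof -
  show LI: "L \<subseteq> I" "I \<subseteq> {1..m}" "L \<in> K" using assms by (auto simp: cochain_basis_def full_subcomplex_def)
  show "finite I" using LI finite_subset by blast
  then show "finite L" using LI finite_subset by blast
  show "L \<subseteq> {1..m}" "I - L \<subseteq> {1..m}" using LI by auto
qed

text \<open>The cancellation behind \<open>dd = 0\<close> and \<open>d'd' = 0\<close>: exchanging the two summation variables shows that
  the sum is its own negative, and the free abelian group has no 2-torsion.\<close>

lemma frag_sum_antisymmetric:
  fixes g :: "'i \<Rightarrow> 'i \<Rightarrow> 'b \<Rightarrow>\<^sub>0 int"
  assumes "finite S" and anti: "\<And>i j. i \<in> S \<Longrightarrow> j \<in> S \<Longrightarrow> i \<noteq> j \<Longrightarrow> g i j = - g j i"
  shows "(\<Sum>i\<in>S. \<Sum>j\<in>S - {i}. g i j) = 0" (is "?s = 0")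
proof -
  have split: "S - {i} = {j \<in> S. i \<noteq> j}" "{j \<in> S. j \<noteq> i} = S - {i}" for i by auto
  have "?s = (\<Sum>i\<in>S. \<Sum>j\<in>{j \<in> S. i \<noteq> j}. g i j)"
    by (rule sum.cong[OF refl], rule sum.cong[OF split(1) refl])
  also have "\<dots> = (\<Sum>j\<in>S. \<Sum>i\<in>{i \<in> S. i \<noteq> j}. g i j)"
    by (rule sum.swap_restrict[OF assms(1) assms(1)])
  also have "\<dots> = (\<Sum>j\<in>S. \<Sum>i\<in>S - {j}. - g j i)"
    using anti by (intro sum.cong split(2) refl) auto
  also have "\<dots> = - ?s" by (simp only: sum_negf)
  finally have eq: "?s = - ?s" .
  have "Poly_Mapping.lookup ?s b = 0" for b
    using arg_cong[OF eq, of "\<lambda>x. Poly_Mapping.lookup x b"] by (simp only: lookup_uminus equal_neg_zero)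
  then show ?thesis by (intro poly_mapping_eqI) simp
qed

lemma cochain_d_of:
  "cochain_d K (frag_of (L, I)) =
    (\<Sum>j\<in>{j \<in> I - L. insert j L \<in> K}. frag_cmul (eps j L) (frag_of (insert j L, I)))"
  by (simp add: cochain_d_def cochain_\<alpha>_def)

lemma cochain_d'_of:
  "cochain_d' (frag_of (L, I)) =
    (\<Sum>i\<in>I - L. frag_cmul ((- 1) ^ card L * eps i I) (frag_of (L, I - {i})))"
  by (simp add: cochain_d'_def cochain_\<alpha>_def frag_cmul_sum)

lemma cochain_d_diff: "cochain_d K (x - y) = cochain_d K x - cochain_d K y"
  and cochain_d_add: "cochain_d K (x + y) = cochain_d K x + cochain_d K y"
  and cochain_d_zero: "cochain_d K 0 = 0"
  and cochain_d_cmul: "cochain_d K (frag_cmul c x) = frag_cmul c (cochain_d K x)"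
  and cochain_d_sum: "finite S \<Longrightarrow> cochain_d K (\<Sum>i\<in>S. f i) = (\<Sum>i\<in>S. cochain_d K (f i))"
  by (simp_all add: cochain_d_def frag_extend_diff frag_extend_add frag_extend_cmul frag_extend_sum o_def)

lemma cochain_d'_diff: "cochain_d' (x - y) = cochain_d' x - cochain_d' y"
  and cochain_d'_add: "cochain_d' (x + y) = cochain_d' x + cochain_d' y"
  and cochain_d'_zero: "cochain_d' 0 = 0"
  and cochain_d'_cmul: "cochain_d' (frag_cmul c x) = frag_cmul c (cochain_d' x)"
  and cochain_d'_sum: "finite S \<Longrightarrow> cochain_d' (\<Sum>i\<in>S. f i) = (\<Sum>i\<in>S. cochain_d' (f i))"
  by (simp_all add: cochain_d'_def frag_extend_diff frag_extend_add frag_extend_cmul frag_extend_sum o_def)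

lemmas cochain_d_simps = cochain_d_diff cochain_d_add cochain_d_zero cochain_d_cmul cochain_d_sum
lemmas cochain_d'_simps = cochain_d'_diff cochain_d'_add cochain_d'_zero cochain_d'_cmul cochain_d'_sum

lemma cochain_d'_d':
  assumes "\<And>L I. (L, I) \<in> Poly_Mapping.keys x \<Longrightarrow> finite I"
  shows "cochain_d' (cochain_d' x) = 0"
proof -
  have "Poly_Mapping.keys x \<subseteq> {(L, I). finite I}" using assms by auto
  then show ?thesis
  proof (induction x rule: frag_induction)
    case (one b)
    obtain L I where b: "b = (L, I)" "finite I" using one by auto
    have "cochain_d' (cochain_d' (frag_of (L, I))) =
      (\<Sum>i\<in>I - L. \<Sum>k\<in>I - {i} - L. frag_cmul ((- 1) ^ card L * eps i I * ((- 1) ^ card L * eps k (I - {i})))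
        (frag_of (L, I - {i} - {k})))"
      using b(2) by (simp add: cochain_d'_of cochain_d'_simps frag_cmul_sum)
    also have "\<dots> = (\<Sum>i\<in>I - L. \<Sum>k\<in>(I - L) - {i}. frag_cmul (eps i I * eps k (I - {i})) (frag_of (L, I - {i} - {k})))"
      by (intro sum.cong) (auto simp: mult_ac minus_one_power_sq)
    also have "\<dots> = 0"
    proof (rule frag_sum_antisymmetric)
      fix i k assume ik: "i \<in> I - L" "k \<in> I - L" "i \<noteq> k"
      then have "eps i I * eps k (I - {i}) = - (eps k I * eps i (I - {k}))"
        using b(2) by (auto simp: eps_remove)
      then show "frag_cmul (eps i I * eps k (I - {i})) (frag_of (L, I - {i} - {k})) =
          - frag_cmul (eps k I * eps i (I - {k})) (frag_of (L, I - {k} - {i}))"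
        by (simp add: insert_commute flip: Diff_insert2)
    qed (use b in auto)
    finally show ?case by (simp add: b)
  qed (simp_all add: cochain_d'_simps)
qed

lemma cochain_d_d:
  assumes K: "simplicial_complex_on m K" and "\<And>L I. (L, I) \<in> Poly_Mapping.keys x \<Longrightarrow> finite I \<and> L \<subseteq> I"
  shows "cochain_d K (cochain_d K x) = 0"
proof -
  have down: "L \<in> K" if "M \<in> K" "L \<subseteq> M" for L M
    using K that unfolding simplicial_complex_on_def by blast
  have "Poly_Mapping.keys x \<subseteq> {(L, I). finite I \<and> L \<subseteq> I}" using assms(2) by auto
  then show ?thesis
  proof (induction x rule: frag_induction)
    case (one b)
    obtain L I where b: "b = (L, I)" "finite I" "L \<subseteq> I" using one by auto
    have fL: "finite L" using b finite_subset by blast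
    let ?S = "{j \<in> I - L. insert j L \<in> K}"
    let ?g = "\<lambda>i k. if insert k (insert i L) \<in> K
      then frag_cmul (eps i L * eps k (insert i L)) (frag_of (insert k (insert i L), I)) else 0"
    have "cochain_d K (cochain_d K (frag_of (L, I))) = (\<Sum>i\<in>?S. \<Sum>k\<in>?S - {i}. ?g i k)"
    proof -
      have "cochain_d K (cochain_d K (frag_of (L, I))) =
        (\<Sum>i\<in>?S. \<Sum>k\<in>{k \<in> I - insert i L. insert k (insert i L) \<in> K}. ?g i k)"
        using b(2) by (simp add: cochain_d_of cochain_d_simps frag_cmul_sum)
      also have "\<dots> = (\<Sum>i\<in>?S. \<Sum>k\<in>?S - {i}. ?g i k)"
        using b(2) down by (intro sum.cong refl sum.mono_neutral_left) (auto intro: down)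
      finally show ?thesis .
    qed
    also have "\<dots> = 0"
    proof (rule frag_sum_antisymmetric)
      fix i k assume ik: "i \<in> ?S" "k \<in> ?S" "i \<noteq> k"
      then have "eps i L * eps k (insert i L) = - (eps k L * eps i (insert k L))"
        using fL by (auto simp: eps_insert)
      then show "?g i k = - ?g k i"
        by (simp add: insert_commute)
    qed (use b in auto)
    finally show ?case by (simp add: b)
  qed (simp_all add: cochain_d_simps)
qed

text \<open>The two composites run over the same pairs of a removed vertex and an added vertex.  Adding \<open>j\<close> to
  \<open>L\<close> affects neither \<open>\<epsilon>(i, I)\<close> nor \<open>\<epsilon>(j, L)\<close>; the sign comes from \<open>(-1)\<close> to the cardinality
  of \<open>L\<close> alone.\<close>

lemma cochain_anticommute:
  assumes "\<And>L I. (L, I) \<in> Poly_Mapping.keys x \<Longrightarrow> finite I \<and> L \<subseteq> I"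
  shows "cochain_d K (cochain_d' x) + cochain_d' (cochain_d K x) = 0"
proof -
  have "Poly_Mapping.keys x \<subseteq> {(L, I). finite I \<and> L \<subseteq> I}" using assms by auto
  then show ?thesis
  proof (induction x rule: frag_induction)
    case (one b)
    obtain L I where b: "b = (L, I)" "finite I" "L \<subseteq> I" using one by auto
    have fL: "finite L" using b finite_subset by blast
    let ?S = "\<lambda>i j. j \<noteq> i \<and> insert j L \<in> K"
    let ?g = "\<lambda>i j. frag_cmul ((- 1) ^ card L * eps i I * eps j L) (frag_of (insert j L, I - {i}))"
    have "cochain_d K (cochain_d' (frag_of (L, I))) = (\<Sum>i\<in>I - L. \<Sum>j\<in>{j \<in> I - {i} - L. insert j L \<in> K}. ?g i j)"
      using b(2) by (simp add: cochain_d_of cochain_d'_of cochain_d_simps frag_cmul_sum)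
    also have "\<dots> = (\<Sum>i\<in>I - L. \<Sum>j\<in>{j \<in> I - L. j \<noteq> i \<and> insert j L \<in> K}. ?g i j)"
      by (intro sum.cong refl) auto
    also have "\<dots> = (\<Sum>j\<in>I - L. \<Sum>i\<in>{i \<in> I - L. j \<noteq> i \<and> insert j L \<in> K}. ?g i j)"
      using b(2) by (intro sum.swap_restrict) auto
    also have "\<dots> = (\<Sum>j\<in>{j \<in> I - L. insert j L \<in> K}. \<Sum>i\<in>I - insert j L. ?g i j)"
    proof (rule sum.mono_neutral_cong_right)
      show "finite (I - L)" using b(2) by simp
      show "\<forall>j\<in>I - L - {j \<in> I - L. insert j L \<in> K}. (\<Sum>i\<in>{i \<in> I - L. j \<noteq> i \<and> insert j L \<in> K}. ?g i j) = 0"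
        by (auto intro!: sum.neutral)
      show "(\<Sum>i\<in>{i \<in> I - L. j \<noteq> i \<and> insert j L \<in> K}. ?g i j) = (\<Sum>i\<in>I - insert j L. ?g i j)"
        if "j \<in> {j \<in> I - L. insert j L \<in> K}" for j
        using that by (intro sum.cong) auto
    qed auto
    also have "\<dots> = - cochain_d' (cochain_d K (frag_of (L, I)))"
      using b(2) fL by (simp add: cochain_d_of cochain_d'_of cochain_d'_simps frag_cmul_sum mult_ac
          flip: sum_negf)
    finally show ?case by (simp add: b)
  next
    case (diff a b)
    have "cochain_d K (cochain_d' (a - b)) + cochain_d' (cochain_d K (a - b)) =
      (cochain_d K (cochain_d' a) + cochain_d' (cochain_d K a)) - (cochain_d K (cochain_d' b) + cochain_d' (cochain_d K b))"
      by (simp add: cochain_d_simps cochain_d'_simps)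
    then show ?case using diff by simp
  qed (simp_all add: cochain_d_simps cochain_d'_simps)
qed

text \<open>Multiplication by \<open>u\<^sub>i\<close> for the least vertex \<open>i\<close> outside \<open>L\<close>, in terms of cochains.  Since \<open>d'\<close> does
  not change \<open>L\<close>, the same \<open>i\<close> serves for \<open>h d'\<close> and for \<open>d' h\<close>.  For \<open>L = [m]\<close> there is no such vertex and
  the value is meaningless.\<close>

definition cochain_h :: "nat \<Rightarrow> (nat set \<times> nat set \<Rightarrow>\<^sub>0 int) \<Rightarrow> (nat set \<times> nat set \<Rightarrow>\<^sub>0 int)"
  where "cochain_h m = frag_extend (\<lambda>(L, I). let i = Min ({1..m} - L) in
    if i \<in> I then 0 else frag_cmul ((- 1) ^ card L * eps i I) (cochain_\<alpha> L (insert i I)))"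

lemma cochain_h_diff: "cochain_h m (x - y) = cochain_h m x - cochain_h m y"
  and cochain_h_zero: "cochain_h m 0 = 0"
  and cochain_h_cmul: "cochain_h m (frag_cmul c x) = frag_cmul c (cochain_h m x)"
  and cochain_h_sum: "finite S \<Longrightarrow> cochain_h m (\<Sum>i\<in>S. f i) = (\<Sum>i\<in>S. cochain_h m (f i))"
  by (simp_all add: cochain_h_def frag_extend_diff frag_extend_cmul frag_extend_sum o_def)

lemmas cochain_h_simps = cochain_h_diff cochain_h_zero cochain_h_cmul cochain_h_sum

lemma cochain_h_of:
  "i = Min ({1..m} - L) \<Longrightarrow> cochain_h m (frag_of (L, I)) =
     (if i \<in> I then 0 else frag_cmul ((- 1) ^ card L * eps i I) (frag_of (L, insert i I)))"
  by (simp add: cochain_h_def cochain_\<alpha>_def Let_def)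

text \<open>With \<open>i\<close> the least vertex outside \<open>L\<close>: if \<open>i \<in> I\<close>, then \<open>h\<close> kills \<open>\<alpha>\<^sub>L\<^sub>,\<^sub>I\<close> and, in \<open>h d'\<close>, every term
  but the one that removes \<open>i\<close>.  Otherwise removing \<open>i\<close> again in \<open>d' h\<close> gives back \<open>\<alpha>\<^sub>L\<^sub>,\<^sub>I\<close>, and the
  remaining terms of \<open>d' h\<close> and \<open>h d'\<close> cancel.\<close>

lemma cochain_homotopy:
  assumes "\<And>L I. (L, I) \<in> Poly_Mapping.keys x \<Longrightarrow> L \<subseteq> I \<and> I \<subseteq> {1..m} \<and> L \<noteq> {1..m}"
  shows "cochain_d' (cochain_h m x) + cochain_h m (cochain_d' x) = x"
proof -
  have "Poly_Mapping.keys x \<subseteq> {(L, I). L \<subseteq> I \<and> I \<subseteq> {1..m} \<and> L \<noteq> {1..m}}" using assms by auto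
  then show ?thesis
  proof (induction x rule: frag_induction)
    case (one b)
    obtain L I where b: "b = (L, I)" "L \<subseteq> I" "I \<subseteq> {1..m}" "L \<noteq> {1..m}" using one by auto
    have fI: "finite I" using b finite_subset by blast
    define i where "i = Min ({1..m} - L)"
    have "{1..m} - L \<noteq> {}" using b by auto
    then have i: "i \<in> {1..m} - L" unfolding i_def by (intro Min_in) auto
    note h_of = cochain_h_of[OF i_def]
    let ?s = "(- 1) ^ card L :: int"
    show ?case
    proof (cases "i \<in> I")
      case True
      have "cochain_h m (cochain_d' (frag_of (L, I))) =
         (\<Sum>k\<in>I - L. if k = i then frag_of (L, I) else 0)"
        using fI True
        unfolding cochain_d'_of cochain_h_sum[OF finite_Diff[OF fI]] cochain_h_cmul h_of
        by (intro sum.cong) (auto simp: eps_remove insert_absorb mult_ac minus_one_power_sq)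
      also have "\<dots> = frag_of (L, I)" using fI i True by simp
      finally show ?thesis using True by (simp add: b h_of cochain_d'_simps)
    next
      case False
      have ins: "insert i I - L = insert i (I - L)" "i \<notin> I - L" using i False by auto
      have rem: "insert i I - {k} = insert i (I - {k})" if "k \<in> I - L" for k using that False by auto
      have "cochain_d' (cochain_h m (frag_of (L, I))) = frag_of (L, I) +
          (\<Sum>k\<in>I - L. frag_cmul (eps i I * eps k (insert i I)) (frag_of (L, insert i (I - {k}))))"
        using fI False ins rem
        by (simp add: h_of cochain_d'_simps cochain_d'_of frag_cmul_distrib2 frag_cmul_sum eps_insert
            mult_ac minus_one_power_sq)
      also have "(\<Sum>k\<in>I - L. frag_cmul (eps i I * eps k (insert i I)) (frag_of (L, insert i (I - {k})))) =
         - cochain_h m (cochain_d' (frag_of (L, I)))"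
        using fI False
        by (simp add: cochain_d'_of cochain_h_simps h_of sum_negf[symmetric])
          (intro sum.cong, auto simp: eps_remove eps_insert mult_ac minus_one_power_sq)
      finally show ?thesis by (simp add: b)
    qed
  next
    case (diff a b)
    have "cochain_d' (cochain_h m (a - b)) + cochain_h m (cochain_d' (a - b)) =
      (cochain_d' (cochain_h m a) + cochain_h m (cochain_d' a)) - (cochain_d' (cochain_h m b) + cochain_h m (cochain_d' b))"
      by (simp add: cochain_h_simps cochain_d'_simps)
    then show ?case using diff by simp
  qed (simp_all add: cochain_h_simps cochain_d'_simps)
qed

lemma keys_frag_extend_subset:
  assumes "\<And>b. b \<in> Poly_Mapping.keys x \<Longrightarrow> Poly_Mapping.keys (f b) \<subseteq> T"
  shows "Poly_Mapping.keys (frag_extend f x) \<subseteq> T"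
  using keys_frag_extend[of f x] assms by blast

lemma keys_cochain_d:
  "Poly_Mapping.keys (cochain_d K x) \<subseteq> {(insert j L, I) | j L I. (L, I) \<in> Poly_Mapping.keys x \<and> j \<in> I - L \<and> insert j L \<in> K}"
  unfolding cochain_d_def
  by (intro keys_frag_extend_subset)
     (fastforce dest!: subsetD[OF keys_sum] subsetD[OF keys_cmul] simp: cochain_\<alpha>_def split: prod.splits)

lemma keys_cochain_d':
  "Poly_Mapping.keys (cochain_d' x) \<subseteq> {(L, I - {i}) | i L I. (L, I) \<in> Poly_Mapping.keys x \<and> i \<in> I - L}"
  unfolding cochain_d'_def
  by (intro keys_frag_extend_subset)
     (fastforce dest!: subsetD[OF keys_sum] subsetD[OF keys_cmul] simp: cochain_\<alpha>_def split: prod.splits)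

lemma keys_cochain_h:
  "Poly_Mapping.keys (cochain_h m x) \<subseteq> {(L, insert (Min ({1..m} - L)) I) | L I. (L, I) \<in> Poly_Mapping.keys x \<and> Min ({1..m} - L) \<notin> I}"
  unfolding cochain_h_def
  by (intro keys_frag_extend_subset)
     (auto intro!: order_trans[OF keys_cmul] simp: cochain_\<alpha>_def Let_def split: prod.splits)

definition cochain_filtration :: "nat \<Rightarrow> nat set set \<Rightarrow> nat \<Rightarrow> (nat set \<times> nat set \<Rightarrow>\<^sub>0 int) set"
  where "cochain_filtration m K p = {x. Poly_Mapping.keys x \<subseteq> {b \<in> cochain_basis m K. p \<le> card (fst b)}}"

lemma top_face_iff:
  assumes "simplicial_complex_on m K"
  shows "{1..m} \<in> K \<longleftrightarrow> K = full_simplex m"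
  using assms unfolding simplicial_complex_on_def full_simplex_def by blast

lemma Min_missing_vertex:
  fixes m :: nat
  assumes "L \<subseteq> {1..m}" "L \<noteq> {1..m}"
  shows "Min ({1..m} - L) \<in> {1..m}"
proof -
  have "{1..m} - L \<noteq> {}" using assms by auto
  then have "Min ({1..m} - L) \<in> {1..m} - L" by (intro Min_in finite_Diff finite_atLeastAtMost)
  then show ?thesis by (rule DiffD1)
qed

lemma subgroup_free_Abelian_group:
  assumes "T \<subseteq> S"
  shows "subgroup {x. Poly_Mapping.keys x \<subseteq> T} (free_Abelian_group S)"
proof
  show "x \<otimes>\<^bsub>free_Abelian_group S\<^esub> y \<in> {x. Poly_Mapping.keys x \<subseteq> T}"
    if "x \<in> {x. Poly_Mapping.keys x \<subseteq> T}" "y \<in> {x. Poly_Mapping.keys x \<subseteq> T}" for x y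
    using that Poly_Mapping.keys_add[of x y] by auto
  show "inv\<^bsub>free_Abelian_group S\<^esub> x \<in> {x. Poly_Mapping.keys x \<subseteq> T}"
    if "x \<in> {x. Poly_Mapping.keys x \<subseteq> T}" for x
    using that assms by (subst inv_free_Abelian_group) auto
qed (use assms in auto)

text \<open>The filtration is by the cardinality of \<open>L\<close>: \<open>d\<close> enlarges \<open>L\<close> by one vertex, whereas \<open>d'\<close> and \<open>h\<close>
  only change \<open>I\<close>.\<close>

lemma cochains_contractible:
  assumes K: "simplicial_complex_on m K" and "K \<noteq> full_simplex m"
  shows "contractible_bicomplex (cochains m K) (cochain_d K) cochain_d' (cochain_h m) (cochain_filtration m K) (Suc m)"
proof -
  let ?B = "cochain_basis m K"
  have top: "{1..m} \<notin> K" using assms top_face_iff by blast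
  note bD = cochain_basisD[of _ _ m K]
  have keys_d: "Poly_Mapping.keys (cochain_d K x) \<subseteq> {b \<in> ?B. Suc p \<le> card (fst b)}"
    if "Poly_Mapping.keys x \<subseteq> {b \<in> ?B. p \<le> card (fst b)}" for x p
  proof
    fix b assume "b \<in> Poly_Mapping.keys (cochain_d K x)"
    then obtain j L I where b: "b = (insert j L, I)" "(L, I) \<in> Poly_Mapping.keys x" "j \<in> I - L" "insert j L \<in> K"
      using keys_cochain_d[of K x] by auto
    then have LI: "(L, I) \<in> ?B" "p \<le> card L" using that by auto
    then show "b \<in> {b \<in> ?B. Suc p \<le> card (fst b)}"
      using b bD[OF LI(1)] by (auto simp: cochain_basis_def full_subcomplex_def)
  qed
  have keys_d': "Poly_Mapping.keys (cochain_d' x) \<subseteq> ?B" if "Poly_Mapping.keys x \<subseteq> ?B" for x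
    using that keys_cochain_d'[of x] by (fastforce simp: cochain_basis_def full_subcomplex_def)
  have keys_h: "Poly_Mapping.keys (cochain_h m x) \<subseteq> {b \<in> ?B. p \<le> card (fst b)}"
    if "Poly_Mapping.keys x \<subseteq> {b \<in> ?B. p \<le> card (fst b)}" for x p
  proof
    fix b assume "b \<in> Poly_Mapping.keys (cochain_h m x)"
    then obtain L I where b: "b = (L, insert (Min ({1..m} - L)) I)" "(L, I) \<in> Poly_Mapping.keys x"
      using keys_cochain_h[of m x] by auto
    then have LI: "(L, I) \<in> ?B" "p \<le> card L" using that by auto
    have "Min ({1..m} - L) \<in> {1..m}" using bD[OF LI(1)] top by (intro Min_missing_vertex) auto
    then show "b \<in> {b \<in> ?B. p \<le> card (fst b)}"
      using b LI bD[OF LI(1)] by (auto simp: cochain_basis_def full_subcomplex_def)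
  qed
  have car: "carrier (cochains m K) = {x. Poly_Mapping.keys x \<subseteq> ?B}" by (auto simp: cochains_def)
  show ?thesis
  proof (intro contractible_bicomplex.intro contractible_bicomplex_axioms.intro)
    show "comm_group (cochains m K)" unfolding cochains_def by (rule abelian_free_Abelian_group)
    show "cochain_d K \<in> hom (cochains m K) (cochains m K)"
      using keys_d[of _ 0] by (intro homI) (auto simp: cochains_def cochain_d_add)
    show "cochain_d' \<in> hom (cochains m K) (cochains m K)"
      using keys_d' by (intro homI) (auto simp: cochains_def cochain_d'_add)
    show "subgroup (cochain_filtration m K p) (cochains m K)" for p
      unfolding cochains_def cochain_filtration_def by (rule subgroup_free_Abelian_group) auto
    show "cochain_filtration m K 0 = carrier (cochains m K)"
      by (simp add: car cochain_filtration_def)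
    have empty: "{b \<in> ?B. Suc m \<le> card (fst b)} = {}"
    proof -
      have "card L \<le> m" if "(L, I) \<in> ?B" for L I
        using card_mono[OF _ bD(6)[OF that]] by simp
      then show ?thesis by fastforce
    qed
    show "cochain_filtration m K (Suc m) = {\<one>\<^bsub>cochains m K\<^esub>}"
      unfolding cochain_filtration_def empty by (auto simp: cochains_def)
  next
    fix x assume "x \<in> carrier (cochains m K)"
    then have x: "\<And>L I. (L, I) \<in> Poly_Mapping.keys x \<Longrightarrow> (L, I) \<in> ?B" by (auto simp: car)
    show "cochain_d K (cochain_d K x) = \<one>\<^bsub>cochains m K\<^esub>"
      using cochain_d_d[OF K, of x] bD[OF x] by (simp add: cochains_def)
    show "cochain_d' (cochain_d' x) = \<one>\<^bsub>cochains m K\<^esub>"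
      using cochain_d'_d'[of x] bD[OF x] by (simp add: cochains_def)
    show "cochain_d K (cochain_d' x) \<otimes>\<^bsub>cochains m K\<^esub> cochain_d' (cochain_d K x) = \<one>\<^bsub>cochains m K\<^esub>"
      using cochain_anticommute[of x K] bD[OF x] by (simp add: cochains_def)
    have "L \<subseteq> I \<and> I \<subseteq> {1..m} \<and> L \<noteq> {1..m}" if "(L, I) \<in> Poly_Mapping.keys x" for L I
      using bD[OF x[OF that]] top by auto
    then show "cochain_d' (cochain_h m x) \<otimes>\<^bsub>cochains m K\<^esub> cochain_h m (cochain_d' x) = x"
      using cochain_homotopy[of x m] by (simp add: cochains_def)
  next
    fix x p assume "x \<in> cochain_filtration m K p"
    then show "cochain_h m x \<in> cochain_filtration m K p" "cochain_d K x \<in> cochain_filtration m K (Suc p)"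
      using keys_h keys_d unfolding cochain_filtration_def by blast+
  qed
qed

definition cochain_basis_deg :: "nat \<Rightarrow> nat set set \<Rightarrow> int \<Rightarrow> (nat set \<times> nat set) set"
  where "cochain_basis_deg m K n = {b \<in> cochain_basis m K. total_degree (cochain_bidegree b) = n}"

lemma cochain_basis_deg_iff:
  "(L, I) \<in> cochain_basis_deg m K n \<longleftrightarrow> (L, I) \<in> cochain_basis m K \<and> int (card L) + int (card I) = n"
  by (auto simp: cochain_basis_deg_def total_degree_def cochain_bidegree_def)

lemma cochains_deg_eq: "cochains_deg m K n = free_Abelian_group (cochain_basis_deg m K n)"
  by (simp add: cochains_deg_def cochain_basis_deg_def)

lemma keys_cochain_d'_deg:
  assumes "Poly_Mapping.keys x \<subseteq> cochain_basis_deg m K n"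
  shows "Poly_Mapping.keys (cochain_d' x) \<subseteq> cochain_basis_deg m K (n - 1)"
proof
  fix b assume "b \<in> Poly_Mapping.keys (cochain_d' x)"
  then obtain i L I where b: "b = (L, I - {i})" "(L, I) \<in> Poly_Mapping.keys x" "i \<in> I - L"
    using keys_cochain_d'[of x] by auto
  then have LI: "(L, I) \<in> cochain_basis m K" "int (card L) + int (card I) = n"
    using assms cochain_basis_deg_iff by blast+
  have "card I > 0" using b cochain_basisD[OF LI(1)] by (auto simp: card_gt_0_iff)
  then show "b \<in> cochain_basis_deg m K (n - 1)"
    using b LI cochain_basisD[OF LI(1)] by (auto simp: cochain_basis_deg_iff cochain_basis_def full_subcomplex_def)
qed

lemma cochain_d'_hom_deg: "cochain_d' \<in> hom (cochains_deg m K n) (cochains_deg m K (n - 1))"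
  using keys_cochain_d'_deg by (intro homI) (auto simp: cochains_deg_eq cochain_d'_add)

text \<open>A basis element with \<open>L = [m]\<close> has \<open>I = [m]\<close> and total degree \<open>2m\<close>.  In the other degrees the
  homotopy identity is therefore available for every simplicial complex.\<close>

lemma cochain_d'_image_deg:
  assumes "n \<noteq> 2 * int m"
  shows "cochain_d' ` carrier (cochains_deg m K (n + 1)) = kernel (cochains_deg m K n) (cochains_deg m K (n - 1)) cochain_d'"
proof
  show "cochain_d' ` carrier (cochains_deg m K (n + 1)) \<subseteq> kernel (cochains_deg m K n) (cochains_deg m K (n - 1)) cochain_d'"
  proof clarify
    fix x assume "x \<in> carrier (cochains_deg m K (n + 1))"
    then have x: "Poly_Mapping.keys x \<subseteq> cochain_basis_deg m K (n + 1)" by (simp add: cochains_deg_eq)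
    have "cochain_d' (cochain_d' x) = 0"
      using x cochain_basisD(4) cochain_basis_deg_iff by (intro cochain_d'_d') blast
    then show "cochain_d' x \<in> kernel (cochains_deg m K n) (cochains_deg m K (n - 1)) cochain_d'"
      using keys_cochain_d'_deg[OF x] by (simp add: kernel_def cochains_deg_eq)
  qed
  show "kernel (cochains_deg m K n) (cochains_deg m K (n - 1)) cochain_d' \<subseteq> cochain_d' ` carrier (cochains_deg m K (n + 1))"
  proof
    fix x assume "x \<in> kernel (cochains_deg m K n) (cochains_deg m K (n - 1)) cochain_d'"
    then have x: "Poly_Mapping.keys x \<subseteq> cochain_basis_deg m K n" "cochain_d' x = 0"
      by (simp_all add: kernel_def cochains_deg_eq)
    have LI: "(L, I) \<in> cochain_basis m K \<and> int (card L) + int (card I) = n \<and> L \<noteq> {1..m}"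
      if "(L, I) \<in> Poly_Mapping.keys x" for L I
    proof -
      have b: "(L, I) \<in> cochain_basis m K" "int (card L) + int (card I) = n"
        using that x cochain_basis_deg_iff by blast+
      have "I = {1..m}" if "L = {1..m}" using cochain_basisD[OF b(1)] that by auto
      then show ?thesis using b assms by auto
    qed
    have "cochain_d' (cochain_h m x) + cochain_h m (cochain_d' x) = x"
      using LI cochain_basisD by (intro cochain_homotopy) blast
    then have eq: "x = cochain_d' (cochain_h m x)" by (simp add: x(2) cochain_h_zero)
    have "Poly_Mapping.keys (cochain_h m x) \<subseteq> cochain_basis_deg m K (n + 1)"
    proof
      fix b assume "b \<in> Poly_Mapping.keys (cochain_h m x)"
      then obtain L I where b: "b = (L, insert (Min ({1..m} - L)) I)" "(L, I) \<in> Poly_Mapping.keys x" "Min ({1..m} - L) \<notin> I"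
        using keys_cochain_h[of m x] by auto
      note LI' = LI[OF b(2), THEN conjunct1] LI[OF b(2), THEN conjunct2]
      have "Min ({1..m} - L) \<in> {1..m}" using cochain_basisD[OF LI'(1)] LI'(2) by (intro Min_missing_vertex) auto
      then show "b \<in> cochain_basis_deg m K (n + 1)"
        using b LI' cochain_basisD[OF LI'(1)] by (auto simp: cochain_basis_deg_iff cochain_basis_def full_subcomplex_def)
    qed
    then have "cochain_h m x \<in> carrier (cochains_deg m K (n + 1))" by (simp add: cochains_deg_eq)
    then show "x \<in> cochain_d' ` carrier (cochains_deg m K (n + 1))" using eq by (rule image_eqI[rotated])
  qed
qed

text \<open>The total degree of \<open>\<alpha>\<^sub>L\<^sub>,\<^sub>I\<close> is the sum of the cardinalities of \<open>L\<close> and \<open>I\<close>, so it is at most \<open>2m\<close>,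
  with equality only for \<open>L = I = [m]\<close>.\<close>

lemma cochain_basis_deg_top:
  assumes "K = full_simplex m"
  shows "cochain_basis_deg m K (2 * int m) = {({1..m}, {1..m})}" "cochain_basis_deg m K (2 * int m + 1) = {}"
proof -
  have le: "card L \<le> m \<and> card I \<le> m \<and> (card L = m \<longrightarrow> L = {1..m}) \<and> (card I = m \<longrightarrow> I = {1..m})"
    if "(L, I) \<in> cochain_basis m K" for L I
    using card_mono[OF _ cochain_basisD(2)[OF that]] card_mono[OF _ cochain_basisD(6)[OF that]]
      card_subset_eq[OF _ cochain_basisD(2)[OF that]] card_subset_eq[OF _ cochain_basisD(6)[OF that]] by simp
  have "(L, I) \<in> cochain_basis_deg m K (2 * int m) \<longleftrightarrow> (L, I) = ({1..m}, {1..m})" for L I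
  proof
    assume "(L, I) \<in> cochain_basis_deg m K (2 * int m)"
    then have "(L, I) \<in> cochain_basis m K" "card L + card I = 2 * m" by (auto simp: cochain_basis_deg_iff)
    moreover from this have "card L = m" "card I = m" using le[of L I] by auto
    ultimately show "(L, I) = ({1..m}, {1..m})" using le[of L I] by simp
  next
    assume "(L, I) = ({1..m}, {1..m})"
    then show "(L, I) \<in> cochain_basis_deg m K (2 * int m)"
      by (simp add: cochain_basis_deg_iff cochain_basis_def full_subcomplex_def assms full_simplex_def)
  qed
  then show "cochain_basis_deg m K (2 * int m) = {({1..m}, {1..m})}" by (auto simp del: One_nat_def)
  have "(L, I) \<notin> cochain_basis_deg m K (2 * int m + 1)" for L I
    using le[of L I] by (auto simp: cochain_basis_deg_iff)
  then show "cochain_basis_deg m K (2 * int m + 1) = {}" by auto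
qed

lemma free_Abelian_group_singleton_generate:
  assumes c: "c * c = (1::int)"
  shows "carrier (free_Abelian_group {b}) = generate (free_Abelian_group {b}) {frag_cmul c (frag_of b)}"
proof -
  let ?F = "free_Abelian_group {b}"
  interpret F: group ?F by (rule group_free_Abelian_group)
  have a: "frag_cmul c (frag_of b) \<in> carrier ?F" using keys_cmul[of c "frag_of b"] by simp
  have pow: "frag_cmul c (frag_of b) [^]\<^bsub>?F\<^esub> k = frag_cmul (k * c) (frag_of b)" for k :: int
    using a by simp
  have "x = frag_cmul (Poly_Mapping.lookup x b * c * c) (frag_of b)" if "x \<in> carrier ?F" for x
  proof (rule poly_mapping_eqI)
    fix k
    have "k = b \<or> Poly_Mapping.lookup x k = 0" using that by (auto simp: in_keys_iff subset_iff)
    then show "Poly_Mapping.lookup x k = Poly_Mapping.lookup (frag_cmul (Poly_Mapping.lookup x b * c * c) (frag_of b)) k"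
      using c by (auto simp: mult.assoc)
  qed
  then have "carrier ?F \<subseteq> generate ?F {frag_cmul c (frag_of b)}"
    unfolding F.generate_pow[OF a] pow by blast
  then show ?thesis using F.generate_incl[of "{frag_cmul c (frag_of b)}"] a by blast
qed

lemma cochain_d'_kernel_top:
  assumes "K = full_simplex m"
  shows "kernel (cochains_deg m K (2 * int m)) (cochains_deg m K n) cochain_d' = carrier (cochains_deg m K (2 * int m))"
proof -
  have "cochain_d' x = 0" if "Poly_Mapping.keys x \<subseteq> {({1..m}, {1..m})}" for x
    using that
  proof (induction x rule: free_Abelian_induct)
    case (gen b)
    then have "b = ({1..m}, {1..m})" by blast
    then show ?case by (simp only: cochain_d'_of Diff_cancel sum.empty)
  qed (simp_all only: cochain_d'_simps diff_self)
  then have "cochain_d' x = \<one>\<^bsub>cochains_deg m K n\<^esub>" if "x \<in> carrier (cochains_deg m K (2 * int m))" for x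
    using that by (simp only: cochains_deg_eq cochain_basis_deg_top[OF assms] carrier_free_Abelian_group_iff one_free_Abelian_group)
  then show ?thesis by (auto simp only: kernel_def)
qed

lemma cochains_top_cohomology:
  assumes K: "K = full_simplex m"
  defines "H \<equiv> cochains_cohomology_deg m K (2 * int m)"
    and "c \<equiv> cochain_d' ` carrier (cochains_deg m K (2 * int m + 1))
      #>\<^bsub>cochains_deg m K (2 * int m)\<^esub> cochain_\<alpha> {1..m} {1..m}"
  shows "H \<cong> integer_group \<and> c \<in> carrier H \<and> carrier H = generate H {c}"
  unfolding H_def c_def cochains_cohomology_deg_def
proof (rule cohomology_at_infinite_cyclic)
  let ?b = "({1..m}, {1..m})"
  have B: "cochains_deg m K (2 * int m) = free_Abelian_group {?b}"
    by (simp only: cochains_deg_eq cochain_basis_deg_top[OF K])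
  have A: "cochains_deg m K (2 * int m + 1) = free_Abelian_group {}"
    by (simp only: cochains_deg_eq cochain_basis_deg_top[OF K])
  show "group (cochains_deg m K (2 * int m))" "group (cochains_deg m K (2 * int m - 1))"
    by (simp_all add: cochains_deg_eq)
  show "cochain_d' \<in> hom (cochains_deg m K (2 * int m)) (cochains_deg m K (2 * int m - 1))"
    by (rule cochain_d'_hom_deg)
  have "carrier (free_Abelian_group ({} :: (nat set \<times> nat set) set)) = {0}" by auto
  then show "cochain_d' ` carrier (cochains_deg m K (2 * int m + 1)) = {\<one>\<^bsub>cochains_deg m K (2 * int m)\<^esub>}"
    by (simp add: A B cochain_d'_zero)
  show "kernel (cochains_deg m K (2 * int m)) (cochains_deg m K (2 * int m - 1)) cochain_d' =
      carrier (cochains_deg m K (2 * int m))"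
    by (rule cochain_d'_kernel_top[OF K])
  show "cochain_\<alpha> {1..m} {1..m} \<in> carrier (cochains_deg m K (2 * int m))"
    by (simp add: B cochain_\<alpha>_def)
  show "carrier (cochains_deg m K (2 * int m)) = generate (cochains_deg m K (2 * int m)) {cochain_\<alpha> {1..m} {1..m}}"
    using free_Abelian_group_singleton_generate[of 1 ?b] by (simp add: B cochain_\<alpha>_def)
  show "n = 0" if "cochain_\<alpha> {1..m} {1..m} [^]\<^bsub>cochains_deg m K (2 * int m)\<^esub> n = \<one>\<^bsub>cochains_deg m K (2 * int m)\<^esub>" for n :: int
    using that by (simp add: B cochain_\<alpha>_def)
qed

section \<open>Derivations of exterior algebras\<close>

context cring
begin

abbreviation "ext m \<equiv> exterior_algebra m R"

lemma ext_tensor_closed [simp]: "s \<in> carrier R \<Longrightarrow> ext_tensor m R J s \<in> carrier (ext m)"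
  by (auto simp: exterior_algebra_simps ext_tensor_def)

lemma ext_closed_apply: "x \<in> carrier (ext m) \<Longrightarrow> A \<subseteq> {1..m} \<Longrightarrow> x A \<in> carrier R"
  by (auto simp: exterior_algebra_simps)

lemma ext_eqI:
  assumes "x \<in> carrier (ext m)" "y \<in> carrier (ext m)" "\<And>A. A \<subseteq> {1..m} \<Longrightarrow> x A = y A"
  shows "x = y"
proof -
  have "x \<in> extensional (Pow {1..m})" "y \<in> extensional (Pow {1..m})"
    using assms(1,2) by (auto simp only: exterior_algebra_simps(1) PiE_iff)
  then show ?thesis using assms(3) by (rule extensionalityI) simp
qed

lemma ext_tensor_apply: "A \<subseteq> {1..m} \<Longrightarrow> ext_tensor m R J s A = (if A = J then s else \<zero>)"
  by (simp add: ext_tensor_def)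

lemma ext_mult_closed [simp]:
  "x \<in> carrier (ext m) \<Longrightarrow> y \<in> carrier (ext m) \<Longrightarrow> x \<otimes>\<^bsub>ext m\<^esub> y \<in> carrier (ext m)"
  by (auto simp: exterior_algebra_simps simp del: atLeastAtMost_iff One_nat_def intro!: ext_prod_closed[of m])

lemma ext_zero: "\<zero>\<^bsub>ext m\<^esub> = ext_tensor m R J \<zero>"
  by (auto simp: exterior_algebra_simps ext_tensor_def)

lemma ext_tensor_homogeneous:
  "s \<in> carrier R \<Longrightarrow> ext_tensor m R J s \<in> ext_homogeneous m R (card J)"
  by (auto simp: ext_homogeneous_def ext_tensor_apply simp del: One_nat_def atLeastAtMost_iff)

lemma ext_tensor_mult_apply:
  assumes s: "s \<in> carrier R" and y: "y \<in> carrier (ext m)" and J: "J \<subseteq> {1..m}"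
  shows "(ext_tensor m R B s \<otimes>\<^bsub>ext m\<^esub> y) J =
    (if B \<subseteq> J then [shuffle_sign B (J - B)] \<cdot> (s \<otimes> y (J - B)) else \<zero>)"
proof -
  have fJ: "finite J" using J finite_subset by blast
  have c: "[shuffle_sign A (J - A)] \<cdot> (s \<otimes> y (J - A)) \<in> carrier R" for A
    using s ext_closed_apply[OF y, of "J - A"] J by auto
  have "(ext_tensor m R B s \<otimes>\<^bsub>ext m\<^esub> y) J =
    (\<Oplus>A\<in>Pow J. [shuffle_sign A (J - A)] \<cdot> (ext_tensor m R B s A \<otimes> y (J - A)))"
    using J by (simp add: exterior_algebra_simps ext_prod_def)
  also have "\<dots> = (\<Oplus>A\<in>Pow J. if B = A then [shuffle_sign A (J - A)] \<cdot> (s \<otimes> y (J - A)) else \<zero>)"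
  proof (intro finsum_cong' refl)
    fix A assume "A \<in> Pow J"
    then have "A \<subseteq> {1..m}" "J - A \<subseteq> {1..m}" using J by auto
    then show "[shuffle_sign A (J - A)] \<cdot> (ext_tensor m R B s A \<otimes> y (J - A)) =
        (if B = A then [shuffle_sign A (J - A)] \<cdot> (s \<otimes> y (J - A)) else \<zero>)"
      using ext_closed_apply[OF y, of "J - A"] by (simp add: ext_tensor_apply)
  qed (use c in auto)
  also have "\<dots> = (if B \<subseteq> J then [shuffle_sign B (J - B)] \<cdot> (s \<otimes> y (J - B)) else \<zero>)"
  proof (cases "B \<subseteq> J")
    case True
    then show ?thesis using fJ c by (subst add.finprod_singleton) auto
  next
    case False
    then show ?thesis by (subst add.finprod_one_eqI) auto
  qed
  finally show ?thesis .
qed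

lemma ext_mult_scalar_apply:
  assumes s: "s \<in> carrier R" and y: "y \<in> carrier (ext m)" and J: "J \<subseteq> {1..m}"
  shows "(y \<otimes>\<^bsub>ext m\<^esub> ext_tensor m R {} s) J = y J \<otimes> s"
proof -
  have fJ: "finite J" using J finite_subset by blast
  have c: "A \<subseteq> J \<Longrightarrow> y A \<in> carrier R" for A
    using ext_closed_apply[OF y, of A] J by auto
  have "(y \<otimes>\<^bsub>ext m\<^esub> ext_tensor m R {} s) J =
    (\<Oplus>A\<in>Pow J. [shuffle_sign A (J - A)] \<cdot> (y A \<otimes> ext_tensor m R {} s (J - A)))"
    using J by (simp add: exterior_algebra_simps ext_prod_def)
  also have "\<dots> = (\<Oplus>A\<in>Pow J. if J = A then y A \<otimes> s else \<zero>)"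
  proof (intro finsum_cong' refl)
    fix A assume "A \<in> Pow J"
    then have A: "A \<subseteq> J" by simp
    show "[shuffle_sign A (J - A)] \<cdot> (y A \<otimes> ext_tensor m R {} s (J - A)) = (if J = A then y A \<otimes> s else \<zero>)"
    proof (cases "A = J")
      case True
      then show ?thesis using c s by (simp add: ext_tensor_def shuffle_sign_def)
    next
      case False
      then have "J - A \<noteq> {}" "J - A \<subseteq> {1..m}" using A J by auto
      then have "ext_tensor m R {} s (J - A) = \<zero>" by (simp add: ext_tensor_apply)
      then show ?thesis using False c[OF A] by simp
    qed
  qed (use c s in auto)
  also have "\<dots> = y J \<otimes> s"
    using fJ c s by (subst add.finprod_singleton) auto
  finally show ?thesis .
qed

lemma ext_zero_mult: "y \<in> carrier (ext m) \<Longrightarrow> \<zero>\<^bsub>ext m\<^esub> \<otimes>\<^bsub>ext m\<^esub> y = \<zero>\<^bsub>ext m\<^esub>"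
  unfolding ext_zero[of m "{}"]
  by (rule ext_eqI[of _ m])
    (auto simp: ext_tensor_mult_apply ext_closed_apply ext_tensor_apply simp del: One_nat_def atLeastAtMost_iff)

lemma ext_tensor_mult_zero:
  assumes s: "s \<in> carrier R"
  shows "ext_tensor m R J s \<otimes>\<^bsub>ext m\<^esub> \<zero>\<^bsub>ext m\<^esub> = \<zero>\<^bsub>ext m\<^esub>"
  unfolding ext_zero[of m "{}"]
proof (rule ext_eqI[of _ m])
  fix A assume A: "A \<subseteq> {1..m}"
  have "A - J \<subseteq> {1..m}" using A by blast
  then show "(ext_tensor m R J s \<otimes>\<^bsub>ext m\<^esub> ext_tensor m R {} \<zero>) A = ext_tensor m R {} \<zero> A"
    using s A by (simp add: ext_tensor_mult_apply ext_tensor_apply)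
qed (use s in simp_all)

lemma ext_one_mult: "y \<in> carrier (ext m) \<Longrightarrow> \<one>\<^bsub>ext m\<^esub> \<otimes>\<^bsub>ext m\<^esub> y = y"
  unfolding exterior_algebra_simps(3)
  by (rule ext_eqI)
    (auto simp: ext_tensor_mult_apply ext_closed_apply shuffle_sign_def simp del: One_nat_def atLeastAtMost_iff)

lemma ext_mult_one: "y \<in> carrier (ext m) \<Longrightarrow> y \<otimes>\<^bsub>ext m\<^esub> \<one>\<^bsub>ext m\<^esub> = y"
  unfolding exterior_algebra_simps(3)
  by (rule ext_eqI)
    (auto simp: ext_mult_scalar_apply ext_closed_apply simp del: One_nat_def atLeastAtMost_iff)

lemma ext_scalar_mult:
  assumes "s \<in> carrier R" "t \<in> carrier R"
  shows "ext_tensor m R {} s \<otimes>\<^bsub>ext m\<^esub> ext_tensor m R {} t = ext_tensor m R {} (s \<otimes> t)"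
  using assms by (intro ext_eqI[of _ m])
    (auto simp: ext_mult_scalar_apply ext_tensor_apply simp del: One_nat_def atLeastAtMost_iff)

lemma ext_add_apply: "A \<subseteq> {1..m} \<Longrightarrow> (x \<oplus>\<^bsub>ext m\<^esub> y) A = x A \<oplus> y A"
  by (simp add: exterior_algebra_simps(5))

lemma ext_add_closed [simp]:
  "x \<in> carrier (ext m) \<Longrightarrow> y \<in> carrier (ext m) \<Longrightarrow> x \<oplus>\<^bsub>ext m\<^esub> y \<in> carrier (ext m)"
  using exterior_algebra_abelian_group[of m] by (simp add: abelian_groupE(1))

lemma ext_scalar_add:
  assumes "s \<in> carrier R" "t \<in> carrier R"
  shows "ext_tensor m R {} s \<oplus>\<^bsub>ext m\<^esub> ext_tensor m R {} t = ext_tensor m R {} (s \<oplus> t)"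
  using assms by (intro ext_eqI[of _ m]) (auto simp: ext_add_apply ext_tensor_apply simp del: One_nat_def atLeastAtMost_iff)

text \<open>No sign appears because \<open>u\<^sub>k\<close> already precedes all factors of \<open>u\<^sub>J\<close>.\<close>

lemma ext_generator_mult:
  assumes "s \<in> carrier R" "insert k J \<subseteq> {1..m}" "\<And>j. j \<in> J \<Longrightarrow> k < j"
  shows "ext_tensor m R {k} \<one> \<otimes>\<^bsub>ext m\<^esub> ext_tensor m R J s = ext_tensor m R (insert k J) s"
proof (rule ext_eqI)
  fix A assume A: "A \<subseteq> {1..m}"
  have k: "k \<notin> J" using assms(3) by blast
  show "(ext_tensor m R {k} \<one> \<otimes>\<^bsub>ext m\<^esub> ext_tensor m R J s) A = ext_tensor m R (insert k J) s A"
  proof (cases "A = insert k J")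
    case True
    have "shuffle_sign {k} (insert k J - {k}) = 1"
    proof -
      have no: "{(a, b). a \<in> {k} \<and> b \<in> insert k J - {k} \<and> b < a} = {}"
        using assms(3) by fastforce
      show ?thesis by (simp only: shuffle_sign_def no card.empty power_0)
    qed
    then show ?thesis using True assms(1,2) A k by (simp add: ext_tensor_mult_apply ext_tensor_apply)
  next
    case False
    then have "A - {k} \<noteq> J" if "k \<in> A" using that by blast
    moreover have "A - {k} \<subseteq> {1..m}" using A by blast
    ultimately show ?thesis using False assms(1) A
      by (simp add: ext_tensor_mult_apply ext_tensor_apply)
  qed
qed (use assms in simp_all)

text \<open>The exterior algebra is generated by the scalars and the \<open>u\<^sub>k\<close>: every \<open>u\<^sub>J \<otimes> s\<close> is obtained from
  \<open>s\<close> by multiplication with the \<open>u\<^sub>k\<close>, in decreasing order of \<open>k \<in> J\<close>.\<close>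

lemma exterior_algebra_induct [consumes 1, case_names add scalar generator]:
  assumes x: "x \<in> carrier (ext m)"
    and add: "\<And>x y. x \<in> carrier (ext m) \<Longrightarrow> y \<in> carrier (ext m) \<Longrightarrow> P x \<Longrightarrow> P y \<Longrightarrow> P (x \<oplus>\<^bsub>ext m\<^esub> y)"
    and scalar: "\<And>s. s \<in> carrier R \<Longrightarrow> P (ext_tensor m R {} s)"
    and gen: "\<And>k x. k \<in> {1..m} \<Longrightarrow> x \<in> carrier (ext m) \<Longrightarrow> P x \<Longrightarrow> P (ext_tensor m R {k} \<one> \<otimes>\<^bsub>ext m\<^esub> x)"
  shows "P x"
proof -
  have tensor: "P (ext_tensor m R J s)" if s: "s \<in> carrier R" and J: "J \<subseteq> {1..m}" for J s
  proof -
    have "finite J" using J finite_subset by blast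
    then show ?thesis using J
    proof (induction "card J" arbitrary: J)
      case 0
      then show ?case using scalar[OF s] by simp
    next
      case (Suc n)
      then have ne: "J \<noteq> {}" by auto
      \<comment> \<open>Splitting off the least index on the left produces no sign.\<close>
      define k L where "k = Min J" and "L = J - {k}"
      have k: "k \<in> J" using Min_in[of J] ne Suc by (simp add: k_def)
      have J: "J = insert k L" "finite L" "n = card L" "L \<subseteq> {1..m}" "k \<in> {1..m}"
        using k Suc by (auto simp: L_def)
      have less: "k < j" if "j \<in> L" for j
        using that Suc.prems(1) Min_le[of J j] by (simp add: L_def k_def le_neq_trans)
      have "ext_tensor m R {k} \<one> \<otimes>\<^bsub>ext m\<^esub> ext_tensor m R L s = ext_tensor m R J s"
        using ext_generator_mult[OF s _ less, of L m] J by simp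
      then show ?case using gen[OF J(5) _ Suc.hyps(1)[OF J(3,2,4)]] s by simp
    qed
  qed
  have "P x" if "finite F" "F \<subseteq> Pow {1..m}" "x \<in> carrier (ext m)"
    "\<And>J. J \<in> Pow {1..m} - F \<Longrightarrow> x J = \<zero>" for F x
    using that
  proof (induction F arbitrary: x rule: finite_induct)
    case empty
    have "x = ext_tensor m R {} \<zero>"
      using empty by (intro ext_eqI[of _ m]) (auto simp: ext_tensor_apply simp del: One_nat_def atLeastAtMost_iff)
    then show ?case using scalar[of \<zero>] by simp
  next
    case (insert J F)
    have J: "J \<subseteq> {1..m}" using insert.prems by simp
    \<comment> \<open>The element without its component at \<open>J\<close>.\<close>
    define y where "y = (\<lambda>A\<in>Pow {1..m}. if A = J then \<zero> else x A)"
    have yA: "y A = (if A = J then \<zero> else x A)" if "A \<subseteq> {1..m}" for A using that by (simp add: y_def)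
    have y: "y \<in> carrier (ext m)"
      unfolding y_def exterior_algebra_simps(1)
      using ext_closed_apply[OF insert.prems(2)] by (intro restrict_PiE_iff[THEN iffD2]) auto
    have xJ: "x J \<in> carrier R" using ext_closed_apply[OF insert.prems(2) J] .
    have "P y" using insert.prems y by (intro insert.IH) (auto simp: yA simp del: One_nat_def atLeastAtMost_iff)
    moreover have "x = ext_tensor m R J (x J) \<oplus>\<^bsub>ext m\<^esub> y"
      using insert.prems(2) xJ y ext_closed_apply[OF insert.prems(2)]
      by (intro ext_eqI[of _ m]) (simp_all add: ext_add_apply ext_tensor_apply yA del: One_nat_def)
    ultimately show ?case using add[OF _ y tensor[OF xJ J]] xJ by simp
  qed
  from this[of "Pow {1..m}"] x show ?thesis by simp
qed

lemma graded_derivation_closed: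
  "graded_derivation m R D \<Longrightarrow> x \<in> carrier (ext m) \<Longrightarrow> D x \<in> carrier (ext m)"
  by (auto simp: graded_derivation_def hom_def)

lemma graded_derivation_add:
  "graded_derivation m R D \<Longrightarrow> x \<in> carrier (ext m) \<Longrightarrow> y \<in> carrier (ext m) \<Longrightarrow>
    D (x \<oplus>\<^bsub>ext m\<^esub> y) = D x \<oplus>\<^bsub>ext m\<^esub> D y"
  by (auto simp: graded_derivation_def hom_def)

lemma graded_derivation_tensor_mult:
  assumes "graded_derivation m R D" "s \<in> carrier R" "y \<in> carrier (ext m)"
  shows "D (ext_tensor m R J s \<otimes>\<^bsub>ext m\<^esub> y) =
    D (ext_tensor m R J s) \<otimes>\<^bsub>ext m\<^esub> y \<oplus>\<^bsub>ext m\<^esub>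
      [((- 1) ^ card J :: int)] \<cdot>\<^bsub>ext m\<^esub> (ext_tensor m R J s \<otimes>\<^bsub>ext m\<^esub> D y)"
  using assms ext_tensor_homogeneous[OF assms(2)] unfolding graded_derivation_def by blast

lemma graded_derivation_unique:
  assumes "graded_derivation m R D" "graded_derivation m R D'"
    and "\<And>s. s \<in> carrier R \<Longrightarrow> D (ext_tensor m R {} s) = D' (ext_tensor m R {} s)"
    and "\<And>k. k \<in> {1..m} \<Longrightarrow> D (ext_tensor m R {k} \<one>) = D' (ext_tensor m R {k} \<one>)"
    and "x \<in> carrier (ext m)"
  shows "D x = D' x"
  using assms(5)
proof (induction rule: exterior_algebra_induct)
  case (add x y)
  then show ?case
    by (simp only: graded_derivation_add[OF assms(1)] graded_derivation_add[OF assms(2)])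
next
  case (scalar s)
  then show ?case by (rule assms(3))
next
  case (generator k x)
  then show ?case
    by (simp only: graded_derivation_tensor_mult[OF assms(1)] graded_derivation_tensor_mult[OF assms(2)] assms(4) one_closed)
qed

lemma graded_derivation_scalar_mult:
  assumes D: "graded_derivation m R D" and s: "s \<in> carrier R" and t: "t \<in> carrier R"
    and "D (ext_tensor m R {} s) = \<zero>\<^bsub>ext m\<^esub>" "D (ext_tensor m R {} t) = \<zero>\<^bsub>ext m\<^esub>"
  shows "D (ext_tensor m R {} (s \<otimes> t)) = \<zero>\<^bsub>ext m\<^esub>"
proof -
  interpret E: abelian_group "ext m" by (rule exterior_algebra_abelian_group)
  show ?thesis
    using graded_derivation_tensor_mult[OF D s, of "ext_tensor m R {} t" "{}"] assms
    by (simp add: ext_scalar_mult ext_zero_mult ext_tensor_mult_zero E.add.int_pow_one)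
qed

lemma graded_derivation_one:
  assumes D: "graded_derivation m R D"
  shows "D (ext_tensor m R {} \<one>) = \<zero>\<^bsub>ext m\<^esub>"
proof -
  interpret E: abelian_group "ext m" by (rule exterior_algebra_abelian_group)
  let ?u = "ext_tensor m R {} \<one>"
  have c: "D ?u \<in> carrier (ext m)" using graded_derivation_closed[OF D] by simp
  have "D ?u = D ?u \<oplus>\<^bsub>ext m\<^esub> D ?u"
    using graded_derivation_tensor_mult[OF D, of \<one> ?u "{}"] c
    by (simp add: ext_scalar_mult ext_one_mult[unfolded exterior_algebra_simps(3)]
       ext_mult_one[unfolded exterior_algebra_simps(3)] E.add.int_pow_1)
  then show ?thesis using c by (metis E.add.l_cancel_one)
qed

text \<open>The composite \<open>DD\<close> vanishes on scalars and commutes with multiplication by each \<open>u\<^sub>k\<close>: the two terms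
  \<open>D x\<close> arising from \<open>D(u\<^sub>k x) = x - u\<^sub>k D x\<close> cancel.\<close>

lemma graded_derivation_square_zero:
  assumes D: "graded_derivation m R D"
    and scalar: "\<And>s. s \<in> carrier R \<Longrightarrow> D (ext_tensor m R {} s) = \<zero>\<^bsub>ext m\<^esub>"
    and gen: "\<And>k. k \<in> {1..m} \<Longrightarrow> D (ext_tensor m R {k} \<one>) = \<one>\<^bsub>ext m\<^esub>"
    and x: "x \<in> carrier (ext m)"
  shows "D (D x) = \<zero>\<^bsub>ext m\<^esub>"
  using x
proof (induction rule: exterior_algebra_induct)
  interpret E: abelian_group "ext m" by (rule exterior_algebra_abelian_group)
  interpret D: group_hom "add_monoid (ext m)" "add_monoid (ext m)" D
    using D by unfold_locales (simp add: graded_derivation_def)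
  note closed = graded_derivation_closed[OF D]
  {
    case (add x y)
    then show ?case by (simp add: graded_derivation_add[OF D] closed)
  next
    case (scalar s)
    then show ?case using D.hom_one assms(2) by simp
  next
    case (generator k x)
    let ?u = "ext_tensor m R {k} \<one>"
    have Du: "D (?u \<otimes>\<^bsub>ext m\<^esub> y) = y \<oplus>\<^bsub>ext m\<^esub> [(- 1 :: int)] \<cdot>\<^bsub>ext m\<^esub> (?u \<otimes>\<^bsub>ext m\<^esub> D y)"
      if "y \<in> carrier (ext m)" for y
      using that by (simp add: graded_derivation_tensor_mult[OF D] gen[OF generator(1)] ext_one_mult)
    have Dx: "D (?u \<otimes>\<^bsub>ext m\<^esub> D x) = D x"
      using generator closed by (simp add: Du ext_tensor_mult_zero E.add.int_pow_one)
    have "D (D (?u \<otimes>\<^bsub>ext m\<^esub> x)) = D x \<oplus>\<^bsub>ext m\<^esub> D ([(- 1 :: int)] \<cdot>\<^bsub>ext m\<^esub> (?u \<otimes>\<^bsub>ext m\<^esub> D x))"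
      using generator closed by (simp add: Du graded_derivation_add[OF D])
    also have "D ([(- 1 :: int)] \<cdot>\<^bsub>ext m\<^esub> (?u \<otimes>\<^bsub>ext m\<^esub> D x)) = [(- 1 :: int)] \<cdot>\<^bsub>ext m\<^esub> D x"
      using D.hom_int_pow[of "?u \<otimes>\<^bsub>ext m\<^esub> D x" "- 1"] generator closed by (simp add: Dx add_pow_def)
    also have "D x \<oplus>\<^bsub>ext m\<^esub> [(- 1 :: int)] \<cdot>\<^bsub>ext m\<^esub> D x = \<zero>\<^bsub>ext m\<^esub>"
      using E.add.int_pow_mult[of "D x" 1 "- 1"] E.add.int_pow_1[of "D x"]
        closed[OF generator(2)] by (simp add: add_pow_def int_pow_0)
    finally show ?case .
  }
qed

text \<open>Multiplication by a generator that \<open>D\<close> sends to one is a contracting homotopy.\<close>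

lemma graded_derivation_contraction:
  assumes D: "graded_derivation m R D"
    and gen: "D (ext_tensor m R {k} \<one>) = \<one>\<^bsub>ext m\<^esub>"
    and x: "x \<in> carrier (ext m)" "D x = \<zero>\<^bsub>ext m\<^esub>"
  shows "D (ext_tensor m R {k} \<one> \<otimes>\<^bsub>ext m\<^esub> x) = x"
proof -
  interpret E: abelian_group "ext m" by (rule exterior_algebra_abelian_group)
  show ?thesis
    using x by (simp add: graded_derivation_tensor_mult[OF D] gen ext_one_mult ext_tensor_mult_zero E.add.int_pow_one)
qed

lemma ext_finsum_apply:
  assumes "finite F" "\<And>k. k \<in> F \<Longrightarrow> f k \<in> carrier (ext m)" "A \<subseteq> {1..m}"
  shows "(\<Oplus>\<^bsub>ext m\<^esub>k\<in>F. f k) A = (\<Oplus>k\<in>F. f k A)"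
  using assms(1,2)
proof (induction F rule: finite_induct)
  interpret E: abelian_group "ext m" by (rule exterior_algebra_abelian_group)
  {
    case empty
    then show ?case using assms(3) by (simp add: exterior_algebra_simps(4))
  next
    case (insert k F)
    then have "(\<Oplus>\<^bsub>ext m\<^esub>k\<in>insert k F. f k) A = (f k \<oplus>\<^bsub>ext m\<^esub> (\<Oplus>\<^bsub>ext m\<^esub>k\<in>F. f k)) A"
      by (simp add: Pi_iff)
    also have "\<dots> = (\<Oplus>k\<in>insert k F. f k A)"
    proof -
      have "f j A \<in> carrier R" if "j \<in> insert k F" for j
        using insert.prems[OF that] assms(3) by (rule ext_closed_apply)
      then show ?thesis using insert assms(3)
        by (simp add: exterior_algebra_simps(5) Pi_iff del: One_nat_def atLeastAtMost_iff)
    qed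
    finally show ?case .
  }
qed

lemma ext_diff_tensor:
  assumes g: "\<And>k. k \<in> {1..m} \<Longrightarrow> g k \<in> carrier R" and J: "J \<subseteq> {1..m}" and s: "s \<in> carrier R"
  shows "ext_diff m R g (ext_tensor m R J s) =
    (\<Oplus>\<^bsub>ext m\<^esub>k\<in>J. [eps k J] \<cdot>\<^bsub>ext m\<^esub> ext_tensor m R (J - {k}) (g k \<otimes> s))"
proof (rule ext_eqI)
  interpret E: abelian_group "ext m" by (rule exterior_algebra_abelian_group)
  have fJ: "finite J" using J finite_subset by blast
  have gJ: "g k \<in> carrier R" if "k \<in> J" for k using g that J by auto
  have c: "[eps k J] \<cdot>\<^bsub>ext m\<^esub> ext_tensor m R (J - {k}) (g k \<otimes> s) \<in> carrier (ext m)" if "k \<in> J" for k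
    using gJ[OF that] s by (intro E.add.int_pow_closed) simp
  then show "(\<Oplus>\<^bsub>ext m\<^esub>k\<in>J. [eps k J] \<cdot>\<^bsub>ext m\<^esub> ext_tensor m R (J - {k}) (g k \<otimes> s)) \<in> carrier (ext m)"
    by (intro E.finsum_closed) auto
  fix A assume A: "A \<subseteq> {1..m}"
  let ?f = "\<lambda>k. [eps k J] \<cdot> (if A = J - {k} then g k \<otimes> s else \<zero>)"
  have eq: "g k \<otimes> contraction R k (ext_tensor m R J s) A = (if k \<in> J then ?f k else \<zero>)" if k: "k \<in> {1..m}" for k
  proof -
    have 1: "insert k A \<subseteq> {1..m}" using A k by auto
    show ?thesis
    proof (cases "k \<in> J \<and> A = J - {k}")
      case True
      have "{r \<in> J. r < k} = {r \<in> A. r < k}" using True by auto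
      then have "eps k A = eps k J" by (simp add: eps_def)
      moreover have "k \<notin> A" "insert k A = J" using True by auto
      ultimately show ?thesis
        using g[OF k] s True ext_tensor_apply[OF 1, of J s] by (simp add: contraction_def add_pow_rdistr_int)
    next
      case False
      then have "k \<in> A \<or> insert k A \<noteq> J" by auto
      then have "contraction R k (ext_tensor m R J s) A = \<zero>"
        using ext_tensor_apply[OF 1, of J s] by (auto simp: contraction_def)
      moreover have "(if k \<in> J then ?f k else \<zero>) = \<zero>" using False by simp
      ultimately show ?thesis using g[OF k] by simp
    qed
  qed
  have "ext_diff m R g (ext_tensor m R J s) A = (\<Oplus>k\<in>{1..m}. g k \<otimes> contraction R k (ext_tensor m R J s) A)"
    using A by (simp add: ext_diff_def)
  also have "\<dots> = (\<Oplus>k\<in>J. ?f k)"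
  proof (rule add.finprod_mono_neutral_cong_right)
    show "finite {1..m}" "J \<subseteq> {1..m}" using J by simp_all
    show "g k \<otimes> contraction R k (ext_tensor m R J s) A = \<zero>" if "k \<in> {1..m} - J" for k
      using that eq by simp
    show "g k \<otimes> contraction R k (ext_tensor m R J s) A = ?f k" if "k \<in> J" for k
    proof -
      have "k \<in> {1..m}" using that J by blast
      from eq[OF this] that show ?thesis by (simp only: if_True)
    qed
    have "contraction R k (ext_tensor m R J s) A \<in> carrier R" if "k \<in> {1..m}" for k
      using that A s by (intro contraction_closed[of m]) (auto simp: ext_tensor_apply simp del: One_nat_def atLeastAtMost_iff)
    then show "(\<lambda>k. g k \<otimes> contraction R k (ext_tensor m R J s) A) \<in> {1..m} \<rightarrow> carrier R"
      using g by simp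
  qed
  also have "\<dots> = (\<Oplus>k\<in>J. ([eps k J] \<cdot>\<^bsub>ext m\<^esub> ext_tensor m R (J - {k}) (g k \<otimes> s)) A)"
  proof (intro finsum_cong' refl)
    show "(\<lambda>k. ([eps k J] \<cdot>\<^bsub>ext m\<^esub> ext_tensor m R (J - {k}) (g k \<otimes> s)) A) \<in> J \<rightarrow> carrier R"
      using c A by (auto intro!: ext_closed_apply[of _ m])
    fix k assume "k \<in> J"
    then show "?f k = ([eps k J] \<cdot>\<^bsub>ext m\<^esub> ext_tensor m R (J - {k}) (g k \<otimes> s)) A"
      unfolding eps_def using gJ s A by (subst exterior_algebra_smul) (simp_all add: ext_tensor_apply del: One_nat_def)
  qed
  also have "\<dots> = (\<Oplus>\<^bsub>ext m\<^esub>k\<in>J. [eps k J] \<cdot>\<^bsub>ext m\<^esub> ext_tensor m R (J - {k}) (g k \<otimes> s)) A"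
    by (rule ext_finsum_apply[symmetric]) (use fJ c A in auto)
  finally show "ext_diff m R g (ext_tensor m R J s) A =
    (\<Oplus>\<^bsub>ext m\<^esub>k\<in>J. [eps k J] \<cdot>\<^bsub>ext m\<^esub> ext_tensor m R (J - {k}) (g k \<otimes> s)) A" .
qed (use ext_diff_closed[OF g] s in auto)

end

section \<open>The Koszul differentials\<close>

lemma update_eq_add_single:
  fixes f :: "'a \<Rightarrow>\<^sub>0 'b::monoid_add"
  assumes "a \<notin> Poly_Mapping.keys f"
  shows "Poly_Mapping.update a b f = f + Poly_Mapping.single a b"
  using assms by (intro poly_mapping_eqI) (auto simp: lookup_update lookup_add lookup_single in_keys_iff when_def)

lemma poly_ring_simps [simp]:
  "x \<otimes>\<^bsub>poly_ring m\<^esub> y = x * y" "x \<oplus>\<^bsub>poly_ring m\<^esub> y = x + y"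
  "\<one>\<^bsub>poly_ring m\<^esub> = 1" "\<zero>\<^bsub>poly_ring m\<^esub> = 0"
  by (simp_all add: poly_ring_def)

text \<open>The polynomial ring is generated by its variables.  This allows a derivation to be controlled by its
  values on them.\<close>

lemma poly_ring_induct [consumes 1, case_names zero one add neg mult var]:
  assumes p: "p \<in> carrier (poly_ring m)"
    and zero: "P 0" and one: "P 1"
    and add: "\<And>p q. p \<in> carrier (poly_ring m) \<Longrightarrow> q \<in> carrier (poly_ring m) \<Longrightarrow> P p \<Longrightarrow> P q \<Longrightarrow> P (p + q)"
    and neg: "\<And>p. p \<in> carrier (poly_ring m) \<Longrightarrow> P p \<Longrightarrow> P (- p)"
    and mult: "\<And>p q. p \<in> carrier (poly_ring m) \<Longrightarrow> q \<in> carrier (poly_ring m) \<Longrightarrow> P p \<Longrightarrow> P q \<Longrightarrow> P (p * q)"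
    and var: "\<And>i. i \<in> {1..m} \<Longrightarrow> P (poly_var i)"
  shows "P p"
proof -
  let ?C = "carrier (poly_ring m)"
  interpret R: cring "poly_ring m" by (rule poly_ring_cring)
  have single_C: "Poly_Mapping.single t c \<in> ?C" if "Poly_Mapping.keys t \<subseteq> {1..m}" for t c
    using that by (auto simp: poly_ring_def)
  have pow: "P (Poly_Mapping.single (Poly_Mapping.single i n) 1)" if i: "i \<in> {1..m}" for i n
  proof (induction n)
    case 0
    then show ?case using one by simp
  next
    case (Suc n)
    have eq: "Poly_Mapping.single (Poly_Mapping.single i (Suc n)) 1 =
        poly_var i * Poly_Mapping.single (Poly_Mapping.single i n) (1::int)"
      by (simp add: poly_var_def mult_single flip: single_add)
    have "poly_var i \<in> ?C" "Poly_Mapping.single (Poly_Mapping.single i n) 1 \<in> ?C"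
      using i unfolding poly_var_def by (auto intro!: single_C split: if_splits)
    then show ?case unfolding eq using mult var[OF i] Suc by blast
  qed
  have mono: "P (Poly_Mapping.single t 1)" if "Poly_Mapping.keys t \<subseteq> {1..m}" for t
    using that
  proof (induction t rule: update_induct)
    case const
    then show ?case using one by simp
  next
    case (update f a b)
    then have f: "Poly_Mapping.keys f \<subseteq> {1..m}" and a: "a \<in> {1..m}" by (auto simp: keys_update)
    have eq: "Poly_Mapping.single (Poly_Mapping.update a b f) 1 =
      Poly_Mapping.single f 1 * Poly_Mapping.single (Poly_Mapping.single a b) (1::int)"
      using update(1) by (simp add: update_eq_add_single mult_single)
    have "Poly_Mapping.keys (Poly_Mapping.single a b) \<subseteq> {1..m}" using a by auto
    then show ?case unfolding eq by (intro mult single_C f update.IH pow a)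
  qed
  have single: "P (Poly_Mapping.single t c)" if t: "Poly_Mapping.keys t \<subseteq> {1..m}" for t c
  proof (induction c rule: int_induct[where k = 0])
    case base
    then show ?case using zero by simp
  next
    case (step1 c)
    then show ?case using add[OF single_C[OF t, of c] single_C[OF t, of 1]] mono[OF t] by (simp flip: single_add)
  next
    case (step2 c)
    have "- Poly_Mapping.single t 1 \<in> ?C" using single_C[OF t, of "- 1"] by (simp add: single_uminus)
    then have "P (Poly_Mapping.single t c + - Poly_Mapping.single t 1)"
      using add single_C[OF t, of c] neg[OF single_C[OF t, of 1] mono[OF t]] step2 by blast
    then show ?case by (simp add: single_diff)
  qed
  have "\<forall>t\<in>Poly_Mapping.keys p. Poly_Mapping.keys t \<subseteq> {1..m}" using p by (simp add: poly_ring_def)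
  then show ?thesis
  proof (induction p rule: update_induct)
    case const
    then show ?case using zero by simp
  next
    case (update f a b)
    then have f: "\<forall>t\<in>Poly_Mapping.keys f. Poly_Mapping.keys t \<subseteq> {1..m}" and a: "Poly_Mapping.keys a \<subseteq> {1..m}"
      by (auto simp: keys_update)
    show ?case unfolding update_eq_add_single[OF update(1)]
      using f by (intro add single_C a update.IH single) (simp_all add: poly_ring_def)
  qed
qed

abbreviation SR_class :: "nat \<Rightarrow> nat set set \<Rightarrow> poly_int \<Rightarrow> poly_int set"
  where "SR_class m K p \<equiv> SR_ideal m K +>\<^bsub>poly_ring m\<^esub> p"

lemma SR_class_ring_hom: "ring_hom_ring (poly_ring m) (SR_ring m K) (SR_class m K)"
  unfolding SR_ring_def by (rule ideal.rcos_ring_hom_ring[OF SR_ideal_ideal])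

lemma carrier_SR_ring: "carrier (SR_ring m K) = SR_class m K ` carrier (poly_ring m)"
  by (auto simp: SR_ring_def FactRing_def A_RCOSETS_def')

text \<open>A derivation kills integers automatically, and the scalars that it kills form a subring, which
  contains the generators \<open>v\<^sub>i\<close> of the Stanley--Reisner ring.\<close>

lemma graded_derivation_SR_scalar:
  assumes D: "graded_derivation m (SR_ring m K) D"
    and v: "\<And>i. i \<in> {1..m} \<Longrightarrow> D (koszul_v m K i) = \<zero>\<^bsub>koszul_algebra m K\<^esub>"
    and s: "s \<in> carrier (SR_ring m K)"
  shows "D (ext_tensor m (SR_ring m K) {} s) = \<zero>\<^bsub>koszul_algebra m K\<^esub>"
proof -
  interpret S: cring "SR_ring m K" by (rule SR_ring_cring)
  interpret E: abelian_group "koszul_algebra m K"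
    unfolding koszul_algebra_def by (rule S.exterior_algebra_abelian_group)
  interpret q: ring_hom_ring "poly_ring m" "SR_ring m K" "SR_class m K" by (rule SR_class_ring_hom)
  let ?t = "ext_tensor m (SR_ring m K) {}"
  obtain p where p: "p \<in> carrier (poly_ring m)" "s = SR_class m K p" using s by (auto simp: carrier_SR_ring)
  have D_add: "D (?t (a \<oplus>\<^bsub>SR_ring m K\<^esub> b)) = D (?t a) \<oplus>\<^bsub>koszul_algebra m K\<^esub> D (?t b)"
    if "a \<in> carrier (SR_ring m K)" "b \<in> carrier (SR_ring m K)" for a b
    using that S.graded_derivation_add[OF D, of "?t a" "?t b"] by (simp add: S.ext_scalar_add koszul_algebra_def)
  have closed: "D (?t a) \<in> carrier (koszul_algebra m K)" if "a \<in> carrier (SR_ring m K)" for a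
    unfolding koszul_algebra_def using that by (intro S.graded_derivation_closed[OF D]) simp
  have zero: "D (?t (SR_class m K 0)) = \<zero>\<^bsub>koszul_algebra m K\<^esub>"
  proof -
    have "D (?t \<zero>\<^bsub>SR_ring m K\<^esub>) = D (?t \<zero>\<^bsub>SR_ring m K\<^esub>) \<oplus>\<^bsub>koszul_algebra m K\<^esub> D (?t \<zero>\<^bsub>SR_ring m K\<^esub>)"
      using D_add[of "\<zero>\<^bsub>SR_ring m K\<^esub>" "\<zero>\<^bsub>SR_ring m K\<^esub>"] by simp
    then have "D (?t \<zero>\<^bsub>SR_ring m K\<^esub>) = \<zero>\<^bsub>koszul_algebra m K\<^esub>"
      using closed[of "\<zero>\<^bsub>SR_ring m K\<^esub>"] by (metis E.add.l_cancel_one S.zero_closed)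
    then show ?thesis using q.hom_zero by simp
  qed
  show ?thesis unfolding p(2) using p(1)
  proof (induction p rule: poly_ring_induct)
    case zero
    show ?case by fact
  next
    case one
    have "SR_class m K 1 = \<one>\<^bsub>SR_ring m K\<^esub>" using q.hom_one by simp
    then show ?case using S.graded_derivation_one[OF D] by (simp add: koszul_algebra_def)
  next
    case (add p q)
    then show ?case using q.hom_add[of p q] D_add[of "SR_class m K p" "SR_class m K q"] by simp
  next
    case (neg p)
    have np: "- p \<in> carrier (poly_ring m)" using neg(1) by (simp add: poly_ring_def)
    have "SR_class m K p \<oplus>\<^bsub>SR_ring m K\<^esub> SR_class m K (- p) = SR_class m K 0"
      using q.hom_add[OF neg(1) np] by simp
    then have "D (?t (SR_class m K p)) \<oplus>\<^bsub>koszul_algebra m K\<^esub> D (?t (SR_class m K (- p))) = \<zero>\<^bsub>koszul_algebra m K\<^esub>"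
      using D_add[OF q.hom_closed[OF neg(1)] q.hom_closed[OF np]] zero by simp
    then show ?case using neg(2) closed[OF q.hom_closed[OF np]] by simp
  next
    case (mult p q)
    then show ?case
      using S.graded_derivation_scalar_mult[OF D, of "SR_class m K p" "SR_class m K q"] q.hom_mult[of p q]
      by (simp add: koszul_algebra_def)
  next
    case (var i)
    then show ?case using v[OF var] by (simp add: koszul_v_def koszul_monomial_def SR_monomial_def)
  qed
qed

lemma koszul_d'_scalar:
  "is_koszul_d' m K d' \<Longrightarrow> s \<in> carrier (SR_ring m K) \<Longrightarrow>
    d' (ext_tensor m (SR_ring m K) {} s) = \<zero>\<^bsub>koszul_algebra m K\<^esub>"
  by (rule graded_derivation_SR_scalar) (auto simp: is_koszul_d'_def)

lemma koszul_d_scalar: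
  "is_koszul_d m K d \<Longrightarrow> s \<in> carrier (SR_ring m K) \<Longrightarrow>
    d (ext_tensor m (SR_ring m K) {} s) = \<zero>\<^bsub>koszul_algebra m K\<^esub>"
  by (rule graded_derivation_SR_scalar) (auto simp: is_koszul_d_def)

lemma koszul_u_eq: "koszul_u m K i = ext_tensor m (SR_ring m K) {i} \<one>\<^bsub>SR_ring m K\<^esub>"
  by (simp add: koszul_u_def koszul_monomial_def SR_monomial_empty)

text \<open>A derivation is determined by its values on the \<open>u\<^sub>k\<close> and on the scalars; in this way the axiomatic
  differential acquires an explicit formula.\<close>

lemma koszul_d'_eq:
  assumes "is_koszul_d' m K d'" "x \<in> carrier (koszul_algebra m K)"
  shows "d' x = ext_diff m (SR_ring m K) (\<lambda>_. \<one>\<^bsub>SR_ring m K\<^esub>) x"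
proof -
  interpret S: cring "SR_ring m K" by (rule SR_ring_cring)
  show ?thesis
  proof (rule S.graded_derivation_unique[of m d' "ext_diff m (SR_ring m K) (\<lambda>_. \<one>\<^bsub>SR_ring m K\<^esub>)"])
    show "graded_derivation m (SR_ring m K) d'" using assms(1) by (simp add: is_koszul_d'_def)
    show "graded_derivation m (SR_ring m K) (ext_diff m (SR_ring m K) (\<lambda>_. \<one>\<^bsub>SR_ring m K\<^esub>))"
      by (rule S.ext_diff_graded_derivation) simp
    show "x \<in> carrier (exterior_algebra m (SR_ring m K))" using assms(2) by (simp add: koszul_algebra_def)
    fix s assume "s \<in> carrier (SR_ring m K)"
    then show "d' (ext_tensor m (SR_ring m K) {} s) = ext_diff m (SR_ring m K) (\<lambda>_. \<one>\<^bsub>SR_ring m K\<^esub>) (ext_tensor m (SR_ring m K) {} s)"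
      using koszul_d'_scalar[OF assms(1)] by (simp add: S.ext_diff_scalar koszul_algebra_def)
  next
    fix k assume "k \<in> {1..m}"
    then show "d' (ext_tensor m (SR_ring m K) {k} \<one>\<^bsub>SR_ring m K\<^esub>) = ext_diff m (SR_ring m K) (\<lambda>_. \<one>\<^bsub>SR_ring m K\<^esub>) (ext_tensor m (SR_ring m K) {k} \<one>\<^bsub>SR_ring m K\<^esub>)"
      using assms(1) unfolding is_koszul_d'_def koszul_u_eq koszul_algebra_def
      by (simp add: S.ext_diff_generator exterior_algebra_simps(3) del: One_nat_def atLeastAtMost_iff)
  qed
qed

lemma koszul_d_eq:
  assumes "is_koszul_d m K d" "x \<in> carrier (koszul_algebra m K)"
  shows "d x = ext_diff m (SR_ring m K) (\<lambda>k. SR_monomial m K {k}) x"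
proof -
  interpret S: cring "SR_ring m K" by (rule SR_ring_cring)
  have g: "SR_monomial m K {k} \<in> carrier (SR_ring m K)" if "k \<in> {1..m}" for k
    using that by (intro SR_monomial_closed) auto
  show ?thesis
  proof (rule S.graded_derivation_unique[of m d "ext_diff m (SR_ring m K) (\<lambda>k. SR_monomial m K {k})"])
    show "graded_derivation m (SR_ring m K) d" using assms(1) by (simp add: is_koszul_d_def)
    show "graded_derivation m (SR_ring m K) (ext_diff m (SR_ring m K) (\<lambda>k. SR_monomial m K {k}))"
      by (rule S.ext_diff_graded_derivation) (rule g)
    show "x \<in> carrier (exterior_algebra m (SR_ring m K))" using assms(2) by (simp add: koszul_algebra_def)
    fix s assume "s \<in> carrier (SR_ring m K)"
    then show "d (ext_tensor m (SR_ring m K) {} s) = ext_diff m (SR_ring m K) (\<lambda>k. SR_monomial m K {k}) (ext_tensor m (SR_ring m K) {} s)"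
      using koszul_d_scalar[OF assms(1)] S.ext_diff_scalar[of m "\<lambda>k. SR_monomial m K {k}", OF g] by (simp add: koszul_algebra_def)
  next
    fix k assume "k \<in> {1..m}"
    then show "d (ext_tensor m (SR_ring m K) {k} \<one>\<^bsub>SR_ring m K\<^esub>) = ext_diff m (SR_ring m K) (\<lambda>k. SR_monomial m K {k}) (ext_tensor m (SR_ring m K) {k} \<one>\<^bsub>SR_ring m K\<^esub>)"
      using assms(1) S.ext_diff_generator[of m "\<lambda>k. SR_monomial m K {k}", OF g]
      unfolding is_koszul_d_def koszul_u_eq koszul_v_def koszul_monomial_def by simp
  qed
qed

lemma koszul_d'_cohomology_trivial:
  assumes "m \<ge> 1" and d': "is_koszul_d' m K d'"
  shows "trivial_group (cohomology (add_monoid (koszul_algebra m K)) d')"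
proof -
  interpret S: cring "SR_ring m K" by (rule SR_ring_cring)
  interpret E: abelian_group "exterior_algebra m (SR_ring m K)" by (rule S.exterior_algebra_abelian_group)
  have D: "graded_derivation m (SR_ring m K) d'" using d' by (simp add: is_koszul_d'_def)
  have gen: "d' (ext_tensor m (SR_ring m K) {k} \<one>\<^bsub>SR_ring m K\<^esub>) = \<one>\<^bsub>exterior_algebra m (SR_ring m K)\<^esub>"
    if "k \<in> {1..m}" for k
    using d' that unfolding is_koszul_d'_def koszul_u_eq koszul_algebra_def by blast
  let ?E = "add_monoid (exterior_algebra m (SR_ring m K))"
  show ?thesis
    unfolding cohomology_def koszul_algebra_def
  proof (rule trivial_cohomology_at)
    show "d' \<in> hom ?E ?E" using D by (simp add: graded_derivation_def)
    have "d' (d' x) = \<zero>\<^bsub>exterior_algebra m (SR_ring m K)\<^esub>" if "x \<in> carrier ?E" for x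
      using that S.graded_derivation_square_zero[OF D koszul_d'_scalar[OF d', unfolded koszul_algebra_def] gen] by simp
    moreover have "x \<in> d' ` carrier ?E" if "x \<in> carrier ?E" "d' x = \<zero>\<^bsub>exterior_algebra m (SR_ring m K)\<^esub>" for x
    proof -
      \<comment> \<open>The generator \<open>u\<^sub>1\<close> is available because \<open>m \<ge> 1\<close>.\<close>
      have "d' (ext_tensor m (SR_ring m K) {1} \<one>\<^bsub>SR_ring m K\<^esub> \<otimes>\<^bsub>exterior_algebra m (SR_ring m K)\<^esub> x) = x"
        using that assms(1) by (intro S.graded_derivation_contraction[OF D gen]) auto
      then show ?thesis using that by (metis S.ext_mult_closed S.ext_tensor_closed S.one_closed image_eqI
          partial_object.select_convs(1))
    qed
    ultimately show "d' ` carrier ?E = kernel ?E ?E d'"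
      using S.graded_derivation_closed[OF D] by (auto simp: kernel_def)
  qed (use E.a_group in auto)
qed

section \<open>Coefficients in the Stanley--Reisner ring\<close>

text \<open>The exponent vector of the square-free monomial with support \<open>I\<close>.\<close>

definition sqfree :: "nat set \<Rightarrow> (nat \<Rightarrow>\<^sub>0 nat)"
  where "sqfree I = (\<Sum>i\<in>I. Poly_Mapping.single i 1)"

lemma keys_add_nat: "Poly_Mapping.keys (s + t) = Poly_Mapping.keys s \<union> Poly_Mapping.keys (t :: 'a \<Rightarrow>\<^sub>0 nat)"
  by (auto simp: in_keys_iff lookup_add)

lemma keys_sqfree: "finite I \<Longrightarrow> Poly_Mapping.keys (sqfree I) = I"
  unfolding sqfree_def by (induction I rule: finite_induct) (simp_all add: keys_add_nat)

lemma prod_poly_var: "finite I \<Longrightarrow> (\<Prod>i\<in>I. poly_var i) = Poly_Mapping.single (sqfree I) 1"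
  unfolding sqfree_def by (induction I rule: finite_induct) (simp_all add: poly_var_def mult_single)

lemma poly_ring_inv: "p \<in> carrier (poly_ring m) \<Longrightarrow> inv\<^bsub>add_monoid (poly_ring m)\<^esub> p = - p"
proof -
  interpret R: cring "poly_ring m" by (rule poly_ring_cring)
  assume p: "p \<in> carrier (poly_ring m)"
  then have "- p \<in> carrier (poly_ring m)" by (simp add: poly_ring_def)
  then have "\<ominus>\<^bsub>poly_ring m\<^esub> p = - p" using p by (intro R.minus_equality) auto
  then show ?thesis by (simp add: a_inv_def)
qed

text \<open>Polynomials all of whose monomials are supported on non-faces form an ideal, since supersets of
  non-faces are non-faces; this ideal contains the generators of the Stanley--Reisner ideal.\<close>

lemma SR_ideal_support:
  assumes K: "simplicial_complex_on m K" and p: "p \<in> SR_ideal m K" and t: "t \<in> Poly_Mapping.keys p"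
  shows "Poly_Mapping.keys t \<notin> K"
proof -
  interpret R: cring "poly_ring m" by (rule poly_ring_cring)
  let ?N = "{p \<in> carrier (poly_ring m). \<forall>t\<in>Poly_Mapping.keys p. Poly_Mapping.keys t \<notin> K}"
  have down: "I \<in> K" if "J \<in> K" "I \<subseteq> J" for I J
    using K that unfolding simplicial_complex_on_def by blast
  have mult: "x * p \<in> ?N" if p: "p \<in> ?N" and x: "x \<in> carrier (poly_ring m)" for p x
  proof -
    have "x * p \<in> carrier (poly_ring m)" using R.m_closed[of x p] p x by simp
    moreover have "Poly_Mapping.keys t \<notin> K" if "t \<in> Poly_Mapping.keys (x * p)" for t
    proof -
      obtain a b where ab: "t = a + b" "b \<in> Poly_Mapping.keys p" using \<open>t \<in> _\<close> keys_mult[of x p] by blast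
      then have "Poly_Mapping.keys b \<notin> K" "Poly_Mapping.keys b \<subseteq> Poly_Mapping.keys t" using p by (auto simp: keys_add_nat)
      then show ?thesis using down by blast
    qed
    ultimately show ?thesis by blast
  qed
  have "ideal ?N (poly_ring m)"
  proof (rule idealI)
    show "subgroup ?N (add_monoid (poly_ring m))"
    proof
      show "x \<otimes>\<^bsub>add_monoid (poly_ring m)\<^esub> y \<in> ?N" if "x \<in> ?N" "y \<in> ?N" for x y
        using that R.a_closed[of x y] Poly_Mapping.keys_add[of x y] by auto
      show "inv\<^bsub>add_monoid (poly_ring m)\<^esub> x \<in> ?N" if "x \<in> ?N" for x
      proof -
        have "x \<in> carrier (poly_ring m)" using that by simp
        then have "- x \<in> carrier (poly_ring m)" by (simp add: poly_ring_def)
        then show ?thesis using that unfolding poly_ring_inv[OF \<open>x \<in> carrier _\<close>] by simp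
      qed
      show "\<one>\<^bsub>add_monoid (poly_ring m)\<^esub> \<in> ?N" using R.zero_closed by simp
    qed auto
    show "x \<otimes>\<^bsub>poly_ring m\<^esub> a \<in> ?N" "a \<otimes>\<^bsub>poly_ring m\<^esub> x \<in> ?N"
      if "a \<in> ?N" "x \<in> carrier (poly_ring m)" for a x
      using mult[OF that] by (simp_all only: poly_ring_simps mult.commute[of a x])
  qed (rule R.ring_axioms)
  moreover have "{\<Prod>i\<in>I. poly_var i | I. I \<subseteq> {1..m} \<and> I \<notin> K} \<subseteq> ?N"
  proof clarify
    fix I assume I: "I \<subseteq> {1..m}" "I \<notin> K"
    then have "finite I" using finite_subset by blast
    then show "(\<Prod>i\<in>I. poly_var i) \<in> carrier (poly_ring m) \<and> (\<forall>t\<in>Poly_Mapping.keys (\<Prod>i\<in>I. poly_var i). Poly_Mapping.keys t \<notin> K)"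
      using I poly_monomial_closed[OF I(1)] by (simp add: prod_poly_var keys_sqfree)
  qed
  ultimately have "SR_ideal m K \<subseteq> ?N" unfolding SR_ideal_def by (rule R.genideal_minimal)
  then show ?thesis using p t by blast
qed

text \<open>The coefficient of \<open>v\<^sub>I\<close> is read off from an arbitrary representative.  For \<open>I \<in> K\<close> the choice does
  not matter, by the preceding lemma on supports.\<close>

definition SR_coeff :: "nat set \<Rightarrow> poly_int set \<Rightarrow> int"
  where "SR_coeff I X = Poly_Mapping.lookup (SOME p. p \<in> X) (sqfree I)"

lemma SR_coeff_class:
  assumes K: "simplicial_complex_on m K" and p: "p \<in> carrier (poly_ring m)" and I: "I \<in> K"
  shows "SR_coeff I (SR_class m K p) = Poly_Mapping.lookup p (sqfree I)"
proof -
  interpret R: cring "poly_ring m" by (rule poly_ring_cring)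
  interpret A: ideal "SR_ideal m K" "poly_ring m" by (rule SR_ideal_ideal)
  have fI: "finite I" using K I finite_subset[of I "{1..m}"] by (auto simp: simplicial_complex_on_def)
  have "p \<in> SR_class m K p" using A.a_rcos_self[OF p] .
  then have "(SOME q. q \<in> SR_class m K p) \<in> SR_class m K p" by (rule someI)
  then obtain a where a: "a \<in> SR_ideal m K" "(SOME q. q \<in> SR_class m K p) = a + p"
    by (auto simp: a_r_coset_def')
  have "Poly_Mapping.lookup a (sqfree I) = 0"
    using SR_ideal_support[OF K a(1), of "sqfree I"] I keys_sqfree[OF fI] by (auto simp: in_keys_iff)
  then show ?thesis by (simp add: SR_coeff_def a(2) lookup_add)
qed

lemma SR_coeff_hom:
  assumes K: "simplicial_complex_on m K" and I: "I \<in> K"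
  shows "SR_coeff I \<in> hom (add_monoid (SR_ring m K)) integer_group"
proof (rule homI)
  interpret q: ring_hom_ring "poly_ring m" "SR_ring m K" "SR_class m K" by (rule SR_class_ring_hom)
  fix x y assume "x \<in> carrier (add_monoid (SR_ring m K))" "y \<in> carrier (add_monoid (SR_ring m K))"
  then obtain a b where ab: "a \<in> carrier (poly_ring m)" "b \<in> carrier (poly_ring m)"
    "x = SR_class m K a" "y = SR_class m K b" by (auto simp: carrier_SR_ring)
  have "a + b \<in> carrier (poly_ring m)" using q.R.a_closed[OF ab(1,2)] by simp
  then show "SR_coeff I (x \<otimes>\<^bsub>add_monoid (SR_ring m K)\<^esub> y) = SR_coeff I x \<otimes>\<^bsub>integer_group\<^esub> SR_coeff I y"
    using q.hom_add[OF ab(1,2), symmetric] ab by (simp add: SR_coeff_class[OF K _ I] lookup_add)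
qed simp

lemma SR_coeff_monomial:
  assumes K: "simplicial_complex_on m K" and "I \<in> K" "L \<in> K"
  shows "SR_coeff I (SR_monomial m K L) = (if I = L then 1 else 0)"
proof -
  have sub: "I \<subseteq> {1..m}" "L \<subseteq> {1..m}" using assms by (auto simp: simplicial_complex_on_def)
  then have f: "finite I" "finite L" using finite_subset by blast+
  have "SR_coeff I (SR_monomial m K L) = Poly_Mapping.lookup (\<Prod>i\<in>L. poly_var i) (sqfree I)"
    unfolding SR_monomial_def by (rule SR_coeff_class[OF K poly_monomial_closed[OF sub(2)] assms(2)])
  moreover have "sqfree I = sqfree L \<longleftrightarrow> I = L" 
  proof
    assume "sqfree I = sqfree L"
    then have "Poly_Mapping.keys (sqfree I) = Poly_Mapping.keys (sqfree L)" by (rule arg_cong)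
    then show "I = L" by (simp only: keys_sqfree[OF f(1)] keys_sqfree[OF f(2)])
  qed (rule arg_cong)
  ultimately show ?thesis by (simp add: prod_poly_var f(2) lookup_single when_def)
qed

lemma SR_monomial_mult:
  assumes "I \<subseteq> {1..m}" "k \<in> {1..m}" "k \<notin> I"
  shows "SR_monomial m K {k} \<otimes>\<^bsub>SR_ring m K\<^esub> SR_monomial m K I = SR_monomial m K (insert k I)"
proof -
  interpret q: ring_hom_ring "poly_ring m" "SR_ring m K" "SR_class m K" by (rule SR_class_ring_hom)
  have "finite I" using assms finite_subset by blast
  then show ?thesis
    using q.hom_mult[of "\<Prod>i\<in>{k}. poly_var i" "\<Prod>i\<in>I. poly_var i"] assms
      poly_monomial_closed[of I m] poly_monomial_closed[of "{k}" m]
    by (simp add: SR_monomial_def)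
qed

lemma SR_monomial_nonface:
  assumes "I \<subseteq> {1..m}" "I \<notin> K"
  shows "SR_monomial m K I = \<zero>\<^bsub>SR_ring m K\<^esub>"
proof -
  interpret R: cring "poly_ring m" by (rule poly_ring_cring)
  interpret A: ideal "SR_ideal m K" "poly_ring m" by (rule SR_ideal_ideal)
  have "{\<Prod>i\<in>I. poly_var i | I. I \<subseteq> {1..m} \<and> I \<notin> K} \<subseteq> carrier (poly_ring m)"
    using poly_monomial_closed by auto
  then have "(\<Prod>i\<in>I. poly_var i) \<in> SR_ideal m K"
    unfolding SR_ideal_def using assms by (intro subsetD[OF R.genideal_self]) blast+
  then show ?thesis by (simp add: SR_monomial_def SR_ring_def FactRing_def A.a_rcos_const)
qed

section \<open>Comparison of cochains with the Koszul algebra\<close>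

lemma (in abelian_group) smul_finsum_add:
  assumes "finite A" "\<And>a. a \<in> A \<Longrightarrow> f a \<in> carrier G"
  shows "[(s::int)] \<cdot> (\<Oplus>a\<in>A. f a) = (\<Oplus>a\<in>A. [s] \<cdot> f a)"
  using assms
proof (induction rule: finite_induct)
  case empty
  show ?case using add.int_pow_one[of s] by simp
next
  case (insert a A)
  then show ?case by (simp add: add.int_pow_distrib Pi_iff)
qed

lemma (in abelian_group) hom_free_sum:
  assumes h: "h \<in> hom (free_Abelian_group S) (add_monoid G)" and "finite F" "\<And>j. j \<in> F \<Longrightarrow> b j \<in> S"
  shows "h (\<Sum>j\<in>F. frag_cmul (c j) (frag_of (b j))) = (\<Oplus>j\<in>F. [c j] \<cdot> h (frag_of (b j)))"
  using assms(2,3)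
proof (induction F rule: finite_induct)
  interpret h: group_hom "free_Abelian_group S" "add_monoid G" h
    by (intro group_hom.intro group_hom_axioms.intro group_free_Abelian_group a_group h)
  {
    case empty
    then show ?case using h.hom_one by simp
  next
    case (insert j F)
    have c: "h (frag_of (b i)) \<in> carrier G" if "i \<in> insert j F" for i
      using insert.prems[OF that] h.hom_closed[of "frag_of (b i)"] by simp
    have 1: "frag_cmul (c j) (frag_of (b j)) \<in> carrier (free_Abelian_group S)"
      using insert.prems[of j] keys_cmul[of "c j" "frag_of (b j)"] by auto
    have 2: "(\<Sum>j\<in>F. frag_cmul (c j) (frag_of (b j))) \<in> carrier (free_Abelian_group S)"
      using insert.prems keys_cmul by (intro sum_closed_free_Abelian_group) fastforce
    have "h (frag_cmul (c j) (frag_of (b j))) = [c j] \<cdot> h (frag_of (b j))"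
      using h.hom_int_pow[of "frag_of (b j)" "c j"] insert.prems[of j] by (simp add: add_pow_def)
    then show ?case
      using insert c h.hom_mult[OF 1 2] by (simp add: Pi_iff)
  }
qed

lemma eps_split:
  assumes "finite I" "L \<subseteq> I"
  shows "eps k I = eps k L * eps k (I - L)"
  using eps_Un[of L "I - L" k] assms finite_subset[OF assms(2,1)] by (simp add: Un_absorb1)

text \<open>The sign that turns \<open>\<alpha>\<^sub>L\<^sub>,\<^sub>I\<close> into the monomial \<open>u\<^sub>J v\<^sub>L\<close> with \<open>J = I - L\<close>.  The two recursions below
  say that it makes the correspondence compatible with both differentials.\<close>

definition koszul_sign :: "nat set \<Rightarrow> nat set \<Rightarrow> int"
  where "koszul_sign L I = (\<Prod>l\<in>L. eps l I)"

lemma koszul_sign_cases: "koszul_sign L I = 1 \<or> koszul_sign L I = - 1"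
proof -
  have "koszul_sign L I = 1 \<or> koszul_sign L I = - 1" if "finite L" for L
    using that unfolding koszul_sign_def
    by (induction L rule: finite_induct) (auto simp: eps_def minus_one_power_iff)
  then show ?thesis by (cases "finite L") (auto simp: koszul_sign_def)
qed

lemma koszul_sign_sq: "koszul_sign L I * koszul_sign L I = 1"
  using koszul_sign_cases[of L I] by auto

lemma koszul_sign_insert:
  assumes "finite I" "L \<subseteq> I" "k \<in> I - L"
  shows "koszul_sign L I * eps k (I - L) = eps k L * koszul_sign (insert k L) I"
proof -
  have "finite L" using assms finite_subset by blast
  then have "koszul_sign (insert k L) I = eps k L * eps k (I - L) * koszul_sign L I"
    using assms by (simp add: koszul_sign_def eps_split[OF assms(1,2)])
  then show ?thesis by (simp add: mult_ac)
qed

lemma koszul_sign_remove: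
  assumes "finite I" "L \<subseteq> I" "k \<in> I - L"
  shows "koszul_sign L I * eps k (I - L) = (- 1) ^ card L * eps k I * koszul_sign L (I - {k})"
proof -
  \<comment> \<open>Removing \<open>k\<close> from \<open>I\<close> flips the factors with \<open>k < l\<close>; their number is \<open>card M\<close> minus the
    number of \<open>l < k\<close>, which \<open>eps k M\<close> accounts for.\<close>
  have "(\<Prod>l\<in>M. eps l (I - {k})) = (- 1) ^ card M * eps k M * (\<Prod>l\<in>M. eps l I)"
    if "M \<subseteq> L" "finite M" for M
    using that(2,1)
  proof (induction M rule: finite_induct)
    case empty
    show ?case by (simp add: eps_def)
  next
    case (insert l M)
    have "l \<noteq> k" using insert assms by auto
    then show ?case using insert assms by (auto simp: eps_remove eps_insert)
  qed
  then have "koszul_sign L (I - {k}) = (- 1) ^ card L * eps k L * koszul_sign L I"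
    using assms finite_subset unfolding koszul_sign_def by blast
  then show ?thesis by (simp add: eps_split[OF assms(1,2)] mult_ac minus_one_power_sq)
qed

lemma koszul_monomial_closed:
  "I \<subseteq> {1..m} \<Longrightarrow> koszul_monomial m K J I \<in> carrier (koszul_algebra m K)"
proof -
  interpret S: cring "SR_ring m K" by (rule SR_ring_cring)
  show "I \<subseteq> {1..m} \<Longrightarrow> ?thesis"
    unfolding koszul_monomial_def koszul_algebra_def by (intro S.ext_tensor_closed SR_monomial_closed)
qed

lemma koszul_d_monomial:
  assumes d: "is_koszul_d m K d" and J: "J \<subseteq> {1..m}" "I \<subseteq> {1..m}" "J \<inter> I = {}"
  shows "d (koszul_monomial m K J I) =
    (\<Oplus>\<^bsub>koszul_algebra m K\<^esub>k\<in>J. [eps k J] \<cdot>\<^bsub>koszul_algebra m K\<^esub> koszul_monomial m K (J - {k}) (insert k I))"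
proof -
  interpret S: cring "SR_ring m K" by (rule SR_ring_cring)
  interpret E: abelian_group "exterior_algebra m (SR_ring m K)" by (rule S.exterior_algebra_abelian_group)
  have g: "SR_monomial m K {k} \<in> carrier (SR_ring m K)" if "k \<in> {1..m}" for k
    using that by (intro SR_monomial_closed) auto
  have k: "k \<in> {1..m}" "k \<notin> I" if "k \<in> J" for k using that J by auto
  have "d (koszul_monomial m K J I) =
      (\<Oplus>\<^bsub>koszul_algebra m K\<^esub>k\<in>J. [eps k J] \<cdot>\<^bsub>koszul_algebra m K\<^esub> ext_tensor m (SR_ring m K) (J - {k}) (SR_monomial m K {k} \<otimes>\<^bsub>SR_ring m K\<^esub> SR_monomial m K I))"
    using koszul_d_eq[OF d koszul_monomial_closed[OF J(2)], of J]
      S.ext_diff_tensor[of m "\<lambda>k. SR_monomial m K {k}", OF g J(1) SR_monomial_closed[OF J(2)]]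
    by (simp add: koszul_monomial_def koszul_algebra_def)
  also have "\<dots> = (\<Oplus>\<^bsub>koszul_algebra m K\<^esub>k\<in>J. [eps k J] \<cdot>\<^bsub>koszul_algebra m K\<^esub> koszul_monomial m K (J - {k}) (insert k I))"
    unfolding koszul_algebra_def
  proof (intro E.finsum_cong' refl)
    show "(\<lambda>k. [eps k J] \<cdot>\<^bsub>exterior_algebra m (SR_ring m K)\<^esub> koszul_monomial m K (J - {k}) (insert k I))
       \<in> J \<rightarrow> carrier (exterior_algebra m (SR_ring m K))"
      using k J(2) koszul_monomial_closed[unfolded koszul_algebra_def] by (auto intro!: E.add.int_pow_closed)
  qed (use SR_monomial_mult[OF J(2) k] in \<open>simp add: koszul_monomial_def\<close>)
  finally show ?thesis .
qed

lemma koszul_d'_monomial: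
  assumes d': "is_koszul_d' m K d'" and J: "J \<subseteq> {1..m}" "I \<subseteq> {1..m}"
  shows "d' (koszul_monomial m K J I) =
    (\<Oplus>\<^bsub>koszul_algebra m K\<^esub>k\<in>J. [eps k J] \<cdot>\<^bsub>koszul_algebra m K\<^esub> koszul_monomial m K (J - {k}) I)"
proof -
  interpret S: cring "SR_ring m K" by (rule SR_ring_cring)
  show ?thesis
    using koszul_d'_eq[OF d' koszul_monomial_closed[OF J(2)], of J]
      S.ext_diff_tensor[of m "\<lambda>_. \<one>\<^bsub>SR_ring m K\<^esub>", OF S.one_closed J(1) SR_monomial_closed[OF J(2)]]
    using SR_monomial_closed[OF J(2), of K] by (simp add: koszul_monomial_def koszul_algebra_def)
qed

lemma koszul_monomial_nonface:
  assumes "I \<subseteq> {1..m}" "I \<notin> K"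
  shows "koszul_monomial m K J I = \<zero>\<^bsub>koszul_algebra m K\<^esub>"
proof -
  interpret S: cring "SR_ring m K" by (rule SR_ring_cring)
  show ?thesis using SR_monomial_nonface[OF assms] 
    by (simp add: koszul_monomial_def koszul_algebra_def S.ext_zero[where J = J])
qed

text \<open>The comparison map \<open>\<phi>\<close> from the cochains to the Koszul algebra, given by its values on the basis.\<close>

locale koszul_comparison =
  fixes m :: nat and K :: "nat set set" and d d' :: "koszul \<Rightarrow> koszul"
    and \<phi> :: "(nat set \<times> nat set \<Rightarrow>\<^sub>0 int) \<Rightarrow> koszul"
  assumes complex: "simplicial_complex_on m K"
    and d: "is_koszul_d m K d" and d': "is_koszul_d' m K d'"
    and \<phi>_hom: "\<phi> \<in> hom (cochains m K) (add_monoid (koszul_algebra m K))"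
    and \<phi>_of: "(L, I) \<in> cochain_basis m K \<Longrightarrow>
      \<phi> (frag_of (L, I)) = [koszul_sign L I] \<cdot>\<^bsub>koszul_algebra m K\<^esub> koszul_monomial m K (I - L) L"
begin

abbreviation "E \<equiv> koszul_algebra m K"
abbreviation "B \<equiv> cochain_basis m K"

lemma abelian_group_E: "abelian_group E"
proof -
  interpret S: cring "SR_ring m K" by (rule SR_ring_cring)
  show ?thesis unfolding koszul_algebra_def by (rule S.exterior_algebra_abelian_group)
qed

sublocale E: abelian_group E by (rule abelian_group_E)

lemma \<phi>_hom': "\<phi> \<in> hom (free_Abelian_group B) (add_monoid E)"
  using \<phi>_hom by (simp add: cochains_def)

sublocale \<phi>: group_hom "free_Abelian_group B" "add_monoid E" \<phi>
  by (intro group_hom.intro group_hom_axioms.intro group_free_Abelian_group E.a_group \<phi>_hom')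

lemma monomial_closed: "(L, I) \<in> B \<Longrightarrow> koszul_monomial m K J L \<in> carrier E"
  by (rule koszul_monomial_closed[OF cochain_basisD(6)])

lemma d_hom: "d \<in> hom (add_monoid E) (add_monoid E)" and d'_hom: "d' \<in> hom (add_monoid E) (add_monoid E)"
  using d d' by (auto simp: is_koszul_d_def is_koszul_d'_def graded_derivation_def koszul_algebra_def)

sublocale d: group_hom "add_monoid E" "add_monoid E" d
  by (intro group_hom.intro group_hom_axioms.intro E.a_group d_hom)

sublocale d': group_hom "add_monoid E" "add_monoid E" d'
  by (intro group_hom.intro group_hom_axioms.intro E.a_group d'_hom)

lemma d_smul: "x \<in> carrier E \<Longrightarrow> d ([(c::int)] \<cdot>\<^bsub>E\<^esub> x) = [c] \<cdot>\<^bsub>E\<^esub> d x"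
  using d.hom_int_pow[of x c] by (simp add: add_pow_def)

lemma d'_smul: "x \<in> carrier E \<Longrightarrow> d' ([(c::int)] \<cdot>\<^bsub>E\<^esub> x) = [c] \<cdot>\<^bsub>E\<^esub> d' x"
  using d'.hom_int_pow[of x c] by (simp add: add_pow_def)

lemma smul_smul: "x \<in> carrier E \<Longrightarrow> [(s::int)] \<cdot>\<^bsub>E\<^esub> ([(t::int)] \<cdot>\<^bsub>E\<^esub> x) = [(s * t)] \<cdot>\<^bsub>E\<^esub> x"
  using E.add.int_pow_pow[of x s t] by (simp add: mult.commute)

lemma smul_closed: "x \<in> carrier E \<Longrightarrow> [(s::int)] \<cdot>\<^bsub>E\<^esub> x \<in> carrier E"
  by (rule E.add.int_pow_closed)

lemma \<phi>_d'_of: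
  assumes b: "(L, I) \<in> B"
  shows "d' (\<phi> (frag_of (L, I))) = \<phi> (cochain_d' (frag_of (L, I)))"
proof -
  note LI = cochain_basisD[OF b]
  have b': "(L, I - {k}) \<in> B" if "k \<in> I - L" for k
    using LI that by (auto simp: cochain_basis_def full_subcomplex_def)
  have D: "I - L - {k} = I - {k} - L" for k by auto
  have "d' (\<phi> (frag_of (L, I))) = [koszul_sign L I] \<cdot>\<^bsub>E\<^esub>
      (\<Oplus>\<^bsub>E\<^esub>k\<in>I - L. [eps k (I - L)] \<cdot>\<^bsub>E\<^esub> koszul_monomial m K (I - L - {k}) L)"
    by (simp add: \<phi>_of[OF b] d'_smul monomial_closed[OF b] koszul_d'_monomial[OF d' LI(7,6)])
  also have "\<dots> = (\<Oplus>\<^bsub>E\<^esub>k\<in>I - L. [koszul_sign L I] \<cdot>\<^bsub>E\<^esub> ([eps k (I - L)] \<cdot>\<^bsub>E\<^esub> koszul_monomial m K (I - L - {k}) L))"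
    using LI(4) by (intro E.smul_finsum_add smul_closed monomial_closed[OF b]) simp
  also have "\<dots> = (\<Oplus>\<^bsub>E\<^esub>k\<in>I - L. [((- 1) ^ card L * eps k I)] \<cdot>\<^bsub>E\<^esub> \<phi> (frag_of (L, I - {k})))"
  proof (intro E.finsum_cong' refl)
    fix k assume k: "k \<in> I - L"
    show "[koszul_sign L I] \<cdot>\<^bsub>E\<^esub> ([eps k (I - L)] \<cdot>\<^bsub>E\<^esub> koszul_monomial m K (I - L - {k}) L) =
      [((- 1) ^ card L * eps k I)] \<cdot>\<^bsub>E\<^esub> \<phi> (frag_of (L, I - {k}))"
      unfolding \<phi>_of[OF b'[OF k]] smul_smul[OF monomial_closed[OF b]] koszul_sign_remove[OF LI(4,1) k] D ..
  qed (use b' \<phi>.hom_closed[of "frag_of (L, I - {_})"] in \<open>auto intro!: smul_closed\<close>)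
  also have "\<dots> = \<phi> (cochain_d' (frag_of (L, I)))"
    unfolding cochain_d'_of using LI(4) b' by (intro E.hom_free_sum[OF \<phi>_hom', symmetric]) auto
  finally show ?thesis .
qed

lemma \<phi>_d_of:
  assumes b: "(L, I) \<in> B"
  shows "d (\<phi> (frag_of (L, I))) = \<phi> (cochain_d K (frag_of (L, I)))"
proof -
  note LI = cochain_basisD[OF b]
  let ?S = "{k \<in> I - L. insert k L \<in> K}"
  have b': "(insert k L, I) \<in> B" if "k \<in> ?S" for k
    using LI that by (auto simp: cochain_basis_def full_subcomplex_def)
  have D: "I - L - {k} = I - insert k L" for k by auto
  have c: "koszul_monomial m K J (insert k L) \<in> carrier E" if "k \<in> I - L" for k J
    using LI that by (intro koszul_monomial_closed) auto
  have "d (\<phi> (frag_of (L, I))) = [koszul_sign L I] \<cdot>\<^bsub>E\<^esub>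
      (\<Oplus>\<^bsub>E\<^esub>k\<in>I - L. [eps k (I - L)] \<cdot>\<^bsub>E\<^esub> koszul_monomial m K (I - L - {k}) (insert k L))"
    using koszul_d_monomial[OF d LI(7,6)] by (simp add: \<phi>_of[OF b] d_smul monomial_closed[OF b] Int_commute)
  also have "\<dots> = (\<Oplus>\<^bsub>E\<^esub>k\<in>I - L. [koszul_sign L I] \<cdot>\<^bsub>E\<^esub> ([eps k (I - L)] \<cdot>\<^bsub>E\<^esub> koszul_monomial m K (I - L - {k}) (insert k L)))"
    using LI(4) c by (intro E.smul_finsum_add smul_closed) auto
  also have "\<dots> = (\<Oplus>\<^bsub>E\<^esub>k\<in>?S. [eps k L] \<cdot>\<^bsub>E\<^esub> \<phi> (frag_of (insert k L, I)))"
  proof (rule E.add.finprod_mono_neutral_cong_right)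
    show "finite (I - L)" using LI(4) by simp
    fix k assume k: "k \<in> I - L - ?S"
    have "koszul_monomial m K (I - L - {k}) (insert k L) = \<zero>\<^bsub>E\<^esub>"
      using k LI by (intro koszul_monomial_nonface) auto
    then show "[koszul_sign L I] \<cdot>\<^bsub>E\<^esub> ([eps k (I - L)] \<cdot>\<^bsub>E\<^esub> koszul_monomial m K (I - L - {k}) (insert k L)) = \<zero>\<^bsub>E\<^esub>"
      by (simp add: E.add.int_pow_one)
  next
    fix k assume k: "k \<in> ?S"
    then have k': "k \<in> I - L" by simp
    show "[koszul_sign L I] \<cdot>\<^bsub>E\<^esub> ([eps k (I - L)] \<cdot>\<^bsub>E\<^esub> koszul_monomial m K (I - L - {k}) (insert k L)) =
      [eps k L] \<cdot>\<^bsub>E\<^esub> \<phi> (frag_of (insert k L, I))"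
      unfolding \<phi>_of[OF b'[OF k]] smul_smul[OF c[OF k']] koszul_sign_insert[OF LI(4,1) k'] D ..
  qed (use c in \<open>auto intro!: smul_closed\<close>)
  also have "\<dots> = \<phi> (cochain_d K (frag_of (L, I)))"
    unfolding cochain_d_of using LI(4) b' by (intro E.hom_free_sum[OF \<phi>_hom', symmetric]) auto
  finally show ?thesis .
qed

lemma keys_cochain_d_basis: "Poly_Mapping.keys x \<subseteq> B \<Longrightarrow> Poly_Mapping.keys (cochain_d K x) \<subseteq> B"
  using keys_cochain_d[of K x] by (fastforce simp: cochain_basis_def full_subcomplex_def)

lemma keys_cochain_d'_basis: "Poly_Mapping.keys x \<subseteq> B \<Longrightarrow> Poly_Mapping.keys (cochain_d' x) \<subseteq> B"
  using keys_cochain_d'[of x] by (fastforce simp: cochain_basis_def full_subcomplex_def)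

lemma \<phi>_diff:
  assumes "Poly_Mapping.keys x \<subseteq> B" "Poly_Mapping.keys y \<subseteq> B"
  shows "\<phi> (x - y) = \<phi> x \<ominus>\<^bsub>E\<^esub> \<phi> y"
  using assms \<phi>.hom_mult[of x "- y"] \<phi>.hom_inv[of y] by (simp add: a_minus_def a_inv_def)

lemma \<phi>_closed: "Poly_Mapping.keys x \<subseteq> B \<Longrightarrow> \<phi> x \<in> carrier E"
  using \<phi>.hom_closed[of x] by simp

lemma \<phi>_zero: "\<phi> 0 = \<zero>\<^bsub>E\<^esub>"
  using \<phi>.hom_one by simp

lemma \<phi>_d: "Poly_Mapping.keys x \<subseteq> B \<Longrightarrow> d (\<phi> x) = \<phi> (cochain_d K x)"
proof (induction x rule: free_Abelian_induct)
  case zero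
  show ?case using d.hom_one by (simp add: \<phi>_zero cochain_d_zero)
next
  case (diff x y)
  have "d (\<phi> x \<ominus>\<^bsub>E\<^esub> \<phi> y) = d (\<phi> x) \<ominus>\<^bsub>E\<^esub> d (\<phi> y)"
    using diff d.hom_mult[of "\<phi> x" "\<ominus>\<^bsub>E\<^esub> \<phi> y"] d.hom_inv[of "\<phi> y", folded a_inv_def] by (simp add: \<phi>_closed a_minus_def)
  then show ?case using diff by (simp add: \<phi>_diff cochain_d_diff keys_cochain_d_basis)
next
  case (gen b)
  then show ?case by (cases b) (simp add: \<phi>_d_of)
qed

lemma \<phi>_d': "Poly_Mapping.keys x \<subseteq> B \<Longrightarrow> d' (\<phi> x) = \<phi> (cochain_d' x)"
proof (induction x rule: free_Abelian_induct)
  case zero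
  show ?case using d'.hom_one by (simp add: \<phi>_zero cochain_d'_zero)
next
  case (diff x y)
  have "d' (\<phi> x \<ominus>\<^bsub>E\<^esub> \<phi> y) = d' (\<phi> x) \<ominus>\<^bsub>E\<^esub> d' (\<phi> y)"
    using diff d'.hom_mult[of "\<phi> x" "\<ominus>\<^bsub>E\<^esub> \<phi> y"] d'.hom_inv[of "\<phi> y", folded a_inv_def] by (simp add: \<phi>_closed a_minus_def)
  then show ?case using diff by (simp add: \<phi>_diff cochain_d'_diff keys_cochain_d'_basis)
next
  case (gen b)
  then show ?case by (cases b) (simp add: \<phi>_d'_of)
qed

text \<open>The coefficient of \<open>\<alpha>\<^sub>L\<^sub>,\<^sub>I\<close> can be recovered from the image as the coefficient of \<open>u\<^sub>J v\<^sub>L\<close>, \<open>J = I - L\<close>: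
  the monomials have distinct exterior parts or distinct square-free parts.\<close>

lemma \<phi>_coefficient:
  assumes b: "(L, I) \<in> B" and x: "Poly_Mapping.keys x \<subseteq> B"
  shows "SR_coeff L (\<phi> x (I - L)) = koszul_sign L I * Poly_Mapping.lookup x (L, I)"
  using x
proof (induction x rule: free_Abelian_induct)
  interpret S: cring "SR_ring m K" by (rule SR_ring_cring)
  note LI = cochain_basisD[OF b]
  have \<chi>: "(\<lambda>y. SR_coeff L (y (I - L))) \<in> hom (add_monoid E) integer_group"
  proof (rule homI)
    fix x y assume "x \<in> carrier (add_monoid E)" "y \<in> carrier (add_monoid E)"
    then have c: "x (I - L) \<in> carrier (SR_ring m K)" "y (I - L) \<in> carrier (SR_ring m K)"
      using S.ext_closed_apply[OF _ LI(7)] by (simp_all add: koszul_algebra_def)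
    then show "SR_coeff L ((x \<otimes>\<^bsub>add_monoid E\<^esub> y) (I - L)) = SR_coeff L (x (I - L)) \<otimes>\<^bsub>integer_group\<^esub> SR_coeff L (y (I - L))"
      using hom_mult[OF SR_coeff_hom[OF complex LI(3)], of "x (I - L)" "y (I - L)"] LI(7)
      by (simp add: koszul_algebra_def S.ext_add_apply)
  qed simp
  interpret \<chi>: group_hom "add_monoid E" integer_group "\<lambda>y. SR_coeff L (y (I - L))"
    by (intro group_hom.intro group_hom_axioms.intro E.a_group \<chi> group_integer_group)
  {
    case zero
    show ?case using \<chi>.hom_one by (simp add: \<phi>_zero)
  next
    case (diff x y)
    then show ?case
      using \<chi>.hom_mult[of "\<phi> x" "\<ominus>\<^bsub>E\<^esub> \<phi> y"] \<chi>.hom_inv[of "\<phi> y", folded a_inv_def]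
      by (simp add: \<phi>_diff \<phi>_closed a_minus_def lookup_minus algebra_simps)
  next
    case (gen b')
    obtain L' I' where b': "b' = (L', I')" "(L', I') \<in> B" using gen by (cases b') auto
    note LI' = cochain_basisD[OF b'(2)]
    have "SR_coeff L (\<phi> (frag_of (L', I')) (I - L)) =
        koszul_sign L' I' * SR_coeff L (koszul_monomial m K (I' - L') L' (I - L))"
      using \<chi>.hom_int_pow[of "koszul_monomial m K (I' - L') L'" "koszul_sign L' I'"] monomial_closed[OF b'(2)]
      by (simp add: \<phi>_of[OF b'(2)] add_pow_def)
    also have "koszul_monomial m K (I' - L') L' (I - L) =
        (if I - L = I' - L' then SR_monomial m K L' else \<zero>\<^bsub>SR_ring m K\<^esub>)"
      unfolding koszul_monomial_def by (rule S.ext_tensor_apply[OF LI(7)])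
    also have "SR_coeff L \<dots> = (if (L', I') = (L, I) then 1 else 0)"
    proof -
      have "SR_coeff L \<zero>\<^bsub>SR_ring m K\<^esub> = 0"
        using hom_one[OF SR_coeff_hom[OF complex LI(3)] S.a_group group_integer_group] by simp
      moreover have "I = I'" if "L = L'" "I - L = I' - L'" using that LI(1) LI'(1) by blast
      ultimately show ?thesis using SR_coeff_monomial[OF complex LI(3) LI'(3)] by auto
    qed
    finally show ?case by (auto simp: b')
  }
qed

lemma \<phi>_inj: "inj_on \<phi> (carrier (cochains m K))"
proof (rule inj_onI)
  fix x y assume xy: "x \<in> carrier (cochains m K)" "y \<in> carrier (cochains m K)" "\<phi> x = \<phi> y"
  then have k: "Poly_Mapping.keys x \<subseteq> B" "Poly_Mapping.keys y \<subseteq> B" by (simp_all add: cochains_def)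
  show "x = y"
  proof (rule poly_mapping_eqI)
    fix b
    show "Poly_Mapping.lookup x b = Poly_Mapping.lookup y b"
    proof (cases "b \<in> B")
      case True
      obtain L I where b: "b = (L, I)" by (cases b)
      have "koszul_sign L I * Poly_Mapping.lookup x b = koszul_sign L I * Poly_Mapping.lookup y b"
        using \<phi>_coefficient[of L I x] \<phi>_coefficient[of L I y] True k by (simp only: b xy(3))
      then show ?thesis using koszul_sign_cases[of L I] by auto
    next
      case False
      then have "b \<notin> Poly_Mapping.keys x" "b \<notin> Poly_Mapping.keys y" using k by auto
      then show ?thesis by (simp add: in_keys_iff)
    qed
  qed
qed

text \<open>Stated for an arbitrary part \<open>T\<close> of the basis, so that it covers \<open>R\<^sup>*(K)\<close> and its homogeneous
  parts alike.\<close>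

lemma \<phi>_image:
  assumes T: "T \<subseteq> B"
  shows "\<phi> ` carrier (free_Abelian_group T) =
    carrier (subgroup_generated (add_monoid E) {koszul_monomial m K (I - L) L | L I. (L, I) \<in> T})"
    (is "?l = carrier (subgroup_generated _ ?X)")
proof -
  have X: "?X \<subseteq> carrier (add_monoid E)" using T monomial_closed by auto
  let ?G = "generate (add_monoid E) ?X"
  have gen: "carrier (subgroup_generated (add_monoid E) ?X) = ?G"
    using X by (simp add: carrier_subgroup_generated Int_absorb1)
  have G: "subgroup ?G (add_monoid E)" using X by (intro E.add.generate_is_subgroup) auto
  have kT: "Poly_Mapping.keys x \<subseteq> B" if "Poly_Mapping.keys x \<subseteq> T" for x :: "nat set \<times> nat set \<Rightarrow>\<^sub>0 int"
    using that T by blast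
  have hom: "\<phi> \<in> hom (free_Abelian_group T) (add_monoid E)"
    using \<phi>.hom_mult \<phi>_closed kT by (intro homI) auto
  interpret t: group_hom "free_Abelian_group T" "add_monoid E" \<phi>
    by (intro group_hom.intro group_hom_axioms.intro group_free_Abelian_group E.a_group hom)
  have "\<phi> x \<in> ?G" if "Poly_Mapping.keys x \<subseteq> T" for x
    using that
  proof (induction x rule: free_Abelian_induct)
    case zero
    show ?case using subgroup.one_closed[OF G] by (simp add: \<phi>_zero)
  next
    case (diff x y)
    then show ?case
      using subgroup.m_closed[OF G, of "\<phi> x" "\<ominus>\<^bsub>E\<^esub> \<phi> y"] subgroup.m_inv_closed[OF G, of "\<phi> y", folded a_inv_def]
      by (simp add: \<phi>_diff kT a_minus_def)
  next
    case (gen b)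
    then obtain L I where b: "b = (L, I)" "(L, I) \<in> T" "(L, I) \<in> B" using T by (cases b) auto
    have "koszul_monomial m K (I - L) L \<in> ?G" using b by (intro generate.incl) auto
    then show ?case
      using E.add.subgroup_int_pow_closed[OF G, of _ "koszul_sign L I"] by (simp add: b \<phi>_of[OF b(3)])
  qed
  then have "?l \<subseteq> ?G" by auto
  moreover have "?G \<subseteq> ?l"
  proof (rule E.add.generate_subgroup_incl[OF _ t.img_is_subgroup])
    show "?X \<subseteq> ?l"
    proof clarify
      fix L I assume LI: "(L, I) \<in> T"
      then have b: "(L, I) \<in> B" using T by auto
      have "\<phi> (frag_cmul (koszul_sign L I) (frag_of (L, I))) =
          [koszul_sign L I] \<cdot>\<^bsub>E\<^esub> ([koszul_sign L I] \<cdot>\<^bsub>E\<^esub> koszul_monomial m K (I - L) L)"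
        using t.hom_int_pow[of "frag_of (L, I)" "koszul_sign L I"] LI by (simp add: \<phi>_of[OF b] add_pow_def)
      also have "\<dots> = koszul_monomial m K (I - L) L"
        using E.add.int_pow_1[of "koszul_monomial m K (I - L) L"] monomial_closed[OF b]
        by (simp add: smul_smul koszul_sign_sq)
      finally have "koszul_monomial m K (I - L) L = \<phi> (frag_cmul (koszul_sign L I) (frag_of (L, I)))" ..
      moreover have "frag_cmul (koszul_sign L I) (frag_of (L, I)) \<in> carrier (free_Abelian_group T)"
        using keys_cmul[of "koszul_sign L I" "frag_of (L, I)"] LI by auto
      ultimately show "koszul_monomial m K (I - L) L \<in> ?l" by (rule image_eqI)
    qed
  qed
  ultimately show ?thesis unfolding gen by (rule equalityI)
qed

end

section \<open>The subgroup spanned by the monomials\<close>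

context koszul_comparison
begin

text \<open>The pair \<open>(J, L)\<close> encoding \<open>u\<^sub>J v\<^sub>L\<close> corresponds to \<open>(L, I)\<close> with \<open>I = J \<union> L\<close>, and both have total degree
  \<open>card J + 2 card L\<close>.\<close>

lemma R_generators_deg:
  "{koszul_monomial m K J I | J I. (J, I) \<in> R_basis m K \<and> total_degree (R_bidegree (J, I)) = n} =
    {koszul_monomial m K (I - L) L | L I. (L, I) \<in> cochain_basis_deg m K n}" (is "?X = ?Y")
proof
  show "?X \<subseteq> ?Y"
  proof
    fix y assume "y \<in> ?X"
    then obtain J I where y: "y = koszul_monomial m K J I"
      and JI: "(J, I) \<in> R_basis m K" "total_degree (R_bidegree (J, I)) = n" by blast
    have sub: "J \<subseteq> {1..m}" "I \<in> K" "I \<subseteq> {1..m}" "J \<inter> I = {}"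
      using JI complex by (auto simp: R_basis_def simplicial_complex_on_def)
    then have f: "finite J" "finite I" using finite_subset by blast+
    have "(I, J \<union> I) \<in> cochain_basis_deg m K n"
      using sub f JI(2) by (simp add: cochain_basis_deg_iff cochain_basis_def full_subcomplex_def
        total_degree_def R_bidegree_def card_Un_disjoint)
    moreover have "(J \<union> I) - I = J" using sub(4) by blast
    ultimately have "y = koszul_monomial m K ((J \<union> I) - I) I \<and> (I, J \<union> I) \<in> cochain_basis_deg m K n"
      by (simp add: y)
    then show "y \<in> ?Y" by blast
  qed
  show "?Y \<subseteq> ?X"
  proof
    fix y assume "y \<in> ?Y"
    then obtain L I where y: "y = koszul_monomial m K (I - L) L" and LI: "(L, I) \<in> cochain_basis_deg m K n" by blast
    then have b: "(L, I) \<in> B" "int (card L) + int (card I) = n" by (simp_all add: cochain_basis_deg_iff)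
    note bD = cochain_basisD[OF b(1)]
    have "card I = card (I - L) + card L" using bD by (simp add: card_Diff_subset card_mono)
    then have "(I - L, L) \<in> R_basis m K \<and> total_degree (R_bidegree (I - L, L)) = n"
      using bD b(2) by (auto simp: R_basis_def total_degree_def R_bidegree_def)
    then show "y \<in> ?X" using y by blast
  qed
qed

lemma R_generators:
  "{koszul_monomial m K J I | J I. (J, I) \<in> R_basis m K} = {koszul_monomial m K (I - L) L | L I. (L, I) \<in> B}"
    (is "?X = ?Y")
proof -
  have "?X = (\<Union>n. {koszul_monomial m K J I | J I. (J, I) \<in> R_basis m K \<and> total_degree (R_bidegree (J, I)) = n})"
    by blast
  also have "\<dots> = ?Y"
    unfolding R_generators_deg by (auto simp: cochain_basis_deg_iff)
  finally show ?thesis .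
qed

lemma carrier_R_group: "carrier (R_group m K) = \<phi> ` carrier (cochains m K)"
  unfolding R_group_def R_generators cochains_def by (rule \<phi>_image[symmetric]) simp

lemma carrier_R_group_deg: "carrier (R_group_deg m K n) = \<phi> ` carrier (cochains_deg m K n)"
  unfolding R_group_deg_def R_generators_deg cochains_deg_eq
  by (rule \<phi>_image[symmetric]) (simp add: cochain_basis_deg_def)

lemma R_group_ops [simp]:
  "x \<otimes>\<^bsub>R_group m K\<^esub> y = x \<oplus>\<^bsub>E\<^esub> y" "\<one>\<^bsub>R_group m K\<^esub> = \<zero>\<^bsub>E\<^esub>"
  "x \<otimes>\<^bsub>R_group_deg m K n\<^esub> y = x \<oplus>\<^bsub>E\<^esub> y" "\<one>\<^bsub>R_group_deg m K n\<^esub> = \<zero>\<^bsub>E\<^esub>"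
  by (simp_all add: R_group_def R_group_deg_def)

lemma R_group_comm_group: "comm_group (R_group m K)"
  unfolding R_group_def by (rule E.add.abelian_subgroup_generated) (rule E.a_comm_group)

lemma R_group_deg_group: "group (R_group_deg m K n)"
  unfolding R_group_deg_def by (rule E.add.group_subgroup_generated)

lemma \<phi>_iso: "\<phi> \<in> iso (cochains m K) (R_group m K)"
  using \<phi>_inj \<phi>_hom by (auto simp: iso_def bij_betw_def hom_def carrier_R_group)

lemma R_group_contractible:
  assumes "K \<noteq> full_simplex m"
  shows "contractible_bicomplex (R_group m K) d d'
    (\<phi> \<circ> cochain_h m \<circ> inv_into (carrier (cochains m K)) \<phi>) (\<lambda>p. \<phi> ` cochain_filtration m K p) (Suc m)"
proof -
  interpret C: contractible_bicomplex "cochains m K" "cochain_d K" cochain_d' "cochain_h m" "cochain_filtration m K" "Suc m"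
    by (rule cochains_contractible[OF complex assms])
  show ?thesis
    by (rule C.transport[OF R_group_comm_group \<phi>_iso]) (simp_all add: cochains_def \<phi>_d \<phi>_d')
qed

lemma keys_basis_deg: "x \<in> carrier (cochains_deg m K n) \<Longrightarrow> Poly_Mapping.keys x \<subseteq> B"
  by (auto simp: cochains_deg_eq cochain_basis_deg_def)

lemma \<phi>_eq_zero_iff: "Poly_Mapping.keys x \<subseteq> B \<Longrightarrow> \<phi> x = \<zero>\<^bsub>E\<^esub> \<longleftrightarrow> x = 0"
  using inj_onD[OF \<phi>_inj, of x 0] by (auto simp: \<phi>_zero cochains_def)

lemma d'_image_deg: "d' ` carrier (R_group_deg m K n) = \<phi> ` cochain_d' ` carrier (cochains_deg m K n)"
  unfolding carrier_R_group_deg image_image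
  by (intro image_cong refl \<phi>_d') (rule keys_basis_deg)

lemma d'_kernel_deg:
  "kernel (R_group_deg m K n) (R_group_deg m K k) d' =
    \<phi> ` kernel (cochains_deg m K n) (cochains_deg m K k) cochain_d'"
proof -
  have "d' (\<phi> x) = \<zero>\<^bsub>E\<^esub> \<longleftrightarrow> cochain_d' x = 0" if "x \<in> carrier (cochains_deg m K n)" for x
    using keys_basis_deg[OF that] by (simp add: \<phi>_d' \<phi>_eq_zero_iff keys_cochain_d'_basis)
  then show ?thesis
    by (auto simp: kernel_def carrier_R_group_deg cochains_deg_eq[of m K k])
qed

lemma d'_hom_deg: "d' \<in> hom (R_group_deg m K n) (R_group_deg m K (n - 1))"
proof (rule homI)
  fix x assume "x \<in> carrier (R_group_deg m K n)"
  then have "d' x \<in> \<phi> ` cochain_d' ` carrier (cochains_deg m K n)" using d'_image_deg by blast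
  also have "\<dots> \<subseteq> carrier (R_group_deg m K (n - 1))"
    unfolding carrier_R_group_deg using keys_cochain_d'_deg by (intro image_mono) (auto simp: cochains_deg_eq)
  finally show "d' x \<in> carrier (R_group_deg m K (n - 1))" .
next
  fix x y assume "x \<in> carrier (R_group_deg m K n)" "y \<in> carrier (R_group_deg m K n)"
  then have "x \<in> carrier E" "y \<in> carrier E" using \<phi>_closed[OF keys_basis_deg] by (auto simp: carrier_R_group_deg)
  then show "d' (x \<otimes>\<^bsub>R_group_deg m K n\<^esub> y) = d' x \<otimes>\<^bsub>R_group_deg m K (n - 1)\<^esub> d' y"
    using d'.hom_mult[of x y] by simp
qed

lemma R_cohomology_trivial:
  assumes "n \<noteq> 2 * int m"
  shows "trivial_group (R_cohomology_deg m K d' n)"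
  unfolding R_cohomology_deg_def
  by (rule trivial_cohomology_at)
    (simp_all only: R_group_deg_group d'_hom_deg d'_image_deg d'_kernel_deg cochain_d'_image_deg[OF assms])

lemma R_top_cohomology:
  assumes full: "K = full_simplex m"
  defines "H \<equiv> R_cohomology_deg m K d' (2 * int m)"
    and "c \<equiv> d' ` carrier (R_group_deg m K (2 * int m + 1))
      #>\<^bsub>R_group_deg m K (2 * int m)\<^esub> koszul_monomial m K {} {1..m}"
  shows "H \<cong> integer_group \<and> c \<in> carrier H \<and> carrier H = generate H {c}"
  unfolding H_def c_def R_cohomology_deg_def
proof (rule cohomology_at_infinite_cyclic)
  let ?b = "({1..m}, {1..m}) :: nat set \<times> nat set"
  let ?G = "R_group_deg m K (2 * int m)"
  let ?s = "koszul_sign {1..m} {1..m}"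
  let ?x = "frag_cmul ?s (frag_of ?b)"
  let ?F = "free_Abelian_group {?b}"
  have b: "?b \<in> B" using cochain_basis_deg_top(1)[OF full] by (auto simp: cochain_basis_deg_def)
  have F: "cochains_deg m K (2 * int m) = ?F"
    by (simp only: cochains_deg_eq cochain_basis_deg_top[OF full])
  have car: "carrier ?G = \<phi> ` carrier ?F" by (simp only: carrier_R_group_deg F)
  have kB: "Poly_Mapping.keys x \<subseteq> B" if "Poly_Mapping.keys x \<subseteq> {?b}" for x :: "nat set \<times> nat set \<Rightarrow>\<^sub>0 int"
    using that b by blast
  have hom: "\<phi> \<in> hom ?F ?G"
  proof (rule homI)
    fix x y assume "x \<in> carrier ?F" "y \<in> carrier ?F"
    then show "\<phi> (x \<otimes>\<^bsub>?F\<^esub> y) = \<phi> x \<otimes>\<^bsub>?G\<^esub> \<phi> y"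
      using \<phi>.hom_mult[of x y] kB by simp
  qed (simp add: car)
  interpret f: group_hom ?F ?G \<phi>
    by (intro group_hom.intro group_hom_axioms.intro group_free_Abelian_group R_group_deg_group hom)
  have x: "?x \<in> carrier ?F" using keys_cmul[of ?s "frag_of ?b"] by simp
  \<comment> \<open>The generator \<open>\<alpha>\<close> itself is mapped to the monomial up to the sign \<open>?s\<close>; hence \<open>?x\<close>, another
    generator of the same group, is used in its place.\<close>
  have a: "koszul_monomial m K {} {1..m} = \<phi> ?x"
  proof -
    have "\<phi> ?x = [?s] \<cdot>\<^bsub>E\<^esub> \<phi> (frag_of ?b)"
      using \<phi>.hom_int_pow[of "frag_of ?b" ?s] b by (simp add: add_pow_def)
    then have "\<phi> ?x = [?s] \<cdot>\<^bsub>E\<^esub> ([?s] \<cdot>\<^bsub>E\<^esub> koszul_monomial m K ({1..m} - {1..m}) {1..m})"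
      by (simp only: \<phi>_of[OF b])
    then show ?thesis
      using E.add.int_pow_1[of "koszul_monomial m K {} {1..m}"] monomial_closed[OF b, of "{}"]
      by (simp add: smul_smul koszul_sign_sq)
  qed
  show "group ?G" "group (R_group_deg m K (2 * int m - 1))" by (rule R_group_deg_group)+
  show "d' \<in> hom ?G (R_group_deg m K (2 * int m - 1))" by (rule d'_hom_deg)
  have "cochains_deg m K (2 * int m + 1) = free_Abelian_group {}"
    by (simp only: cochains_deg_eq cochain_basis_deg_top[OF full])
  then have "carrier (cochains_deg m K (2 * int m + 1)) = {0}" by auto
  then show "d' ` carrier (R_group_deg m K (2 * int m + 1)) = {\<one>\<^bsub>?G\<^esub>}"
    by (simp add: d'_image_deg cochain_d'_zero \<phi>_zero)
  show "kernel ?G (R_group_deg m K (2 * int m - 1)) d' = carrier ?G"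
    unfolding d'_kernel_deg cochain_d'_kernel_top[OF full] carrier_R_group_deg ..
  show "koszul_monomial m K {} {1..m} \<in> carrier ?G" unfolding a car using x by (rule imageI)
  show "carrier ?G = generate ?G {koszul_monomial m K {} {1..m}}"
    using f.generate_img[of "{?x}"] x free_Abelian_group_singleton_generate[OF koszul_sign_sq, of ?b "{1..m}" "{1..m}"]
    by (simp only: car a image_insert image_empty insert_subset empty_subsetI simp_thms)
  show "n = 0" if "koszul_monomial m K {} {1..m} [^]\<^bsub>?G\<^esub> n = \<one>\<^bsub>?G\<^esub>" for n :: int
  proof -
    have "\<phi> (frag_cmul n ?x) = \<phi> (?x [^]\<^bsub>?F\<^esub> n)"
      using x by (simp only: int_pow_free_Abelian_group carrier_free_Abelian_group_iff)
    also have "\<dots> = \<zero>\<^bsub>E\<^esub>"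
      using that by (simp only: f.hom_int_pow[OF x] a R_group_ops)
    finally have "\<phi> (frag_cmul n ?x) = \<zero>\<^bsub>E\<^esub>" .
    moreover have "Poly_Mapping.keys (frag_cmul n ?x) \<subseteq> B"
      using b keys_cmul by fastforce
    ultimately have "frag_cmul n ?x = 0" using \<phi>_eq_zero_iff by blast
    then show ?thesis using koszul_sign_cases[of "{1..m}" "{1..m}"] by auto
  qed
qed

end

text \<open>Such a map exists because the cochain group is free.\<close>

lemma koszul_comparison_exists:
  assumes "simplicial_complex_on m K" "is_koszul_d m K d" "is_koszul_d' m K d'"
  obtains \<phi> where "koszul_comparison m K d d' \<phi>"
proof -
  interpret S: cring "SR_ring m K" by (rule SR_ring_cring)
  interpret E: abelian_group "koszul_algebra m K"
    unfolding koszul_algebra_def by (rule S.exterior_algebra_abelian_group)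
  let ?f = "\<lambda>(L, I). [koszul_sign L I] \<cdot>\<^bsub>koszul_algebra m K\<^esub> koszul_monomial m K (I - L) L"
  have "?f ` cochain_basis m K \<subseteq> carrier (add_monoid (koszul_algebra m K))"
    using koszul_monomial_closed cochain_basisD(6) by (auto intro!: E.add.int_pow_closed)
  then obtain h where h: "h \<in> hom (free_Abelian_group (cochain_basis m K)) (add_monoid (koszul_algebra m K))"
    "\<And>b. b \<in> cochain_basis m K \<Longrightarrow> h (frag_of b) = ?f b"
    by (rule comm_group.free_Abelian_group_universal[OF E.a_comm_group]) blast
  have "koszul_comparison m K d d' h"
    using assms h by (simp add: koszul_comparison_def cochains_def)
  then show ?thesis by (rule that)
qed

section \<open>Single, double and total cohomology\<close>

theorem proposition4p5:
  fixes m :: nat and K :: "nat set set" and d d' :: "koszul \<Rightarrow> koszul"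
  assumes "m \<ge> 1"
    and "simplicial_complex_on m K"
    and "is_koszul_d m K d"
    and "is_koszul_d' m K d'"
  shows
    "trivial_group (cohomology (add_monoid (koszul_algebra m K)) d') \<and>
     (K \<noteq> full_simplex m \<longrightarrow>
        trivial_group (cohomology (cochains m K) cochain_d') \<and>
        trivial_group (cohomology (R_group m K) d') \<and>
        trivial_group (second_double_cohomology (cochains m K) (cochain_d K) cochain_d') \<and>
        trivial_group (second_double_cohomology (R_group m K) d d') \<and>
        trivial_group (total_cohomology (cochains m K) (cochain_d K) cochain_d') \<and>
        trivial_group (total_cohomology (R_group m K) d d')) \<and>
     (K = full_simplex m \<longrightarrow>
        (\<forall>n. n \<noteq> 2 * int m \<longrightarrow>
          trivial_group (cochains_cohomology_deg m K n) \<and> trivial_group (R_cohomology_deg m K d' n)) \<and>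
        (let H = cochains_cohomology_deg m K (2 * int m);
             c = cochain_d' ` carrier (cochains_deg m K (2 * int m + 1))
                   #>\<^bsub>cochains_deg m K (2 * int m)\<^esub> cochain_\<alpha> {1..m} {1..m}
         in H \<cong> integer_group \<and> c \<in> carrier H \<and> carrier H = generate H {c}) \<and>
        (let H = R_cohomology_deg m K d' (2 * int m);
             c = d' ` carrier (R_group_deg m K (2 * int m + 1))
                   #>\<^bsub>R_group_deg m K (2 * int m)\<^esub> koszul_monomial m K {} {1..m}
         in H \<cong> integer_group \<and> c \<in> carrier H \<and> carrier H = generate H {c}))"
proof (intro conjI impI allI)
  show "trivial_group (cohomology (add_monoid (koszul_algebra m K)) d')"
    by (rule koszul_d'_cohomology_trivial[OF assms(1,4)])
next
  obtain \<phi> where "koszul_comparison m K d d' \<phi>" by (rule koszul_comparison_exists[OF assms(2-4)])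
  then interpret koszul_comparison m K d d' \<phi> .
  {
    assume K: "K \<noteq> full_simplex m"
    note C = cochains_contractible[OF assms(2) K] and R = R_group_contractible[OF K]
    show "trivial_group (cohomology (cochains m K) cochain_d')" "trivial_group (cohomology (R_group m K) d')"
      by (rule contractible_bicomplex.trivial_cohomology[OF C] contractible_bicomplex.trivial_cohomology[OF R])+
    show "trivial_group (second_double_cohomology (cochains m K) (cochain_d K) cochain_d')"
      "trivial_group (second_double_cohomology (R_group m K) d d')"
      by (rule contractible_bicomplex.trivial_second_double_cohomology[OF C]
        contractible_bicomplex.trivial_second_double_cohomology[OF R])+
    show "trivial_group (total_cohomology (cochains m K) (cochain_d K) cochain_d')"
      "trivial_group (total_cohomology (R_group m K) d d')"
      by (rule contractible_bicomplex.trivial_total_cohomology[OF C]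
        contractible_bicomplex.trivial_total_cohomology[OF R])+
  next
    fix n :: int assume n: "n \<noteq> 2 * int m"
    show "trivial_group (cochains_cohomology_deg m K n)"
      unfolding cochains_cohomology_deg_def
      by (rule trivial_cohomology_at) (simp_all add: cochains_deg_eq[of m K] cochain_d'_hom_deg[unfolded cochains_deg_eq]
        cochain_d'_image_deg[OF n, unfolded cochains_deg_eq])
    show "trivial_group (R_cohomology_deg m K d' n)" by (rule R_cohomology_trivial[OF n])
  next
    assume full: "K = full_simplex m"
    show "let H = cochains_cohomology_deg m K (2 * int m);
             c = cochain_d' ` carrier (cochains_deg m K (2 * int m + 1))
                   #>\<^bsub>cochains_deg m K (2 * int m)\<^esub> cochain_\<alpha> {1..m} {1..m}
         in H \<cong> integer_group \<and> c \<in> carrier H \<and> carrier H = generate H {c}"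
      unfolding Let_def by (rule cochains_top_cohomology[OF full])
    show "let H = R_cohomology_deg m K d' (2 * int m);
             c = d' ` carrier (R_group_deg m K (2 * int m + 1))
                   #>\<^bsub>R_group_deg m K (2 * int m)\<^esub> koszul_monomial m K {} {1..m}
         in H \<cong> integer_group \<and> c \<in> carrier H \<and> carrier H = generate H {c}"
      unfolding Let_def by (rule R_top_cohomology[OF full])
  }
qed

end
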